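(* Let $n>5$ be an integer and let $N$ be the homogeneous norm on the anisotropic Heisenberg group $\mathbb{R}^{2n+1}$ corresponding to the fundamental solution $N^{-2n}$ of the sub-Laplacian. Let $\alpha>0$, $p\ge4$, $0<\beta\le\frac{p-3}{p}$ and $q\ge2$. Let $d\mu=\frac{e^{-\alpha N^{p}}}{Z}\,d\lambda$, where $\lambda$ is Lebesgue measure on $\mathbb{R}^{2n+1}$ and $Z$ is the normalization constant making $\mu$ a probability measure. Then there are positive constants $C$ and $D$, independent of $f$, such that $$\int|f|^{q}\left|\log\left(\frac{|f|^{q}}{\int|f|^{q}d\mu}\right)\right|^{\beta}d\mu\ \le\ C\int|f|^{q}\,d\mu+D\int|\nabla f|^{q}\,d\mu$$ for all locally Lipschitz functions $f$ for which the right-hand side is well defined.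
   Context: The anisotropic Heisenberg group is $\mathbb{R}^{2n+1}$, with points $(x,t)=(x_1,\dots,x_{2n},t)$ and group law $$(x,t)\circ(\eta,\tau)=\Big(x+\eta,\ t+\tau+\tfrac{x_1\eta_{n+1}}{2}-\tfrac{x_{n+1}\eta_1}{2}+\sum_{j=2}^n (x_j\eta_{j+n}-\eta_j x_{j+n})\Big).$$ The sub-gradient is $\nabla=(X_1,\dots,X_{2n})$, where $X_1=\partial_{x_1}-\frac{x_{n+1}}{2}\partial_t$, $X_{n+1}=\partial_{x_{n+1}}+\frac{x_1}{2}\partial_t$, $X_j=\partial_{x_j}-x_{j+n}\partial_t$ for $j=2,\dots,n$, and $X_j=\partial_{x_j}+x_{j-n}\partial_t$ for $j=n+2,\dots,2n$; $|\nabla f|^2=\sum_j (X_jf)^2$; the sub-Laplacian is $\sum_{j=1}^{2n}X_j^2$. The norm $N$ is given explicitly by $$N(x,t)=\frac{\left(B^{2}+t^{2}\right)^{\frac{1}{4n}}\left(AB+t^{2}+A\sqrt{B^{2}+t^{2}}\right)^{\frac{1}{2}-\frac{1}{4n}}}{\left(B+\sqrt{B^{2}+t^{2}}\right)^{\frac{1}{2}}}\quad((x,t)\ne0),\qquad N(0,0)=0,$$ with $A=\frac{x_1^2+x_{n+1}^2}{2}+\frac12\sum_{2\le j\le 2n,\,j\ne n+1}x_j^2$ and $B=\frac{x_1^2+x_{n+1}^2}{4}+\frac12\sum_{2\le j\le 2n,\,j\ne n+1}x_j^2$. The integrand on the left is taken to be $0$ where $f=0$. *)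

theory Defs
  imports "HOL-Analysis.Analysis"
begin

text \<open>
  Points of the group \<open>\<real>\<^bsup>2n+1\<^esup>\<close> are pairs \<open>(x, t)\<close> with
  \<open>x :: real ^ ('n + 'n)\<close> and \<open>n = CARD('n)\<close>. The coordinates \<open>x\<^sub>1, \<dots>, x\<^sub>n\<close> are
  the components \<open>x $ Inl i\<close>, and \<open>x\<^sub>n\<^sub>+\<^sub>1, \<dots>, x\<^sub>2\<^sub>n\<close> are the components \<open>x $ Inr i\<close>.
  The parameter \<open>k :: 'n\<close> is the distinguished index \<open>1\<close>, so that \<open>x\<^sub>1\<close> is
  \<open>x $ Inl k\<close> and \<open>x\<^sub>n\<^sub>+\<^sub>1\<close> is \<open>x $ Inr k\<close>. The ordering of the other indices plays
  no role.
\<close>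

type_synonym 'n heis = "(real ^ ('n + 'n)) \<times> real"

definition twist :: "'n \<Rightarrow> 'n \<Rightarrow> real" where
  "twist k i = (if i = k then 1 / 2 else 1)"

text \<open>The factor \<open>1 / 2\<close> of the term \<open>i = k\<close> in the group law is \<open>twist k k\<close>.\<close>

definition heis_mult :: "'n::finite \<Rightarrow> 'n heis \<Rightarrow> 'n heis \<Rightarrow> 'n heis" where
  "heis_mult k z w =
     (fst z + fst w,
      snd z + snd w +
        (\<Sum>i\<in>UNIV. twist k i * (fst z $ Inl i * fst w $ Inr i - fst w $ Inl i * fst z $ Inr i)))"

text \<open>The coefficient vector of the vector field \<open>X\<^sub>j\<close> at the point \<open>z\<close>.\<close>

definition hvec :: "'n::finite \<Rightarrow> 'n + 'n \<Rightarrow> 'n heis \<Rightarrow> 'n heis" where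
  "hvec k j z =
     (axis j 1,
      case j of Inl i \<Rightarrow> - twist k i * fst z $ Inr i
              | Inr i \<Rightarrow> twist k i * fst z $ Inl i)"

text \<open>
  \<open>X\<^sub>j f\<close> is the derivative of \<open>f\<close> in the direction of the vector field. A locally Lipschitz
  function is differentiable only almost everywhere; where the derivative does not exist, the
  value is set to \<open>0\<close>, which only affects a null set.
\<close>

definition hderiv :: "'n::finite \<Rightarrow> 'n + 'n \<Rightarrow> ('n heis \<Rightarrow> real) \<Rightarrow> 'n heis \<Rightarrow> real" where
  "hderiv k j f z =
     (if (\<lambda>s. f (z + s *\<^sub>R hvec k j z)) differentiable (at 0)
      then deriv (\<lambda>s. f (z + s *\<^sub>R hvec k j z)) 0 else 0)"

definition subgrad_norm :: "'n::finite \<Rightarrow> ('n heis \<Rightarrow> real) \<Rightarrow> 'n heis \<Rightarrow> real" where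
  "subgrad_norm k f z = sqrt (\<Sum>j\<in>UNIV. (hderiv k j f z)\<^sup>2)"

text \<open>
  The line \<open>z + s X\<^sub>j(z)\<close> used above is the integral curve of the left-invariant field \<open>X\<^sub>j\<close>
  through \<open>z\<close>, and at points of differentiability \<open>X\<^sub>j f\<close> is given by the usual combination
  of partial derivatives.
\<close>

lemma heis_mult_axis:
  "heis_mult k z (s *\<^sub>R axis j 1, 0) = z + s *\<^sub>R hvec k j z"
proof (cases j)
  case (Inl i)
  have "(\<Sum>i'\<in>UNIV. twist k i' * (fst z $ Inl i' * (s * axis j 1 $ Inr i')
            - s * axis j 1 $ Inl i' * fst z $ Inr i'))
        = (\<Sum>i'\<in>UNIV. if i' = i then - (s * (twist k i * fst z $ Inr i)) else 0)"
    by (intro sum.cong) (auto simp: Inl axis_def)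
  then show ?thesis
    by (simp add: heis_mult_def hvec_def Inl prod_eq_iff)
next
  case (Inr i)
  have "(\<Sum>i'\<in>UNIV. twist k i' * (fst z $ Inl i' * (s * axis j 1 $ Inr i')
            - s * axis j 1 $ Inl i' * fst z $ Inr i'))
        = (\<Sum>i'\<in>UNIV. if i' = i then s * (twist k i * fst z $ Inl i) else 0)"
    by (intro sum.cong) (auto simp: Inr axis_def)
  then show ?thesis
    by (simp add: heis_mult_def hvec_def Inr prod_eq_iff)
qed

lemma hderiv_eq_partials:
  assumes "(f has_derivative f') (at z)"
  shows "hderiv k j f z = f' (axis j 1, 0) + snd (hvec k j z) * f' (0, 1)"
proof -
  interpret f': bounded_linear f'
    using assms by (rule has_derivative_bounded_linear)
  have line: "((\<lambda>s. z + s *\<^sub>R hvec k j z) has_derivative (\<lambda>s. s *\<^sub>R hvec k j z)) (at 0)"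
    by (auto intro!: derivative_eq_intros)
  have "((\<lambda>s. f (z + s *\<^sub>R hvec k j z)) has_derivative (\<lambda>s. f' (s *\<^sub>R hvec k j z))) (at 0)"
    using has_derivative_compose[OF line, of f f'] assms by simp
  then have D: "((\<lambda>s. f (z + s *\<^sub>R hvec k j z)) has_field_derivative f' (hvec k j z)) (at 0)"
    by (simp add: has_field_derivative_def f'.scaleR mult_commute_abs)
  have "hvec k j z = (axis j 1, 0) + snd (hvec k j z) *\<^sub>R (0, 1)"
    by (simp add: hvec_def)
  then have "f' (hvec k j z) = f' (axis j 1, 0) + snd (hvec k j z) * f' (0, 1)"
    by (metis f'.add f'.scaleR real_scaleR_def)
  with D show ?thesis
    unfolding hderiv_def by (auto dest: DERIV_imp_deriv simp: real_differentiable_def)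
qed

definition heis_A :: "'n::finite \<Rightarrow> 'n heis \<Rightarrow> real" where
  "heis_A k z = ((fst z $ Inl k)\<^sup>2 + (fst z $ Inr k)\<^sup>2) / 2
     + 1 / 2 * (\<Sum>j\<in>UNIV - {Inl k, Inr k}. (fst z $ j)\<^sup>2)"

definition heis_B :: "'n::finite \<Rightarrow> 'n heis \<Rightarrow> real" where
  "heis_B k z = ((fst z $ Inl k)\<^sup>2 + (fst z $ Inr k)\<^sup>2) / 4
     + 1 / 2 * (\<Sum>j\<in>UNIV - {Inl k, Inr k}. (fst z $ j)\<^sup>2)"

definition heis_norm :: "'n::finite \<Rightarrow> 'n heis \<Rightarrow> real" where
  "heis_norm k z =
     (if z = 0 then 0 else
        (let A = heis_A k z; B = heis_B k z; t = snd z; n = real CARD('n) in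
          (B\<^sup>2 + t\<^sup>2) powr (1 / (4 * n))
          * (A * B + t\<^sup>2 + A * sqrt (B\<^sup>2 + t\<^sup>2)) powr (1 / 2 - 1 / (4 * n))
          / (B + sqrt (B\<^sup>2 + t\<^sup>2)) powr (1 / 2)))"

definition heis_Z :: "'n::finite \<Rightarrow> real \<Rightarrow> real \<Rightarrow> real" where
  "heis_Z k \<alpha> p = (\<integral>z. exp (- \<alpha> * heis_norm k z powr p) \<partial>lborel)"

definition heis_measure :: "'n::finite \<Rightarrow> real \<Rightarrow> real \<Rightarrow> 'n heis measure" where
  "heis_measure k \<alpha> p =
     density lborel (\<lambda>z. ennreal (exp (- \<alpha> * heis_norm k z powr p) / heis_Z k \<alpha> p))"

text \<open>Local Lipschitz continuity with respect to the Euclidean distance of \<open>\<real>\<^bsup>2n+1\<^esup>\<close>.\<close>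

definition locally_lipschitz :: "('a::metric_space \<Rightarrow> real) \<Rightarrow> bool" where
  "locally_lipschitz f \<longleftrightarrow> (\<forall>z. \<exists>r>0. \<exists>L. L-lipschitz_on (cball z r) f)"

end

theory Submission imports Defs begin

text \<open>
  Write \<open>U = \<alpha> N\<^sup>p\<close>, \<open>h = |f|\<^sup>q\<close> and \<open>H = q\<^sup>2 (|f|\<^sup>q + |\<nabla>f|\<^sup>q)\<close>, so that \<open>(X\<^sub>j h)\<^sup>2 \<le> h H\<close>;
  everything is proved for such pairs \<open>(h, H)\<close>. With \<open>E = \<Sum> x\<^sub>j X\<^sub>j\<close>, \<open>R = \<Sum> y\<^sub>j X\<^sub>j\<close> (\<open>y\<close> is \<open>x\<close> rotated by a
  quarter turn in every plane) and \<open>P = 1 + B\<^sup>2 + t\<^sup>2\<close>, homogeneity gives \<open>(B E + t R) ln N = B\<close>. Integrating by parts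
  against a combination of \<open>B E + t R\<close> and \<open>- E\<close>, where the latter supplies positivity near the \<open>t\<close>-axis,
  bounds \<open>\<integral> h P\<^bsup>(p-2)/4\<^esup> d\<mu>\<close> by \<open>\<integral> (h + H) d\<mu>\<close>; this controls \<open>\<integral> h U\<^sup>\<beta> d\<mu>\<close>.

  It remains to control the logarithm of the Lebesgue density \<open>u = h exp (- U)\<close>. Every right translation by
  a small element is a composition of a few short horizontal flows, so averaging over small translations changes
  a function \<open>v\<close> in \<open>L\<^sup>1\<close> by at most \<open>5 r \<Sum> \<integral> |X\<^sub>j v|\<close> while the average is at most \<open>r\<^bsup>-2n-2\<^esup> \<integral> v\<close>. Hence
  \<open>\<integral> (v - s)\<^sub>+\<close> decays like a power of \<open>s\<close>. Applied to \<open>v = u P\<^bsup>-p/4\<^esup>\<close>, for which the growth of \<open>|\<nabla>U|\<close> is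
  damped, this bounds a power \<open>v\<^bsup>1+\<epsilon>\<^esup>\<close> and therefore \<open>u ln u\<close> up to a term \<open>u ln P\<close>.
\<close>

section \<open>Almost everywhere differentiability of Lipschitz functions on the line\<close>

text \<open>On functions of \<open>A\<close>, \<open>B\<close> and \<open>t\<close> the field
  \<open>E\<close> acts as 2 A d/dA + 2 B d/dB and \<open>R\<close> as 2 B d/dt, so B E + t R is B
  times the generator of the dilations. The obstacle is the \<open>t\<close>-axis: there every X_j N
  vanishes, so the growth of \<open>U\<close> yields nothing, and B E + t R vanishes as well. The
  field \<open>E\<close> vanishes too, but its divergence is 2 n, and the term 2 n b P^((p-2)/4)
  that it leaves behind fixes the exponent of the bound. As \<open>U\<close> is at most a multiple
  of P^(p/4), the hypothesis on \<beta> places U^\<beta> below a multiple of that weight.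

  The smoothing argument takes place in L^1 and uses only Tonelli and the invariance of Lebesgue
  measure under the flows. Its price is the damping: |grad U| is bounded by a multiple of
  P^((p-1)/4), which exceeds P^((p-2)/4), so the integral of h |grad U| is out of reach and
  \<open>v\<close> must replace \<open>u\<close>.

  Derivatives are taken along flow lines throughout, so a one-dimensional differentiation theorem
  together with Tonelli replaces differentiability in all variables.\<close>

lemma monotone_lipschitz_continuous:
  fixes F :: "real \<Rightarrow> real"
  assumes mono: "\<And>x y. x \<le> y \<Longrightarrow> 0 \<le> F y - F x \<and> F y - F x \<le> y - x"
  shows "continuous_on UNIV F"
  unfolding continuous_on_iff
proof (intro ballI allI impI)
  fix x e :: real assume "e > 0"
  then show "\<exists>d>0. \<forall>x'\<in>UNIV. dist x' x < d \<longrightarrow> dist (F x') (F x) < e"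
    using mono by (intro exI[of _ e]) (smt (verit) dist_real_def)
qed

text \<open>\<open>F\<close> and \<open>x - F x\<close> are both nondecreasing and continuous, so
  their Stieltjes measures add up to the length on every box. As the second summand is nonnegative,
  the measure of \<open>F\<close> is dominated by Lebesgue measure, which gives absolute continuity
  at once.\<close>

lemma interval_measure_add_eq_lborel:
  fixes F :: "real \<Rightarrow> real"
  assumes mono: "\<And>x y. x \<le> y \<Longrightarrow> 0 \<le> F y - F x \<and> F y - F x \<le> y - x"
    and A: "A \<in> sets borel"
  shows "emeasure (interval_measure F) A + emeasure (interval_measure (\<lambda>x. x - F x)) A = emeasure lborel A"
proof -
  let ?G = "\<lambda>x. x - F x"
  define m where "m = (\<lambda>A. emeasure (interval_measure F) A + emeasure (interval_measure ?G) A)"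
  define M where "M = measure_of UNIV (sets borel) m"
  have cF: "continuous_on UNIV F" by (rule monotone_lipschitz_continuous[OF mono])
  then have cG: "continuous_on UNIV ?G" by (intro continuous_intros)
  have mF: "\<And>x y. x \<le> y \<Longrightarrow> F x \<le> F y" and mG: "\<And>x y. x \<le> y \<Longrightarrow> ?G x \<le> ?G y"
    using mono by (smt (verit))+
  have "countably_additive (sets borel) m"
    unfolding countably_additive_def m_def
    by (auto simp: suminf_add[symmetric] suminf_emeasure)
  then have m: "emeasure M A = m A" if "A \<in> sets borel" for A
    unfolding M_def using that
    by (intro emeasure_measure_of_sigma) (auto simp: m_def positive_def sets.sigma_algebra_axioms
        intro: sets.sigma_algebra_axioms[of borel, simplified])
  have "lborel = M"
  proof (rule lborel_eqI)
    show "sets M = sets borel" by (simp add: M_def) (metis sets.sigma_sets_eq space_borel)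
    fix l u :: real assume "\<And>b. b \<in> Basis \<Longrightarrow> l \<bullet> b \<le> u \<bullet> b"
    then have lu: "l \<le> u" by simp
    \<comment> \<open>Stieltjes measures are known on half-open intervals, while Lebesgue measure is
      characterised on open boxes; the endpoint carries no mass because \<open>H\<close> is
      continuous.\<close>
    have i: "emeasure (interval_measure H) (box l u) = ennreal (H u - H l)"
      if "continuous_on UNIV H" "\<And>x y. x \<le> y \<Longrightarrow> H x \<le> H y" for H
    proof -
      have "emeasure (interval_measure H) {l<..u} = emeasure (interval_measure H) (box l u \<union> {u..u})" if "l < u"
        using that by (intro arg_cong[where f="emeasure _"]) auto
      also have "\<dots> = emeasure (interval_measure H) (box l u) + emeasure (interval_measure H) {u..u}"
        by (subst plus_emeasure) auto
      also have "emeasure (interval_measure H) {u..u} = 0"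
        using that by (subst emeasure_interval_measure_Icc) auto
      finally have *: "l < u \<Longrightarrow> emeasure (interval_measure H) {l<..u} = emeasure (interval_measure H) (box l u)"
        by simp
      show ?thesis
      proof (cases "l < u")
        case True
        then show ?thesis using that *
          by (subst *[symmetric], simp, subst emeasure_interval_measure_Ioc)
             (auto simp: continuous_on_eq_continuous_within intro: continuous_at_imp_continuous_at_within)
      next
        case False then have "l = u" using lu by simp
        then show ?thesis by simp
      qed
    qed
    show "emeasure M (box l u) = ennreal (\<Prod>b\<in>Basis. (u - l) \<bullet> b)"
      using lu mono[OF lu] i[OF cF mF] i[OF cG mG]
      by (subst m) (simp_all add: m_def ennreal_plus[symmetric] del: ennreal_plus)
  qed
  then show ?thesis using m[OF A] by (simp add: m_def)
qed

text \<open>Radon-Nikodym applied to the Stieltjes measure of \<open>F\<close>. The density is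
  finite almost everywhere on each bounded interval, so \<open>enn2real\<close> loses nothing under
  the integral.\<close>

lemma monotone_lipschitz_integral_repr:
  fixes F :: "real \<Rightarrow> real"
  assumes mono: "\<And>x y. x \<le> y \<Longrightarrow> 0 \<le> F y - F x \<and> F y - F x \<le> y - x"
  obtains g :: "real \<Rightarrow> real" where "\<And>a b. a \<le> b \<Longrightarrow> (g has_integral (F b - F a)) {a..b}"
proof -
  let ?M = "interval_measure F"
  have "absolutely_continuous lborel ?M"
    unfolding absolutely_continuous_def
  proof
    fix A assume "A \<in> null_sets (lborel :: real measure)"
    then have "A \<in> sets borel" "emeasure lborel A = 0" by auto
    with interval_measure_add_eq_lborel[OF mono, of A] show "A \<in> null_sets ?M"
      by (auto simp: null_sets_def)
  qed
  then obtain f where f [measurable]: "f \<in> borel_measurable lborel" and d: "density lborel f = ?M"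
    using sigma_finite_measure.Radon_Nikodym[OF sigma_finite_lborel, of ?M] by auto
  have cF: "continuous_on UNIV F" by (rule monotone_lipschitz_continuous[OF mono])
  have mF: "\<And>x y. x \<le> y \<Longrightarrow> F x \<le> F y" using mono by (smt (verit))
  have "((\<lambda>x. enn2real (f x)) has_integral (F b - F a)) {a..b}" if "a \<le> b" for a b
  proof -
    have e: "(\<integral>\<^sup>+x. f x * indicator {a..b} x \<partial>lborel) = ennreal (F b - F a)"
      using emeasure_interval_measure_Icc[OF that mF cF] d[symmetric]
      by (simp add: emeasure_density)
    have "AE x in lborel. f x * indicator {a..b} x \<noteq> \<infinity>"
      using e by (intro nn_integral_PInf_AE) auto
    then have "(\<integral>\<^sup>+x. ennreal (enn2real (f x) * indicator {a..b} x) \<partial>lborel) = (\<integral>\<^sup>+x. f x * indicator {a..b} x \<partial>lborel)"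
      by (intro nn_integral_cong_AE) (auto simp: indicator_def less_top elim!: eventually_mono)
    with e have "((\<lambda>x. enn2real (f x) * indicator {a..b} x) has_integral (F b - F a)) UNIV"
      using mF[OF that] by (intro nn_integral_has_integral) auto
    moreover have "(\<lambda>x. enn2real (f x) * indicator {a..b} x) = (\<lambda>x. if x \<in> {a..b} then enn2real (f x) else 0)"
      by auto
    ultimately show ?thesis by (simp only: has_integral_restrict_UNIV)
  qed
  then show ?thesis using that by blast
qed

text \<open>Lebesgue differentiation controls only the averages over \<open>[x, x + h]\<close> with
  h > 0. Averages to the left of \<open>x\<close> are right averages of the reflected integrand at
  \<open>- x\<close>, which is why a second exceptional set \<open>N'\<close> enters through its
  reflection.\<close>

lemma integral_repr_AE_differentiable:
  fixes F g :: "real \<Rightarrow> real"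
  assumes F: "\<And>a b. a \<le> b \<Longrightarrow> (g has_integral (F b - F a)) {a..b}"
  shows "negligible {x. \<not> F differentiable at x}"
proof -
  have g: "g integrable_on cbox a b" for a b
    using F[of a b] by (cases "a \<le> b") (auto simp: integrable_on_def)
  have G: "((\<lambda>x. g (- x)) has_integral (F (-a) - F (-b))) {a..b}" if "a \<le> b" for a b
    using that F[of "-b" "-a"] has_integral_reflect_real[where f=g and a="-b" and b="-a" and i="F (-a) - F (-b)"] by simp
  have g': "(\<lambda>x. g (- x)) integrable_on cbox a b" for a b
    using G[of a b] by (cases "a \<le> b") (auto simp: integrable_on_def)
  obtain N where N: "negligible N" and N1:
       "\<And>x e. \<lbrakk>x \<notin> N; 0 < e\<rbrakk> \<Longrightarrow> \<exists>d>0. \<forall>h. 0 < h \<and> h < d \<longrightarrow>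
                         norm(integral (cbox x (x + h *\<^sub>R One)) g /\<^sub>R h ^ DIM(real) - g x) < e"
    using integrable_ccontinuous_explicit[OF g] by metis
  obtain N' where N': "negligible N'" and N1':
       "\<And>x e. \<lbrakk>x \<notin> N'; 0 < e\<rbrakk> \<Longrightarrow> \<exists>d>0. \<forall>h. 0 < h \<and> h < d \<longrightarrow>
                         norm(integral (cbox x (x + h *\<^sub>R One)) (\<lambda>x. g (- x)) /\<^sub>R h ^ DIM(real) - g (-x)) < e"
    using integrable_ccontinuous_explicit[OF g'] by metis
  have "F differentiable at x" if x: "x \<notin> N" "x \<notin> uminus ` N'" for x
  proof -
    have "((\<lambda>h. (F (x + h) - F x) / h) \<longlongrightarrow> g x) (at 0)"
      unfolding tendsto_iff
    proof (intro allI impI)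
      fix e :: real assume "e > 0"
      obtain d where d: "d > 0" "\<And>h. 0 < h \<Longrightarrow> h < d \<Longrightarrow> \<bar>integral {x..x+h} g / h - g x\<bar> < e"
        using N1[OF x(1) \<open>e > 0\<close>] by (auto simp: divide_inverse_commute)
      have "- x \<notin> N'" using x(2) by force
      then obtain d' where d': "d' > 0" "\<And>h. 0 < h \<Longrightarrow> h < d' \<Longrightarrow> \<bar>integral {-x..-x+h} (\<lambda>x. g (-x)) / h - g x\<bar> < e"
        using N1'[of "-x" e] \<open>e > 0\<close> by (auto simp: divide_inverse_commute)
      have "dist ((F (x + h) - F x) / h) (g x) < e" if "h \<noteq> 0" "\<bar>h\<bar> < min d d'" for h
      proof (cases "h > 0")
        case True
        then have "integral {x..x+h} g = F (x + h) - F x"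
          by (intro integral_unique F) simp
        then show ?thesis using d(2)[of h] True that by (simp add: dist_real_def)
      next
        case False
        have c: "F (h + x) = F (x + h)" by (simp add: add.commute)
        with False have "integral {-x..-x+(-h)} (\<lambda>x. g (-x)) = F x - F (x + h)"
          using G[of "-x" "-x+(-h)"] that by (intro integral_unique) (simp add: c)
        then show ?thesis using d'(2)[of "-h"] False that
          by (simp add: dist_real_def field_simps)
      qed
      then show "\<forall>\<^sub>F h in at 0. dist ((F (x + h) - F x) / h) (g x) < e"
        unfolding eventually_at using d(1) d'(1) by (intro exI[of _ "min d d'"]) auto
    qed
    then have "(F has_real_derivative g x) (at x)" by (simp add: DERIV_def)
    then show ?thesis by (auto simp: real_differentiable_def)
  qed
  then have "{x. \<not> F differentiable at x} \<subseteq> N \<union> uminus ` N'" by auto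
  moreover have "negligible (uminus ` N')"
    using N' by (intro negligible_differentiable_image_negligible) (auto intro!: derivative_intros simp: differentiable_on_def)
  ultimately show ?thesis using N negligible_subset negligible_Un by metis
qed

text \<open>Adding a multiple of the identity makes a Lipschitz function monotone; after rescaling,
  \<open>F\<close> has slopes between 0 and 1.\<close>

lemma lipschitz_AE_differentiable:
  fixes f :: "real \<Rightarrow> real"
  assumes "\<And>x y. \<bar>f x - f y\<bar> \<le> L * \<bar>x - y\<bar>"
  shows "negligible {x. \<not> f differentiable at x}"
proof -
  define K where "K = max L 1"
  have K: "K > 0" by (simp add: K_def)
  define F where "F x = (f x / K + x) / 2" for x
  have "0 \<le> F y - F x \<and> F y - F x \<le> y - x" if "x \<le> y" for x y
  proof -
    have "\<bar>f x - f y\<bar> \<le> K * \<bar>x - y\<bar>"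
      using assms[of x y] by (smt (verit) K_def mult_right_mono abs_ge_zero)
    then have "\<bar>f x / K - f y / K\<bar> \<le> \<bar>x - y\<bar>"
      using K by (simp add: diff_divide_distrib[symmetric] abs_divide divide_le_eq mult.commute)
    moreover have "F y - F x = ((y - x) - (f x / K - f y / K)) / 2"
      by (simp add: F_def field_simps)
    ultimately show ?thesis using that by (auto simp: abs_le_iff)
  qed
  from monotone_lipschitz_integral_repr[OF this] obtain g where
    "\<And>a b. a \<le> b \<Longrightarrow> (g has_integral (F b - F a)) {a..b}" by blast
  from integral_repr_AE_differentiable[OF this] have n: "negligible {x. \<not> F differentiable at x}" .
  have "f = (\<lambda>x. K * (2 * F x - x))" using K by (auto simp: F_def fun_eq_iff field_simps)
  moreover have "(\<lambda>x. K * (2 * F x - x)) differentiable at x" if "F differentiable at x" for x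
    using that by (intro derivative_intros)
  ultimately have "{x. \<not> f differentiable at x} \<subseteq> {x. \<not> F differentiable at x}" by auto
  with n show ?thesis using negligible_subset by blast
qed

section \<open>Translations and horizontal flows\<close>

lemma fst_borel [measurable]: "fst \<in> (borel :: ('a::euclidean_space \<times> 'b::euclidean_space) measure) \<rightarrow>\<^sub>M borel"
  and snd_borel [measurable]: "snd \<in> (borel :: ('a::euclidean_space \<times> 'b::euclidean_space) measure) \<rightarrow>\<^sub>M borel"
  by (auto intro!: borel_measurable_continuous_onI continuous_intros)

lemma nn_integral_lborel_translate:
  fixes h :: "'a::euclidean_space \<Rightarrow> ennreal"
  assumes [measurable]: "h \<in> borel_measurable borel"
  shows "(\<integral>\<^sup>+y. h (a + y) \<partial>lborel) = (\<integral>\<^sup>+y. h y \<partial>lborel)"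
proof -
  have "(\<integral>\<^sup>+y. h y \<partial>lborel) = (\<integral>\<^sup>+y. h y \<partial>distr lborel borel ((+) a))"
    by (simp add: lborel_distr_plus)
  also have "\<dots> = (\<integral>\<^sup>+y. h (a + y) \<partial>lborel)" by (subst nn_integral_distr) auto
  finally show ?thesis by simp
qed

text \<open>Such maps have unit Jacobian: Tonelli, a translation in the second variable for each
  fixed first one, then a translation in the first. Group translations from either side are of this
  form, with \<open>G\<close> collecting the twist.\<close>

lemma nn_integral_lborel_shear:
  fixes f :: "'a::euclidean_space \<times> 'b::euclidean_space \<Rightarrow> ennreal"
  assumes [measurable]: "f \<in> borel_measurable borel" "G \<in> borel_measurable borel"
  shows "(\<integral>\<^sup>+z. f (c + fst z, G (fst z) + snd z) \<partial>lborel) = (\<integral>\<^sup>+z. f z \<partial>lborel)"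
proof -
  have [measurable]: "f \<in> borel_measurable (lborel \<Otimes>\<^sub>M lborel)" by (simp add: lborel_prod)
  have [measurable]: "(\<lambda>z. f (c + fst z, G (fst z) + snd z)) \<in> borel_measurable (lborel \<Otimes>\<^sub>M lborel)"
    unfolding lborel_prod by measurable
  have "(\<integral>\<^sup>+z. f (c + fst z, G (fst z) + snd z) \<partial>lborel)
      = (\<integral>\<^sup>+x. \<integral>\<^sup>+y. f (c + x, G x + y) \<partial>lborel \<partial>lborel)"
    by (subst lborel_prod[symmetric], subst lborel.nn_integral_fst[symmetric]) auto
  also have "\<dots> = (\<integral>\<^sup>+x. \<integral>\<^sup>+y. f (c + x, y) \<partial>lborel \<partial>lborel)"
    by (intro nn_integral_cong nn_integral_lborel_translate) measurable
  also have "\<dots> = (\<integral>\<^sup>+x. \<integral>\<^sup>+y. f (x, y) \<partial>lborel \<partial>lborel)"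
    by (rule nn_integral_lborel_translate[where h = "\<lambda>x. \<integral>\<^sup>+y. f (x, y) \<partial>lborel"]) measurable
  also have "\<dots> = (\<integral>\<^sup>+z. f z \<partial>lborel)"
    by (subst lborel.nn_integral_fst) (auto simp: lborel_prod)
  finally show ?thesis .
qed

section \<open>The horizontal fields and their flows\<close>

definition hw :: "'n \<Rightarrow> 'n + 'n \<Rightarrow> real" where
  "hw k j = (case j of Inl i \<Rightarrow> twist k i | Inr i \<Rightarrow> twist k i)"

text \<open>The vector \<open>y\<close> of the overview. The weights of the group law are kept apart
  in \<open>hw\<close>, so that the \<open>t\<close>-component of X_j is the product of the
  two.\<close>

definition hrot :: "'n::finite heis \<Rightarrow> 'n + 'n \<Rightarrow> real" where
  "hrot z j = (case j of Inl i \<Rightarrow> - fst z $ Inr i | Inr i \<Rightarrow> fst z $ Inl i)"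

definition hflow :: "'n::finite \<Rightarrow> 'n + 'n \<Rightarrow> real \<Rightarrow> 'n heis \<Rightarrow> 'n heis" where
  "hflow k j s z = z + s *\<^sub>R hvec k j z"

lemma hvec_eq: "hvec k j z = (axis j 1, hw k j * hrot z j)"
  by (auto simp: hvec_def hw_def hrot_def split: sum.splits)

lemma hw_simps [simp]: "hw k (Inl i) = twist k i" "hw k (Inr i) = twist k i"
  by (simp_all add: hw_def)

lemma hrot_simps [simp]: "hrot z (Inl i) = - fst z $ Inr i" "hrot z (Inr i) = fst z $ Inl i"
  by (simp_all add: hrot_def)

lemma hw_bounds: "1 / 2 \<le> hw k j" "hw k j \<le> 1"
  by (auto simp: hw_def twist_def split: sum.splits)

text \<open>X_j moves only the coordinate \<open>j\<close> and \<open>t\<close>, while its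
  coefficient reads only the conjugate coordinate. Hence the straight line is the flow line and the
  flows are one-parameter groups.\<close>

lemma hvec_hflow [simp]: "hvec k j (hflow k j s z) = hvec k j z"
  by (auto simp: hvec_eq hflow_def hrot_def axis_def split: sum.splits)

lemma hflow_hflow: "hflow k j s (hflow k j r z) = hflow k j (r + s) z"
  unfolding hflow_def[of k j s] hvec_hflow by (simp add: hflow_def algebra_simps)

lemma hflow_0 [simp]: "hflow k j 0 z = z"
  by (simp add: hflow_def)

lemma hflow_eq_mult: "hflow k j s z = heis_mult k z (s *\<^sub>R axis j 1, 0)"
  by (simp add: hflow_def heis_mult_axis)

lemma heis_mult_assoc: "heis_mult k (heis_mult k a b) c = heis_mult k a (heis_mult k b c)"
  by (simp add: heis_mult_def add.assoc algebra_simps sum.distrib sum_subtractf sum_negf)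

lemma heis_mult_0 [simp]: "heis_mult k z 0 = z"
  by (simp add: heis_mult_def prod_eq_iff)

lemma continuous_heis_mult [continuous_intros]:
  assumes "continuous_on S f" "continuous_on S g"
  shows "continuous_on S (\<lambda>x. heis_mult k (f x) (g x))"
  unfolding heis_mult_def by (intro continuous_intros assms)

lemma borel_measurable_heis_mult [measurable]:
  assumes "f \<in> borel_measurable M" "g \<in> borel_measurable M"
  shows "(\<lambda>x. heis_mult k (f x) (g x)) \<in> borel_measurable M"
proof -
  have "continuous_on UNIV (\<lambda>p. heis_mult k (fst p) (snd p))"
    by (intro continuous_intros)
  from borel_measurable_continuous_Pair[OF assms, of "heis_mult k"] this
  show ?thesis by (simp add: case_prod_beta')
qed

lemma nn_integral_heis_mult:
  assumes "f \<in> borel_measurable borel"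
  shows "(\<integral>\<^sup>+z. f (heis_mult k z w) \<partial>lborel) = (\<integral>\<^sup>+z. f z \<partial>lborel)"
proof -
  define G where "G x = snd w + (\<Sum>i\<in>UNIV. twist k i * (x $ Inl i * fst w $ Inr i - fst w $ Inl i * x $ Inr i))" for x
  have "continuous_on UNIV G" unfolding G_def by (intro continuous_intros)
  then have "G \<in> borel_measurable borel" by (rule borel_measurable_continuous_onI)
  moreover have "heis_mult k z w = (fst w + fst z, G (fst z) + snd z)" for z
    by (simp add: heis_mult_def G_def add.commute add.left_commute)
  ultimately show ?thesis using nn_integral_lborel_shear[OF assms, of G "fst w"] by simp
qed

lemma distr_heis_mult: "distr lborel lborel (\<lambda>z. heis_mult k z w) = lborel"
proof (rule measure_eqI)
  fix A assume "A \<in> sets (distr lborel lborel (\<lambda>z. heis_mult k z w))"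
  then have A [measurable]: "A \<in> sets borel" by simp
  have "emeasure (distr lborel lborel (\<lambda>z. heis_mult k z w)) A = (\<integral>\<^sup>+z. indicator A (heis_mult k z w) \<partial>lborel)"
    by (subst nn_integral_indicator[symmetric], simp, subst nn_integral_distr) auto
  also have "\<dots> = emeasure lborel A" by (subst nn_integral_heis_mult) auto
  finally show "emeasure (distr lborel lborel (\<lambda>z. heis_mult k z w)) A = emeasure lborel A" .
qed simp

lemma borel_measurable_hflow [measurable]: "hflow k j s \<in> borel_measurable borel"
  unfolding hflow_eq_mult by measurable

lemma integral_hflow:
  fixes f :: "'n::finite heis \<Rightarrow> real"
  assumes [measurable]: "f \<in> borel_measurable borel"
  shows "(\<integral>z. f (hflow k j s z) \<partial>lborel) = (\<integral>z. f z \<partial>lborel)"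
  using integral_distr[of "hflow k j s" lborel lborel f] distr_heis_mult[of k "(s *\<^sub>R axis j 1, 0)"]
  by (simp add: hflow_eq_mult[abs_def])

lemma integrable_hflow:
  fixes f :: "'n::finite heis \<Rightarrow> real"
  assumes "integrable lborel f"
  shows "integrable lborel (\<lambda>z. f (hflow k j s z))"
  using assms integrable_distr[of "hflow k j s" lborel lborel f] distr_heis_mult[of k "(s *\<^sub>R axis j 1, 0)"]
  by (simp add: hflow_eq_mult[abs_def])

text \<open>Tonelli in \<open>(z, s)\<close>, since every map of the flow preserves Lebesgue measure.\<close>

lemma AE_along_flow:
  assumes [measurable]: "N \<in> sets borel"
    and ae: "\<And>z. AE s in lborel. hflow k j s z \<notin> N"
  shows "AE z in lborel. z \<notin> N"
proof -
  have m: "(\<lambda>p. hflow k j (snd p) (fst p)) \<in> borel_measurable borel"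
    unfolding hflow_eq_mult by (intro borel_measurable_continuous_onI continuous_intros)
  have m' [measurable]: "(\<lambda>(z, s). indicator N (hflow k j s z) * indicator {0..1::real} s :: ennreal)
      \<in> borel_measurable (lborel \<Otimes>\<^sub>M lborel)"
    using m unfolding lborel_prod by (simp add: case_prod_beta') measurable
  have "0 = (\<integral>\<^sup>+z. \<integral>\<^sup>+s. indicator N (hflow k j s z) * indicator {0..1::real} s \<partial>lborel \<partial>lborel)"
  proof -
    have "(\<integral>\<^sup>+s. indicator N (hflow k j s z) * indicator {0..1::real} s \<partial>lborel) = 0" for z
      using ae[of z] by (subst nn_integral_0_iff_AE)
        (auto elim!: eventually_mono intro!: measurable_compose[OF _ measurable_compose[OF m, of _ borel], of "\<lambda>s. (z, s)", simplified] )
    then show ?thesis by simp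
  qed
  also have "\<dots> = (\<integral>\<^sup>+s. \<integral>\<^sup>+z. indicator N (hflow k j s z) * indicator {0..1::real} s \<partial>lborel \<partial>lborel)"
    by (rule lborel_pair.Fubini'[OF m', symmetric])
  also have "\<dots> = (\<integral>\<^sup>+s. emeasure lborel N * indicator {0..1::real} s \<partial>lborel)"
  proof (intro nn_integral_cong)
    fix s :: real
    have "(\<integral>\<^sup>+z. indicator N (hflow k j s z) \<partial>lborel) = emeasure lborel N"
      unfolding hflow_eq_mult by (subst nn_integral_heis_mult) auto
    then show "(\<integral>\<^sup>+z. indicator N (hflow k j s z) * indicator {0..1::real} s \<partial>lborel) = emeasure lborel N * indicator {0..1} s"
      by (simp add: nn_integral_multc)
  qed
  also have "\<dots> = emeasure lborel N" by (subst nn_integral_cmult_indicator) auto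
  finally have "N \<in> null_sets lborel" by auto
  then show ?thesis by (rule AE_not_in)
qed

section \<open>Measurability and existence of horizontal derivatives\<close>

text \<open>The notion \<open>local_lipschitz\<close> concerns families depending on time; a single
  function is a family over the one time 0.\<close>

lemma locally_lipschitz_on_compact:
  fixes f :: "'a::metric_space \<Rightarrow> real"
  assumes f: "locally_lipschitz f" and K: "compact K"
  obtains L where "L-lipschitz_on K f"
proof -
  have ll: "local_lipschitz {0::real} UNIV (\<lambda>_. f)"
  proof (rule local_lipschitzI)
    fix t :: real and x :: 'a
    obtain r L where "r > 0" "L-lipschitz_on (cball x r) f"
      using f unfolding locally_lipschitz_def by blast
    then show "\<exists>u>0. \<exists>L. \<forall>t\<in>cball t u \<inter> {0}. L-lipschitz_on (cball x u \<inter> UNIV) f" by auto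
  qed
  have "local_lipschitz {0::real} K (\<lambda>_. f)"
    by (rule local_lipschitz_subset[OF ll]) auto
  then show ?thesis
    using local_lipschitz_compact_implies_lipschitz[where X=K and T="{0::real}" and f="\<lambda>_. f"] K that by auto
qed

lemma locally_lipschitz_continuous:
  fixes f :: "'a::metric_space \<Rightarrow> real"
  assumes "locally_lipschitz f"
  shows "continuous_on UNIV f"
proof -
  have "isCont f z" for z
  proof -
    obtain r L where r: "r > 0" "L-lipschitz_on (cball z r) f"
      using assms unfolding locally_lipschitz_def by blast
    then have "continuous_on (cball z r) f" by (intro lipschitz_on_continuous_on)
    moreover have "z \<in> interior (cball z r)"
      using r(1) by (metis ball_subset_cball centre_in_ball interior_maximal open_ball subset_eq)
    ultimately show ?thesis by (rule continuous_on_interior)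
  qed
  then show ?thesis by (simp add: continuous_at_imp_continuous_on)
qed

abbreviation has_hderiv :: "'n::finite \<Rightarrow> 'n + 'n \<Rightarrow> ('n heis \<Rightarrow> real) \<Rightarrow> real \<Rightarrow> 'n heis \<Rightarrow> bool" where
  "has_hderiv k j f d z \<equiv> ((\<lambda>s. f (hflow k j s z)) has_real_derivative d) (at 0)"

definition hdifferentiable :: "'n::finite \<Rightarrow> 'n + 'n \<Rightarrow> ('n heis \<Rightarrow> real) \<Rightarrow> 'n heis \<Rightarrow> bool" where
  "hdifferentiable k j f z \<longleftrightarrow> (\<exists>d. has_hderiv k j f d z)"

lemma hderiv_eqI: "has_hderiv k j f d z \<Longrightarrow> hderiv k j f z = d"
  by (auto simp: hderiv_def hflow_def real_differentiable_def dest: DERIV_imp_deriv)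

lemma has_hderiv_hderiv: "hdifferentiable k j f z \<Longrightarrow> has_hderiv k j f (hderiv k j f z) z"
  unfolding hdifferentiable_def using hderiv_eqI by metis

lemma hderiv_not_hdifferentiable: "\<not> hdifferentiable k j f z \<Longrightarrow> hderiv k j f z = 0"
  by (auto simp: hderiv_def hdifferentiable_def hflow_def real_differentiable_def)

lemma AE_lborel_negligible: "negligible N \<Longrightarrow> AE x in lborel. x \<notin> N"
  by (metis AE_completion_iff AE_not_in negligible_iff_null_sets)

lemma continuous_on_hflow: "continuous_on UNIV (\<lambda>s. hflow k j s z)"
  unfolding hflow_def by (intro continuous_intros)

text \<open>Along one flow line and for bounded times, \<open>f\<close> is Lipschitz in the
  parameter, so the one-dimensional theorem applies; a countable union over the time bounds covers
  the line.\<close>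

lemma AE_hdifferentiable_flow:
  assumes f: "locally_lipschitz f"
  shows "AE s in lborel. hdifferentiable k j f (hflow k j s z)"
proof -
  define \<phi> where "\<phi> s = f (hflow k j s z)" for s
  have "negligible {s. \<not> \<phi> differentiable at s \<and> \<bar>s\<bar> < real n}" for n
  proof -
    define N where "N = real n"
    have "compact ((\<lambda>s. hflow k j s z) ` {-N..N})"
      by (intro compact_continuous_image continuous_on_subset[OF continuous_on_hflow]) auto
    then obtain L where L: "L-lipschitz_on ((\<lambda>s. hflow k j s z) ` {-N..N}) f"
      using locally_lipschitz_on_compact[OF f] by blast
    \<comment> \<open>Clamping the parameter to \<open>[-N, N]\<close> turns the Lipschitz bound on
      a compact piece into a global one without changing the function near times of modulus less
      than \<open>N\<close>.\<close>
    define c where "c s = max (-N) (min N s)" for s :: real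
    have c: "c s \<in> {-N..N}" "\<bar>c s - c t\<bar> \<le> \<bar>s - t\<bar>" for s t
      by (auto simp: c_def N_def)
    have "L \<ge> 0" using L by (rule lipschitz_on_nonneg)
    have "\<bar>\<phi> (c s) - \<phi> (c t)\<bar> \<le> (L * norm (hvec k j z)) * \<bar>s - t\<bar>" for s t
    proof -
      have "\<bar>\<phi> (c s) - \<phi> (c t)\<bar> \<le> L * dist (hflow k j (c s) z) (hflow k j (c t) z)"
        using lipschitz_onD[OF L, of "hflow k j (c s) z" "hflow k j (c t) z"] c(1)
        by (auto simp: \<phi>_def dist_real_def)
      also have "dist (hflow k j (c s) z) (hflow k j (c t) z) = \<bar>c s - c t\<bar> * norm (hvec k j z)"
        by (simp add: hflow_def dist_norm scaleR_left_diff_distrib[symmetric])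
      also have "L * \<dots> \<le> L * (\<bar>s - t\<bar> * norm (hvec k j z))"
        using \<open>L \<ge> 0\<close> c(2) by (intro mult_left_mono mult_right_mono) auto
      finally show ?thesis by (simp add: algebra_simps)
    qed
    then have "negligible {s. \<not> (\<lambda>s. \<phi> (c s)) differentiable at s}"
      by (rule lipschitz_AE_differentiable)
    moreover have "\<phi> differentiable at s" if "(\<lambda>s. \<phi> (c s)) differentiable at s" "\<bar>s\<bar> < N" for s
    proof -
      have "\<forall>\<^sub>F t in nhds s. t \<in> {-N<..<N}"
        using that(2) by (intro eventually_nhds_in_open) auto
      then have "\<forall>\<^sub>F t in nhds s. \<phi> (c t) = \<phi> t"
        by eventually_elim (auto simp: c_def)
      then have "((\<lambda>s. \<phi> (c s)) has_real_derivative D) (at s) = (\<phi> has_real_derivative D) (at s)" for D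
        by (intro DERIV_cong_ev) auto
      then show ?thesis using that(1) by (simp add: real_differentiable_def)
    qed
    ultimately show ?thesis
      by (elim negligible_subset) (auto simp: N_def)
  qed
  then have "negligible (\<Union>n. {s. \<not> \<phi> differentiable at s \<and> \<bar>s\<bar> < real n})"
    by (intro negligible_countable_Union) auto
  also have "(\<Union>n. {s. \<not> \<phi> differentiable at s \<and> \<bar>s\<bar> < real n}) = {s. \<not> \<phi> differentiable at s}"
    using reals_Archimedean2 by auto
  finally have "AE s in lborel. \<phi> differentiable at s"
    by (auto dest: AE_lborel_negligible)
  then show ?thesis
  proof eventually_elim
    case (elim s)
    then obtain d where "(\<phi> has_real_derivative d) (at s)" by (auto simp: real_differentiable_def)
    then have "((\<lambda>x. \<phi> (s + x)) has_real_derivative d) (at 0)" using DERIV_shift[of \<phi> d 0 s] by (simp add: add.commute)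
    then show ?case by (auto simp: hdifferentiable_def \<phi>_def hflow_hflow)
  qed
qed

definition hquot :: "'n::finite \<Rightarrow> 'n + 'n \<Rightarrow> ('n heis \<Rightarrow> real) \<Rightarrow> real \<Rightarrow> 'n heis \<Rightarrow> real" where
  "hquot k j f s z = (f (hflow k j s z) - f z) / s"

lemma has_hderiv_hquot: "has_hderiv k j f d z \<longleftrightarrow> ((\<lambda>s. hquot k j f s z) \<longlongrightarrow> d) (at 0)"
  by (simp add: DERIV_def hquot_def)

text \<open>The limit along one fixed sequence is Borel in \<open>z\<close> whether or not a
  derivative exists, and equals the derivative where there is one. Differentiability can thus be
  tested against a known candidate.\<close>

definition hquot_lim :: "'n::finite \<Rightarrow> 'n + 'n \<Rightarrow> ('n heis \<Rightarrow> real) \<Rightarrow> 'n heis \<Rightarrow> real" where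
  "hquot_lim k j f z = lim (\<lambda>n. hquot k j f (1 / Suc n) z)"

text \<open>Rational times suffice because the difference quotient is continuous in \<open>s\<close>
  away from 0: a violation of the bound at a real time persists at a nearby rational one. The right
  side then consists of countably many Borel conditions.\<close>

lemma hdifferentiable_iff_countable:
  assumes f: "continuous_on UNIV f"
  shows "hdifferentiable k j f z \<longleftrightarrow>
    (\<forall>n::nat. \<exists>m::nat. \<forall>r::rat. r \<noteq> 0 \<and> \<bar>of_rat r\<bar> < 1 / Suc m \<longrightarrow> \<bar>hquot k j f (of_rat r) z - hquot_lim k j f z\<bar> \<le> 1 / Suc n)"
    and "hdifferentiable k j f z \<Longrightarrow> hderiv k j f z = hquot_lim k j f z"
proof -
  have lim: "hquot_lim k j f z = d" if "has_hderiv k j f d z" for d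
  proof -
    have "filterlim (\<lambda>n. 1 / real (Suc n)) (at 0) sequentially"
      unfolding filterlim_at using LIMSEQ_inverse_real_of_nat by (simp add: inverse_eq_divide)
    then have "(\<lambda>n. hquot k j f (1 / Suc n) z) \<longlonglongrightarrow> d"
      using that unfolding has_hderiv_hquot by (rule filterlim_compose[rotated])
    then show ?thesis unfolding hquot_lim_def by (rule limI)
  qed
  then show "hdifferentiable k j f z \<Longrightarrow> hderiv k j f z = hquot_lim k j f z"
    unfolding hdifferentiable_def using hderiv_eqI by metis
  show "hdifferentiable k j f z \<longleftrightarrow>
    (\<forall>n::nat. \<exists>m::nat. \<forall>r::rat. r \<noteq> 0 \<and> \<bar>of_rat r\<bar> < 1 / Suc m \<longrightarrow> \<bar>hquot k j f (of_rat r) z - hquot_lim k j f z\<bar> \<le> 1 / Suc n)"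
    (is "?L = ?R")
  proof
    assume ?L
    then obtain d where d: "has_hderiv k j f d z" by (auto simp: hdifferentiable_def)
    show ?R
    proof
      fix n :: nat
      from d have "((\<lambda>s. hquot k j f s z) \<longlongrightarrow> hquot_lim k j f z) (at 0)" by (simp add: has_hderiv_hquot lim)
      then have "\<exists>e>0. \<forall>s. s \<noteq> 0 \<and> norm (s - 0) < e \<longrightarrow> norm (hquot k j f s z - hquot_lim k j f z) < 1 / Suc n"
        unfolding LIM_eq by (elim allE impE) auto
      then obtain e where e: "e > 0" "\<And>s. s \<noteq> 0 \<Longrightarrow> \<bar>s\<bar> < e \<Longrightarrow> \<bar>hquot k j f s z - hquot_lim k j f z\<bar> < 1 / Suc n"
        by auto
      obtain m where "1 / real (Suc m) < e"
        using reals_Archimedean[OF e(1)] by (auto simp: inverse_eq_divide)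
      then show "\<exists>m::nat. \<forall>r::rat. r \<noteq> 0 \<and> \<bar>of_rat r\<bar> < 1 / Suc m \<longrightarrow> \<bar>hquot k j f (of_rat r) z - hquot_lim k j f z\<bar> \<le> 1 / Suc n"
        by (intro exI[of _ m] allI impI less_imp_le e) auto
    qed
  next
    assume R: ?R
    have cont: "isCont (\<lambda>s. hquot k j f s z) s" if "s \<noteq> 0" for s
    proof -
      have "isCont (\<lambda>s. f (hflow k j s z)) s"
        using continuous_on_compose2[OF f continuous_on_hflow[of k j z]] by (simp add: continuous_on_eq_continuous_at)
      then show ?thesis unfolding hquot_def using that by (intro continuous_intros) auto
    qed
    have "((\<lambda>s. hquot k j f s z) \<longlongrightarrow> hquot_lim k j f z) (at 0)"
      unfolding tendsto_iff
    proof (intro allI impI)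
      fix e :: real assume "e > 0"
      obtain n where n: "1 / real (Suc n) < e"
        using reals_Archimedean[OF \<open>e > 0\<close>] by (auto simp: inverse_eq_divide)
      obtain m where m: "\<And>r. r \<noteq> 0 \<Longrightarrow> \<bar>of_rat r\<bar> < 1 / Suc m \<Longrightarrow> \<bar>hquot k j f (of_rat r) z - hquot_lim k j f z\<bar> \<le> 1 / Suc n"
        using R by blast
      have "\<bar>hquot k j f s z - hquot_lim k j f z\<bar> \<le> 1 / Suc n" if s: "s \<noteq> 0" "\<bar>s\<bar> < 1 / Suc m" for s
      proof (rule ccontr)
        assume "\<not> ?thesis"
        then have *: "1 / Suc n < \<bar>hquot k j f s z - hquot_lim k j f z\<bar>" by simp
        have "((\<lambda>s. \<bar>hquot k j f s z - hquot_lim k j f z\<bar>) \<longlongrightarrow> \<bar>hquot k j f s z - hquot_lim k j f z\<bar>) (nhds s)"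
        proof -
          have "isCont (\<lambda>s. \<bar>hquot k j f s z - hquot_lim k j f z\<bar>) s"
            by (intro continuous_intros cont s)
          then show ?thesis unfolding isCont_def by (subst (asm) tendsto_at_iff_tendsto_nhds)
        qed
        then have "\<forall>\<^sub>F t in nhds s. 1 / Suc n < \<bar>hquot k j f t z - hquot_lim k j f z\<bar>"
          using * by (rule order_tendstoD)
        moreover have "\<forall>\<^sub>F t in nhds s. t \<in> {-1 / Suc m<..<1 / Suc m} - {0}"
          using s by (intro eventually_nhds_in_open) auto
        ultimately have "\<forall>\<^sub>F t in nhds s. 1 / Suc n < \<bar>hquot k j f t z - hquot_lim k j f z\<bar> \<and> t \<noteq> 0 \<and> \<bar>t\<bar> < 1 / Suc m"
          by eventually_elim auto
        then obtain d where d: "d > 0" "\<And>t. dist t s < d \<Longrightarrow> 1 / Suc n < \<bar>hquot k j f t z - hquot_lim k j f z\<bar> \<and> t \<noteq> 0 \<and> \<bar>t\<bar> < 1 / Suc m"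
          unfolding eventually_nhds_metric by blast
        obtain r where r: "s < of_rat r" "of_rat r < s + d"
          using of_rat_dense[of s "s + d"] d(1) by auto
        then show False using d(2)[of "of_rat r"] m[of r] by (auto simp: dist_real_def)
      qed
      then have "s \<noteq> 0 \<Longrightarrow> \<bar>s\<bar> < 1 / Suc m \<Longrightarrow> dist (hquot k j f s z) (hquot_lim k j f z) < e" for s
        using n unfolding dist_real_def by (meson order_le_less_trans)
      then show "\<forall>\<^sub>F s in at 0. dist (hquot k j f s z) (hquot_lim k j f z) < e"
        unfolding eventually_at by (intro exI[of _ "1 / Suc m"]) (auto simp: dist_real_def)
    qed
    then show ?L by (auto simp: hdifferentiable_def has_hderiv_hquot)
  qed
qed

lemma borel_measurable_hquot:
  assumes f: "continuous_on UNIV f"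
  shows "hquot k j f s \<in> borel_measurable borel"
proof -
  have [measurable]: "f \<in> borel_measurable borel" using f by (rule borel_measurable_continuous_onI)
  show ?thesis unfolding hquot_def by measurable
qed

lemma pred_hdifferentiable:
  assumes f: "continuous_on UNIV f"
  shows "Measurable.pred borel (hdifferentiable k j f)"
proof -
  have [measurable]: "\<And>s. hquot k j f s \<in> borel_measurable borel" by (rule borel_measurable_hquot[OF f])
  have [measurable]: "hquot_lim k j f \<in> borel_measurable borel" unfolding hquot_lim_def[abs_def] by measurable
  show ?thesis
    by (subst hdifferentiable_iff_countable(1)[OF f, abs_def]) measurable
qed

lemma borel_measurable_hderiv:
  assumes f: "continuous_on UNIV f"
  shows "hderiv k j f \<in> borel_measurable borel"
proof -
  have [measurable]: "\<And>s. hquot k j f s \<in> borel_measurable borel" by (rule borel_measurable_hquot[OF f])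
  have [measurable]: "hquot_lim k j f \<in> borel_measurable borel" unfolding hquot_lim_def[abs_def] by measurable
  have [measurable]: "Measurable.pred borel (hdifferentiable k j f)" by (rule pred_hdifferentiable[OF f])
  have "hderiv k j f = (\<lambda>z. if hdifferentiable k j f z then hquot_lim k j f z else 0)"
    by (auto simp: fun_eq_iff hdifferentiable_iff_countable(2)[OF f] hderiv_not_hdifferentiable)
  also have "\<dots> \<in> borel_measurable borel" by measurable
  finally show ?thesis .
qed

lemma AE_hdifferentiable:
  assumes f: "locally_lipschitz f"
  shows "AE z in lborel. hdifferentiable k j f z"
proof -
  have "AE z in lborel. z \<notin> {z \<in> space borel. \<not> hdifferentiable k j f z}"
    using pred_hdifferentiable[OF locally_lipschitz_continuous[OF f], of k j]
    by (intro AE_along_flow[of _ k j]) (auto simp: AE_hdifferentiable_flow[OF f])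
  then show ?thesis by simp
qed

section \<open>Functions regular along the horizontal flows\<close>

text \<open>Regularity along the flows only. Unlike Euclidean Lipschitz continuity, this can be checked for
  \<open>exp (- \<alpha> N\<^sup>p)\<close> by differentiating along lines, also through the origin.\<close>

definition hreg :: "'n::finite \<Rightarrow> ('n heis \<Rightarrow> real) \<Rightarrow> bool" where
  "hreg k f \<longleftrightarrow> continuous_on UNIV f \<and>
     (\<forall>j R. \<exists>L. \<forall>z\<in>cball 0 R. \<forall>s. \<bar>s\<bar> \<le> 1 \<longrightarrow> \<bar>f (hflow k j s z) - f z\<bar> \<le> L * \<bar>s\<bar>) \<and>
     (\<forall>j. AE z in lborel. hdifferentiable k j f z)"

lemma hreg_continuous: "hreg k f \<Longrightarrow> continuous_on UNIV f"
  by (simp add: hreg_def)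

lemma hreg_borel: "hreg k f \<Longrightarrow> f \<in> borel_measurable borel"
  by (simp add: hreg_def borel_measurable_continuous_onI)

lemma hreg_AE: "hreg k f \<Longrightarrow> AE z in lborel. hdifferentiable k j f z"
  by (simp add: hreg_def)

lemma hreg_quot:
  assumes "hreg k f"
  obtains L where "\<And>z s. norm z \<le> R \<Longrightarrow> \<bar>s\<bar> \<le> 1 \<Longrightarrow> \<bar>f (hflow k j s z) - f z\<bar> \<le> L * \<bar>s\<bar>"
  using assms unfolding hreg_def by (metis dist_0_norm mem_cball)

lemma abs_hrot_le: "\<bar>hrot z j\<bar> \<le> norm z"
proof -
  have "\<bar>fst z $ i\<bar> \<le> norm z" for i
    using component_le_norm_cart[of "fst z" i] norm_fst_le[of "fst z" "snd z"] by simp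
  then show ?thesis by (auto simp: hrot_def split: sum.splits)
qed

lemma norm_hvec_le: "norm (hvec k j z) \<le> 1 + norm z"
proof -
  have "norm (hvec k j z) \<le> norm (axis j (1::real)) + \<bar>hw k j * hrot z j\<bar>"
    unfolding hvec_eq using norm_Pair_le[of "axis j (1::real)" "hw k j * hrot z j"] by simp
  also have "norm (axis j (1::real)) = 1" by (simp add: norm_axis_1)
  also have "\<bar>hw k j * hrot z j\<bar> \<le> 1 * norm z"
    unfolding abs_mult using hw_bounds[of k j] abs_hrot_le[of z j] by (intro mult_mono) auto
  finally show ?thesis by simp
qed

lemma norm_hflow_le:
  assumes "\<bar>s\<bar> \<le> 1"
  shows "norm (hflow k j s z) \<le> 2 * norm z + 1"
proof -
  have "norm (hflow k j s z) \<le> norm z + \<bar>s\<bar> * norm (hvec k j z)"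
    unfolding hflow_def using norm_triangle_ineq[of z "s *\<^sub>R hvec k j z"] by simp
  also have "\<bar>s\<bar> * norm (hvec k j z) \<le> 1 * (1 + norm z)"
    using assms norm_hvec_le[of k j z] by (intro mult_mono) simp_all
  finally show ?thesis by simp
qed

lemma locally_lipschitz_hreg:
  assumes f: "locally_lipschitz f"
  shows "hreg k f"
  unfolding hreg_def
proof (intro conjI allI)
  show "continuous_on UNIV f" by (rule locally_lipschitz_continuous[OF f])
  show "AE z in lborel. hdifferentiable k j f z" for j by (rule AE_hdifferentiable[OF f])
  fix j R
  obtain L where L: "L-lipschitz_on (cball 0 (2 * R + 1)) f"
    using locally_lipschitz_on_compact[OF f, of "cball 0 (2 * R + 1)"] by auto
  show "\<exists>L. \<forall>z\<in>cball 0 R. \<forall>s. \<bar>s\<bar> \<le> 1 \<longrightarrow> \<bar>f (hflow k j s z) - f z\<bar> \<le> L * \<bar>s\<bar>"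
  proof (intro exI ballI allI impI)
    fix z :: "'a heis" and s :: real assume z: "z \<in> cball 0 R" and s: "\<bar>s\<bar> \<le> 1"
    have "norm (hflow k j s z) \<le> 2 * R + 1" "norm z \<le> 2 * R + 1"
      using norm_hflow_le[OF s, of k j z] z norm_ge_zero[of z] unfolding mem_cball dist_0_norm by linarith+
    then have "\<bar>f (hflow k j s z) - f z\<bar> \<le> L * dist (hflow k j s z) z"
      using lipschitz_onD[OF L, of "hflow k j s z" z] by (simp add: dist_real_def)
    also have "dist (hflow k j s z) z = \<bar>s\<bar> * norm (hvec k j z)" by (simp add: hflow_def dist_norm)
    also have "L * \<dots> \<le> L * (\<bar>s\<bar> * (1 + R))"
      using norm_hvec_le[of k j z] z lipschitz_on_nonneg[OF L] by (intro mult_left_mono) auto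
    finally show "\<bar>f (hflow k j s z) - f z\<bar> \<le> (L * (1 + R)) * \<bar>s\<bar>" by (simp add: algebra_simps)
  qed
qed

lemma continuous_bounded_on_ball:
  fixes f :: "'a::euclidean_space \<Rightarrow> real"
  assumes "continuous_on UNIV f"
  shows "\<exists>M. \<forall>z. norm z \<le> R \<longrightarrow> \<bar>f z\<bar> \<le> M"
proof -
  have "compact (f ` cball 0 R)"
    by (intro compact_continuous_image continuous_on_subset[OF assms]) auto
  then have "\<exists>B. \<forall>z\<in>cball 0 R. \<bar>f z\<bar> \<le> B"
    by (auto simp: bounded_iff dest!: compact_imp_bounded)
  then show ?thesis unfolding Ball_def mem_cball dist_0_norm .
qed

lemma integrable_compact_support:
  fixes f :: "'a::euclidean_space \<Rightarrow> real"
  assumes "continuous_on UNIV f" "\<And>z. norm z > R \<Longrightarrow> f z = 0"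
  shows "integrable lborel f"
proof -
  have "integrable lborel (\<lambda>z. indicator (cball 0 R) z *\<^sub>R f z)"
    by (intro borel_integrable_compact continuous_on_subset[OF assms(1)]) auto
  moreover have "(\<lambda>z. indicator (cball 0 R) z *\<^sub>R f z) = f"
    using assms(2) by (auto simp: fun_eq_iff indicator_def)
  ultimately show ?thesis by simp
qed

text \<open>All parts rest on the invariance of Lebesgue measure under the flow. Difference
  quotients have integral 0 and are dominated, so the derivative has integral 0. For the last
  estimate a flow of time \<open>s\<close> is cut into many equal steps, all with the same L^1
  change, and the step length tends to 0.\<close>

lemma hderiv_integral:
  assumes g: "hreg k g" and supp: "\<And>z. norm z > R \<Longrightarrow> g z = 0"
  shows "integrable lborel (hderiv k j g)"
    and "(\<integral>z. hderiv k j g z \<partial>lborel) = 0"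
    and "(\<integral>\<^sup>+z. ennreal \<bar>g (hflow k j s z) - g z\<bar> \<partial>lborel) \<le> ennreal (\<bar>s\<bar> * (\<integral>z. \<bar>hderiv k j g z\<bar> \<partial>lborel))"
proof -
  note cont = hreg_continuous[OF g]
  have [measurable]: "g \<in> borel_measurable borel" by (rule hreg_borel[OF g])
  have [measurable]: "hderiv k j g \<in> borel_measurable borel" by (rule borel_measurable_hderiv[OF cont])
  have [measurable]: "hquot k j g s \<in> borel_measurable borel" for s by (rule borel_measurable_hquot[OF cont])
  \<comment> \<open>A point outside the ball of radius \<open>R1\<close> cannot reach the support
    within time 1: the reversed flow takes a point of the support to norm at most
    \<open>2 * R + 1\<close>.\<close>
  define R1 where "R1 = 2 * R + 1"
  obtain L where L: "\<And>z s. norm z \<le> R1 \<Longrightarrow> \<bar>s\<bar> \<le> 1 \<Longrightarrow> \<bar>g (hflow k j s z) - g z\<bar> \<le> L * \<bar>s\<bar>"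
    using hreg_quot[OF g] by blast
  define W where "W z = \<bar>L\<bar> * indicator (cball (0::'a heis) (max R R1)) z" for z
  have W: "integrable lborel W"
    unfolding W_def by (intro integrable_mult_right integrable_real_indicator emeasure_bounded_finite bounded_cball) simp
  have dom0: "\<bar>g (hflow k j s z) - g z\<bar> \<le> W z * \<bar>s\<bar>" if s: "\<bar>s\<bar> \<le> 1" for s z
  proof (cases "norm z \<le> R1")
    case True
    then have "\<bar>g (hflow k j s z) - g z\<bar> \<le> L * \<bar>s\<bar>" by (rule L[OF _ s])
    also have "\<dots> \<le> W z * \<bar>s\<bar>" using True by (intro mult_right_mono) (auto simp: W_def)
    finally show ?thesis .
  next
    case False
    have "g (hflow k j s z) = 0"
    proof (rule ccontr)
      assume "g (hflow k j s z) \<noteq> 0"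
      then have "norm (hflow k j s z) \<le> R" using supp not_le by blast
      moreover have "norm (hflow k j (-s) (hflow k j s z)) \<le> 2 * norm (hflow k j s z) + 1"
        using s by (intro norm_hflow_le) simp
      moreover have "hflow k j (-s) (hflow k j s z) = z" by (simp add: hflow_hflow)
      ultimately show False using False by (simp add: R1_def)
    qed
    moreover have "g z = 0 \<or> norm z \<le> R" using supp not_le by blast
    moreover have "norm z \<le> R \<Longrightarrow> False" using False norm_ge_zero[of z] by (simp add: R1_def) 
    ultimately show ?thesis by (auto simp: W_def)
  qed
  have conv: "integrable lborel (hderiv k j g)"
    "(\<lambda>m. \<integral>z. hquot k j g (a m) z \<partial>lborel) \<longlonglongrightarrow> (\<integral>z. hderiv k j g z \<partial>lborel)"
    "(\<lambda>m. \<integral>z. \<bar>hquot k j g (a m) z\<bar> \<partial>lborel) \<longlonglongrightarrow> (\<integral>z. \<bar>hderiv k j g z\<bar> \<partial>lborel)"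
    "\<And>m. integrable lborel (hquot k j g (a m))"
    if a: "\<And>m. a m \<noteq> 0" "\<And>m. \<bar>a m\<bar> \<le> 1" "a \<longlonglongrightarrow> 0" for a :: "nat \<Rightarrow> real"
  proof -
    have lim: "AE z in lborel. (\<lambda>m. hquot k j g (a m) z) \<longlonglongrightarrow> hderiv k j g z"
      using hreg_AE[OF g, of j]
    proof eventually_elim
      case (elim z)
      have "filterlim a (at 0) sequentially" using a by (auto simp: filterlim_at)
      with has_hderiv_hderiv[OF elim] show ?case
        unfolding has_hderiv_hquot by (rule filterlim_compose)
    qed
    have dom: "\<bar>hquot k j g (a m) z\<bar> \<le> W z" for m z
      using dom0[OF a(2)[of m], of z] a(1)[of m] by (simp add: hquot_def divide_le_eq)
    show "integrable lborel (hderiv k j g)"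
      by (rule integrable_dominated_convergence[OF _ _ W lim]) (auto simp: dom)
    show "(\<lambda>m. \<integral>z. hquot k j g (a m) z \<partial>lborel) \<longlonglongrightarrow> (\<integral>z. hderiv k j g z \<partial>lborel)"
      by (rule integral_dominated_convergence[OF _ _ W lim]) (auto simp: dom)
    show "(\<lambda>m. \<integral>z. \<bar>hquot k j g (a m) z\<bar> \<partial>lborel) \<longlonglongrightarrow> (\<integral>z. \<bar>hderiv k j g z\<bar> \<partial>lborel)"
      using lim by (intro integral_dominated_convergence[OF _ _ W]) (auto simp: dom elim!: eventually_mono intro!: tendsto_intros)
    show "integrable lborel (hquot k j g (a m))" for m
      by (rule Bochner_Integration.integrable_bound[OF W]) (use dom in \<open>auto simp: order_trans[OF _ abs_ge_self]\<close>)
  qed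
  have inv: "(\<lambda>m. 1 / real (Suc m)) \<longlonglongrightarrow> 0"
    using LIMSEQ_inverse_real_of_nat by (simp add: inverse_eq_divide)
  note conv1 = conv[of "\<lambda>m. 1 / Suc m", OF _ _ inv, simplified]
  show "integrable lborel (hderiv k j g)" by (rule conv1(1))
  have gint: "integrable lborel g" by (rule integrable_compact_support[OF cont supp])
  have "(\<integral>z. hquot k j g s z \<partial>lborel) = 0" for s
    unfolding hquot_def using gint integrable_hflow[OF gint]
    by (simp add: integral_hflow)
  then show "(\<integral>z. hderiv k j g z \<partial>lborel) = 0"
    using conv1(2) by (simp add: LIMSEQ_const_iff)
  define d where "d s = (\<integral>\<^sup>+z. ennreal \<bar>g (hflow k j s z) - g z\<bar> \<partial>lborel)" for s
  have d_mult: "d (real m * s) \<le> of_nat m * d s" for m s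
  proof (induction m)
    case 0 show ?case by (simp add: d_def)
  next
    case (Suc m)
    have "d (real (Suc m) * s) \<le> (\<integral>\<^sup>+z. ennreal \<bar>g (hflow k j s (hflow k j (m * s) z)) - g (hflow k j (m * s) z)\<bar>
        + ennreal \<bar>g (hflow k j (m * s) z) - g z\<bar> \<partial>lborel)"
      unfolding d_def hflow_hflow
      by (intro nn_integral_mono) (simp add: ennreal_plus[symmetric] algebra_simps del: ennreal_plus)
    also have "\<dots> = d s + d (m * s)"
      unfolding d_def
      using nn_integral_heis_mult[of "\<lambda>z. ennreal \<bar>g (hflow k j s z) - g z\<bar>" k "((m * s) *\<^sub>R axis j 1, 0)"]
      by (subst nn_integral_add) (auto simp flip: hflow_eq_mult)
    also have "\<dots> \<le> d s + of_nat m * d s" using Suc by (intro add_left_mono)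
    finally show ?case by (simp add: algebra_simps)
  qed
  have main: "d s \<le> ennreal (\<bar>s\<bar> * (\<integral>z. \<bar>hderiv k j g z\<bar> \<partial>lborel))" if s: "s \<noteq> 0" for s
  proof -
    \<comment> \<open>The shift by \<open>m0\<close> keeps every step length at most 1 in absolute
      value, the range in which the dominating function \<open>W\<close> is valid.\<close>
    define m0 where "m0 = nat \<lceil>\<bar>s\<bar>\<rceil>"
    have m0: "\<bar>s\<bar> \<le> real m0" by (simp add: m0_def) 
    define a where "a m = s / real (Suc m + m0)" for m
    have a0: "\<And>m. a m \<noteq> 0" and a1: "\<And>m. \<bar>a m\<bar> \<le> 1" using s m0 by (auto simp: a_def divide_le_eq)
    have a2: "a \<longlonglongrightarrow> 0"
      unfolding a_def using LIMSEQ_ignore_initial_segment[OF lim_const_over_n[of s], of "Suc m0"] by (simp add: add.commute)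
    note c = conv[of a, OF a0 a1 a2]
    have le: "d s \<le> ennreal (\<bar>s\<bar> * (\<integral>z. \<bar>hquot k j g (a m) z\<bar> \<partial>lborel))" for m
    proof -
      let ?N = "Suc m + m0"
      have "d s = d (real ?N * a m)" by (simp add: a_def)
      also have "\<dots> \<le> of_nat ?N * d (a m)" by (rule d_mult)
      also have "d (a m) = (\<integral>\<^sup>+z. ennreal (\<bar>a m\<bar> * \<bar>hquot k j g (a m) z\<bar>) \<partial>lborel)"
        unfolding d_def hquot_def using a0[of m] by (simp add: abs_divide)
      also have "\<dots> = ennreal (\<integral>z. \<bar>a m\<bar> * \<bar>hquot k j g (a m) z\<bar> \<partial>lborel)"
        using c(4)[of m] by (intro nn_integral_eq_integral) auto
      also have "of_nat ?N * \<dots> = ennreal (real ?N * (\<integral>z. \<bar>a m\<bar> * \<bar>hquot k j g (a m) z\<bar> \<partial>lborel))"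
        by (simp add: ennreal_mult ennreal_of_nat_eq_real_of_nat)
      also have "real ?N * (\<integral>z. \<bar>a m\<bar> * \<bar>hquot k j g (a m) z\<bar> \<partial>lborel) = \<bar>s\<bar> * (\<integral>z. \<bar>hquot k j g (a m) z\<bar> \<partial>lborel)"
        by (simp add: a_def abs_divide del: of_nat_Suc of_nat_add)
      finally show ?thesis .
    qed
    have "(\<lambda>m. ennreal (\<bar>s\<bar> * (\<integral>z. \<bar>hquot k j g (a m) z\<bar> \<partial>lborel)))
        \<longlonglongrightarrow> ennreal (\<bar>s\<bar> * (\<integral>z. \<bar>hderiv k j g z\<bar> \<partial>lborel))"
      using c(3) by (intro tendsto_intros)
    then show ?thesis by (rule LIMSEQ_le_const) (use le in auto)
  qed
  show "(\<integral>\<^sup>+z. ennreal \<bar>g (hflow k j s z) - g z\<bar> \<partial>lborel) \<le> ennreal (\<bar>s\<bar> * (\<integral>z. \<bar>hderiv k j g z\<bar> \<partial>lborel))"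
    using main[of s] by (cases "s = 0") (auto simp: d_def)
qed

lemma has_hderiv_imp_along:
  assumes "has_hderiv k j f d (hflow k j s z)"
  shows "((\<lambda>s. f (hflow k j s z)) has_real_derivative d) (at s)"
  using assms DERIV_shift[of "\<lambda>s. f (hflow k j s z)" d 0 s]
  by (simp add: hflow_hflow add.commute)

text \<open>The mean value theorem along a flow line of time at most 1, which stays in the ball of
  radius \<open>2 * R + 1\<close>. A local bound on the derivatives is the form in which the
  estimate for \<open>wt\<close> is available.\<close>

lemma hregI:
  assumes cont: "continuous_on UNIV f"
    and D: "\<And>j z. has_hderiv k j f (f' j z) z"
    and bdd: "\<And>j R. \<exists>M. \<forall>z. norm z \<le> R \<longrightarrow> \<bar>f' j z\<bar> \<le> M"
  shows "hreg k f"
  unfolding hreg_def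
proof (intro conjI allI cont)
  fix j
  have "hdifferentiable k j f z" for z using D[of j z] unfolding hdifferentiable_def by (rule exI)
  then show "AE z in lborel. hdifferentiable k j f z" by simp
  fix R
  obtain M where M: "\<And>z. norm z \<le> 2 * R + 1 \<Longrightarrow> \<bar>f' j z\<bar> \<le> M" using bdd by blast
  have "\<bar>f (hflow k j s z) - f z\<bar> \<le> M * \<bar>s\<bar>" if z: "z \<in> cball 0 R" and s: "\<bar>s\<bar> \<le> 1" for z s
  proof -
    have der: "((\<lambda>s. f (hflow k j s z)) has_real_derivative f' j (hflow k j t z)) (at t)" for t
      by (rule has_hderiv_imp_along[OF D])
    have "norm (f (hflow k j s z) - f (hflow k j 0 z)) \<le> M * norm (s - 0)"
    proof (rule field_differentiable_bound[of "cball 0 1"])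
      show "((\<lambda>s. f (hflow k j s z)) has_real_derivative f' j (hflow k j t z)) (at t within cball 0 1)" for t
        by (rule has_field_derivative_at_within[OF der])
      fix t :: real assume "t \<in> cball 0 1"
      then show "norm (f' j (hflow k j t z)) \<le> M"
        using norm_hflow_le[of t k j z] z by (auto intro!: M)
    qed (use s in auto)
    then show ?thesis by simp
  qed
  then show "\<exists>L. \<forall>z\<in>cball 0 R. \<forall>s. \<bar>s\<bar> \<le> 1 \<longrightarrow> \<bar>f (hflow k j s z) - f z\<bar> \<le> L * \<bar>s\<bar>" by blast
qed

lemma hreg_compose:
  fixes \<phi> \<phi>' :: "real \<Rightarrow> real"
  assumes f: "hreg k f"
    and D: "\<And>x. (\<phi> has_real_derivative \<phi>' x) (at x)" and cont': "continuous_on UNIV \<phi>'"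
  shows "hreg k (\<lambda>z. \<phi> (f z))"
  unfolding hreg_def
proof (intro conjI allI)
  have c\<phi>: "continuous_on UNIV \<phi>"
    using D by (meson DERIV_isCont continuous_at_imp_continuous_on)
  show "continuous_on UNIV (\<lambda>z. \<phi> (f z))"
    by (rule continuous_on_compose2[OF c\<phi> hreg_continuous[OF f]]) auto
  fix j
  show "AE z in lborel. hdifferentiable k j (\<lambda>z. \<phi> (f z)) z"
    using hreg_AE[OF f, of j]
    by eventually_elim (auto simp: hdifferentiable_def intro: DERIV_chain2[OF D])
  fix R
  obtain L where L: "\<And>z s. norm z \<le> R \<Longrightarrow> \<bar>s\<bar> \<le> 1 \<Longrightarrow> \<bar>f (hflow k j s z) - f z\<bar> \<le> L * \<bar>s\<bar>"
    using hreg_quot[OF f] by blast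
  obtain B where B: "\<And>z. norm z \<le> 2 * R + 1 \<Longrightarrow> \<bar>f z\<bar> \<le> B"
    using continuous_bounded_on_ball[OF hreg_continuous[OF f]] by blast
  obtain M where M: "\<And>x. \<bar>x\<bar> \<le> B \<Longrightarrow> \<bar>\<phi>' x\<bar> \<le> M"
    using continuous_bounded_on_ball[OF cont', of B] by auto
  show "\<exists>L. \<forall>z\<in>cball 0 R. \<forall>s. \<bar>s\<bar> \<le> 1 \<longrightarrow> \<bar>\<phi> (f (hflow k j s z)) - \<phi> (f z)\<bar> \<le> L * \<bar>s\<bar>"
  proof (intro exI ballI allI impI)
    fix z :: "'a heis" and s :: real assume "z \<in> cball 0 R" and s: "\<bar>s\<bar> \<le> 1"
    then have z: "norm z \<le> R" by simp
    have z': "norm (hflow k j s z) \<le> 2 * R + 1" "norm z \<le> 2 * R + 1"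
      using norm_hflow_le[OF s, of k j z] z norm_ge_zero[of z] by linarith+
    have "norm (\<phi> (f (hflow k j s z)) - \<phi> (f z)) \<le> M * norm (f (hflow k j s z) - f z)"
      by (rule field_differentiable_bound[of "cball 0 B"])
        (use B[OF z'(1)] B[OF z'(2)] M in \<open>auto intro: has_field_derivative_at_within[OF D]\<close>)
    also have "\<dots> \<le> M * (L * \<bar>s\<bar>)"
      using L[OF z s] M[of "f z"] B[OF z'(2)] by (intro mult_left_mono) (auto intro: order_trans[OF abs_ge_zero])
    finally show "\<bar>\<phi> (f (hflow k j s z)) - \<phi> (f z)\<bar> \<le> (M * L) * \<bar>s\<bar>" by (simp add: algebra_simps)
  qed
qed

lemma hreg_add:
  assumes f: "hreg k f" and g: "hreg k g"
  shows "hreg k (\<lambda>z. f z + g z)"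
  unfolding hreg_def
proof (intro conjI allI)
  show "continuous_on UNIV (\<lambda>z. f z + g z)"
    using hreg_continuous[OF f] hreg_continuous[OF g] by (intro continuous_intros)
  fix j
  show "AE z in lborel. hdifferentiable k j (\<lambda>z. f z + g z) z"
    using hreg_AE[OF f, of j] hreg_AE[OF g, of j]
    by eventually_elim (auto simp: hdifferentiable_def intro: DERIV_add)
  fix R
  obtain L where L: "\<And>z s. norm z \<le> R \<Longrightarrow> \<bar>s\<bar> \<le> 1 \<Longrightarrow> \<bar>f (hflow k j s z) - f z\<bar> \<le> L * \<bar>s\<bar>"
    using hreg_quot[OF f] by blast
  obtain M where M: "\<And>z s. norm z \<le> R \<Longrightarrow> \<bar>s\<bar> \<le> 1 \<Longrightarrow> \<bar>g (hflow k j s z) - g z\<bar> \<le> M * \<bar>s\<bar>"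
    using hreg_quot[OF g] by blast
  show "\<exists>L. \<forall>z\<in>cball 0 R. \<forall>s. \<bar>s\<bar> \<le> 1 \<longrightarrow> \<bar>f (hflow k j s z) + g (hflow k j s z) - (f z + g z)\<bar> \<le> L * \<bar>s\<bar>"
  proof (intro exI ballI allI impI)
    fix z :: "'a heis" and s :: real assume "z \<in> cball 0 R" and s: "\<bar>s\<bar> \<le> 1"
    then have z: "norm z \<le> R" by simp
    show "\<bar>f (hflow k j s z) + g (hflow k j s z) - (f z + g z)\<bar> \<le> (L + M) * \<bar>s\<bar>"
      using L[OF z s] M[OF z s] by (simp add: distrib_right)
  qed
qed

text \<open>Polarisation reduces products to sums and squares, hence to \<open>hreg_add\<close> and
  \<open>hreg_compose\<close>.\<close>

lemma hreg_mult:
  assumes f: "hreg k f" and g: "hreg k g"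
  shows "hreg k (\<lambda>z. f z * g z)"
proof -
  have sq: "hreg k (\<lambda>z. c * (h z)\<^sup>2)" if "hreg k h" for h and c :: real
    by (rule hreg_compose[OF that, where \<phi>' = "\<lambda>x. c * (2 * x)"]) (auto intro!: derivative_eq_intros continuous_intros)
  have "hreg k (\<lambda>z. - g z)"
    by (rule hreg_compose[OF g, where \<phi>' = "\<lambda>_. - 1"]) (auto intro!: derivative_eq_intros)
  then have "hreg k (\<lambda>z. 1 / 4 * (f z + g z)\<^sup>2 + (- 1 / 4) * (f z + - g z)\<^sup>2)"
    by (intro hreg_add sq f g)
  moreover have "1 / 4 * (a + b)\<^sup>2 + (- 1 / 4) * (a + - b)\<^sup>2 = a * b" for a b :: real
    by (simp add: power2_eq_square field_simps)
  ultimately show ?thesis by simp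
qed

section \<open>Truncation by averaging over horizontal paths\<close>

text \<open>A modulus of continuity in L^1. Right translations by multiples of the axes are the
  horizontal flows, so this is the quantity that horizontal derivatives control.\<close>

definition rdist :: "'n::finite \<Rightarrow> ('n heis \<Rightarrow> real) \<Rightarrow> 'n heis \<Rightarrow> ennreal" where
  "rdist k v w = (\<integral>\<^sup>+z. ennreal \<bar>v (heis_mult k z w) - v z\<bar> \<partial>lborel)"

lemma rdist_0 [simp]: "rdist k v 0 = 0" "rdist k v (0, 0) = 0"
  using heis_mult_0[of k] by (simp_all add: rdist_def zero_prod_def)

lemma rdist_mult:
  assumes [measurable]: "v \<in> borel_measurable borel"
  shows "rdist k v (heis_mult k w w') \<le> rdist k v w + rdist k v w'"
proof -
  have "rdist k v (heis_mult k w w') \<le>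
     (\<integral>\<^sup>+z. ennreal \<bar>v (heis_mult k (heis_mult k z w) w') - v (heis_mult k z w)\<bar> + ennreal \<bar>v (heis_mult k z w) - v z\<bar> \<partial>lborel)"
    unfolding rdist_def heis_mult_assoc
    by (intro nn_integral_mono) (simp add: ennreal_plus[symmetric] del: ennreal_plus)
  also have "\<dots> = rdist k v w' + rdist k v w"
    unfolding rdist_def
    using nn_integral_heis_mult[of "\<lambda>z. ennreal \<bar>v (heis_mult k z w') - v z\<bar>" k w]
    by (subst nn_integral_add) auto
  finally show ?thesis by (simp add: add.commute)
qed

text \<open>Only the L^1 effect of the flows enters the truncation argument; \<open>K j\<close> will
  be the integral of |X_j v|.\<close>

locale horizontal_modulus =
  fixes k :: "'n::finite" and v :: "'n heis \<Rightarrow> real" and K :: "'n + 'n \<Rightarrow> real"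
  assumes v_borel [measurable]: "v \<in> borel_measurable borel"
    and K_nonneg: "K j \<ge> 0"
    and rdist_axis: "rdist k v (s *\<^sub>R axis j 1, 0) \<le> ennreal (\<bar>s\<bar> * K j)"
begin

text \<open>The span of the \<open>Inl\<close> axes is isotropic for the twist form, and so is that
  of the \<open>Inr\<close> axes. Within one half the axis elements multiply without any
  contribution to \<open>t\<close>, so a vector is reached by one flow per coordinate.\<close>

lemma rdist_half:
  fixes \<iota> :: "'n \<Rightarrow> 'n + 'n"
  assumes \<iota>: "\<iota> = Inl \<or> \<iota> = Inr" and a: "\<And>j. \<bar>a j\<bar> \<le> r" and F: "finite F"
  shows "rdist k v (\<Sum>i\<in>F. a (\<iota> i) *\<^sub>R axis (\<iota> i) 1, 0) \<le> ennreal (r * (\<Sum>i\<in>F. K (\<iota> i)))"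
  using F
proof (induction F)
  case empty then show ?case by simp
next
  case (insert i F)
  let ?b = "\<Sum>i\<in>F. a (\<iota> i) *\<^sub>R axis (\<iota> i) (1::real)"
  have r: "r \<ge> 0" using a[of "Inl i"] by linarith
  have c: "\<iota> = Inl \<Longrightarrow> ?b $ Inr i' = 0" "\<iota> = Inr \<Longrightarrow> ?b $ Inl i' = 0" for i'
    by (simp_all add: axis_def)
  have t: "(\<Sum>i'\<in>UNIV. twist k i' * (?b $ Inl i' * (a (\<iota> i) *\<^sub>R axis (\<iota> i) 1) $ Inr i' -
      (a (\<iota> i) *\<^sub>R axis (\<iota> i) 1) $ Inl i' * ?b $ Inr i')) = 0"
    using \<iota>
  proof
    assume \<iota>: "\<iota> = Inl"
    show ?thesis unfolding c(1)[OF \<iota>] by (simp add: \<iota> axis_def)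
  next
    assume \<iota>: "\<iota> = Inr"
    show ?thesis unfolding c(2)[OF \<iota>] by (simp add: \<iota> axis_def)
  qed
  have "(\<Sum>i\<in>insert i F. a (\<iota> i) *\<^sub>R axis (\<iota> i) 1, 0) = heis_mult k (?b, 0) (a (\<iota> i) *\<^sub>R axis (\<iota> i) (1::real), 0)"
    unfolding heis_mult_def fst_conv snd_conv t using insert.hyps by (simp add: add.commute)
  then have "rdist k v (\<Sum>i\<in>insert i F. a (\<iota> i) *\<^sub>R axis (\<iota> i) 1, 0)
      \<le> rdist k v (?b, 0) + rdist k v (a (\<iota> i) *\<^sub>R axis (\<iota> i) (1::real), 0)"
    by (simp only: rdist_mult[OF v_borel])
  also have "\<dots> \<le> ennreal (r * (\<Sum>i\<in>F. K (\<iota> i))) + ennreal (\<bar>a (\<iota> i)\<bar> * K (\<iota> i))"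
    by (intro add_mono insert.IH rdist_axis)
  also have "\<dots> = ennreal (r * (\<Sum>i\<in>F. K (\<iota> i)) + \<bar>a (\<iota> i)\<bar> * K (\<iota> i))"
    using r K_nonneg by (intro ennreal_plus[symmetric]) (auto intro!: mult_nonneg_nonneg sum_nonneg)
  also have "\<dots> \<le> ennreal (r * (\<Sum>i\<in>F. K (\<iota> i)) + r * K (\<iota> i))"
    using a K_nonneg by (intro ennreal_leI add_left_mono mult_right_mono) auto
  finally show ?case using insert.hyps by (simp add: algebra_simps)
qed

text \<open>The \<open>t\<close>-coordinate created when the \<open>Inl\<close> part of
  \<open>a\<close> is multiplied by its \<open>Inr\<close> part, so that a horizontal path through
  the two parts ends exactly at height \<open>offset a\<close>.\<close>

definition offset :: "(real ^ ('n + 'n)) \<Rightarrow> real" where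
  "offset a = (\<Sum>i\<in>UNIV. twist k i * (a $ Inl i * a $ Inr i))"

text \<open>The target is the product of its \<open>Inl\<close> part, its \<open>Inr\<close> part
  and a central element. The two parts together cost \<open>r\<close> times the sum of
  \<open>K\<close>, and the four flows that produce the central shift cost at most four times as
  much, whence the 5. The twist 1/2 of the distinguished plane is what makes flows of time b shift
  \<open>t\<close> by exactly b^2.\<close>

lemma rdist_le:
  assumes a: "\<And>j. \<bar>fst w $ j\<bar> \<le> r" and \<tau>: "0 \<le> snd w" "snd w \<le> r\<^sup>2" and r: "r \<ge> 0"
  shows "rdist k v (fst w, offset (fst w) + snd w) \<le> ennreal (5 * r * (\<Sum>j\<in>UNIV. K j))"
proof -
  define aL where "aL = (\<Sum>i\<in>UNIV. fst w $ Inl i *\<^sub>R axis (Inl i) (1::real) :: real ^ ('n + 'n))"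
  define aR where "aR = (\<Sum>i\<in>UNIV. fst w $ Inr i *\<^sub>R axis (Inr i) (1::real) :: real ^ ('n + 'n))"
  have delta: "(\<Sum>i\<in>UNIV. f i * (if i = i' then 1 else 0)) = (f i' :: real)" for f and i' :: 'n
    by (simp add: if_distrib[of "\<lambda>x. _ * x"] cong: if_cong)
  have delta': "(\<Sum>i\<in>UNIV. f i * (if i' = i then 1 else 0)) = (f i' :: real)" for f and i' :: 'n
    by (simp add: if_distrib[of "\<lambda>x. _ * x"] cong: if_cong)
  have aL: "aL $ Inl i = fst w $ Inl i" "aL $ Inr i = 0" and aR: "aR $ Inr i = fst w $ Inr i" "aR $ Inl i = 0" for i
    unfolding aL_def aR_def by (simp_all add: axis_def delta delta')
  define \<kappa> where "\<kappa> = (\<Sum>j\<in>UNIV. K j)"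
  have \<kappa>: "\<kappa> = (\<Sum>i\<in>UNIV. K (Inl i)) + (\<Sum>i\<in>UNIV. K (Inr i))"
  proof -
    have "sum K UNIV = sum K (range Inl \<union> range Inr)" by (rule sum.cong[OF UNIV_sum]) auto
    then show ?thesis unfolding \<kappa>_def
      by (subst (asm) sum.union_disjoint) (auto simp: sum.reindex inj_on_def)
  qed
  have K\<kappa>: "K j \<le> \<kappa>" for j unfolding \<kappa>_def by (intro member_le_sum K_nonneg) auto
  have \<kappa>0: "\<kappa> \<ge> 0" using K_nonneg K\<kappa> order_trans by blast
  have "aL + aR = fst w"
  proof (simp only: vec_eq_iff, intro allI)
    fix j show "(aL + aR) $ j = fst w $ j" by (cases j) (auto simp: aL aR)
  qed
  then have 1: "(fst w, offset (fst w)) = heis_mult k (aL, 0) (aR, 0)"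
    by (simp add: heis_mult_def offset_def aL aR)
  have "rdist k v (fst w, offset (fst w)) \<le> rdist k v (aL, 0) + rdist k v (aR, 0)"
    unfolding 1 by (rule rdist_mult[OF v_borel])
  also have "\<dots> \<le> ennreal (r * (\<Sum>i\<in>UNIV. K (Inl i))) + ennreal (r * (\<Sum>i\<in>UNIV. K (Inr i)))"
    unfolding aL_def aR_def
    using rdist_half[of Inl "($) (fst w)" r UNIV] rdist_half[of Inr "($) (fst w)" r UNIV] a
    by (intro add_mono) auto
  also have "\<dots> = ennreal (r * \<kappa>)"
    unfolding \<kappa> using r K_nonneg by (simp add: ennreal_plus[symmetric] distrib_left sum_nonneg del: ennreal_plus)
  finally have A: "rdist k v (fst w, offset (fst w)) \<le> ennreal (r * \<kappa>)" .
  define b where "b = sqrt (snd w)"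
  have b: "0 \<le> b" "b \<le> r" "b\<^sup>2 = snd w"
    using \<tau> r by (auto simp: b_def real_le_lsqrt)
  define e where "e s j = (s *\<^sub>R axis j (1::real) :: real ^ ('n + 'n), 0::real)" for s j
  have s1: "(\<Sum>i\<in>UNIV. twist k i * (f i * (if i = k then c else 0) - g i)) = twist k k * (f k * c) - (\<Sum>i\<in>UNIV. twist k i * g i)" for f g c
  proof -
    have "(\<Sum>i\<in>UNIV. twist k i * (f i * (if i = k then c else 0) - g i)) = (\<Sum>i\<in>UNIV. (if i = k then twist k i * (f i * c) else 0) - twist k i * g i)"
      by (intro sum.cong) (auto simp: algebra_simps)
    then show ?thesis by (simp add: sum_subtractf)
  qed
  have s2: "(\<Sum>i\<in>UNIV. twist k i * (f i - (if i = k then c else 0) * g i)) = (\<Sum>i\<in>UNIV. twist k i * f i) - twist k k * (c * g k)" for f g c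
  proof -
    have "(\<Sum>i\<in>UNIV. twist k i * (f i - (if i = k then c else 0) * g i)) = (\<Sum>i\<in>UNIV. twist k i * f i - (if i = k then twist k i * (c * g i) else 0))"
      by (intro sum.cong) (auto simp: algebra_simps)
    then show ?thesis by (simp add: sum_subtractf)
  qed
  have ax: "(s *\<^sub>R axis j (1::real) :: real ^ ('n + 'n)) $ j' = (if j' = j then s else 0)" for s j j'
    by (auto simp: axis_def)
  have i: "heis_mult k z (e s (Inl k)) = (fst z + s *\<^sub>R axis (Inl k) 1, snd z - 1/2 * (s * fst z $ Inr k))" for z s
    unfolding hflow_eq_mult[symmetric] e_def by (simp add: hflow_def hvec_eq twist_def prod_eq_iff)
  have ii: "heis_mult k z (e s (Inr k)) = (fst z + s *\<^sub>R axis (Inr k) 1, snd z + 1/2 * (s * fst z $ Inl k))" for z s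
    unfolding hflow_eq_mult[symmetric] e_def by (simp add: hflow_def hvec_eq twist_def prod_eq_iff)
  \<comment> \<open>The commutator of the two flows of the distinguished plane moves only \<open>t\<close>, with length \<open>4 b\<close> for a shift of \<open>b\<^sup>2\<close>.\<close>
  have "heis_mult k (heis_mult k (heis_mult k (e b (Inl k)) (e b (Inr k))) (e (-b) (Inl k))) (e (-b) (Inr k)) = (0, b\<^sup>2)"
    unfolding i ii by (simp add: e_def ax axis_def power2_eq_square)
  moreover have step: "rdist k v (heis_mult k w w') \<le> X + rdist k v w'" if "rdist k v w \<le> X" for w w' X
    using rdist_mult[OF v_borel, of k w w'] add_right_mono[OF that] by (rule order_trans)
  ultimately have "rdist k v (0, snd w) \<le> rdist k v (e b (Inl k)) + rdist k v (e b (Inr k)) + rdist k v (e (-b) (Inl k)) + rdist k v (e (-b) (Inr k))"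
    using step[OF step[OF rdist_mult[OF v_borel, of k "e b (Inl k)" "e b (Inr k)"], of "e (-b) (Inl k)"], of "e (-b) (Inr k)"] b(3)
    by simp
  also have "\<dots> \<le> ennreal (r * \<kappa>) + ennreal (r * \<kappa>) + ennreal (r * \<kappa>) + ennreal (r * \<kappa>)"
  proof -
    have "rdist k v (e s j) \<le> ennreal (r * \<kappa>)" if "\<bar>s\<bar> \<le> r" for s j
    proof -
      have "rdist k v (e s j) \<le> ennreal (\<bar>s\<bar> * K j)" unfolding e_def by (rule rdist_axis)
      also have "\<dots> \<le> ennreal (r * \<kappa>)" using that K\<kappa> K_nonneg r by (intro ennreal_leI mult_mono) auto
      finally show ?thesis .
    qed
    then show ?thesis using b by (intro add_mono) auto
  qed
  also have "\<dots> = ennreal (4 * r * \<kappa>)"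
    using r \<kappa>0 by (simp add: ennreal_plus[symmetric] del: ennreal_plus)
  finally have B: "rdist k v (0, snd w) \<le> ennreal (4 * r * \<kappa>)" .
  have "(fst w, offset (fst w) + snd w) = heis_mult k (fst w, offset (fst w)) (0, snd w)"
    by (simp add: heis_mult_def)
  then have "rdist k v (fst w, offset (fst w) + snd w) \<le> ennreal (r * \<kappa>) + ennreal (4 * r * \<kappa>)"
    by (simp only: order_trans[OF rdist_mult[OF v_borel] add_mono[OF A B]])
  also have "\<dots> = ennreal (5 * r * \<kappa>)"
    using r \<kappa>0 by (simp add: ennreal_plus[symmetric] del: ennreal_plus)
  finally show ?thesis unfolding \<kappa>_def .
qed

text \<open>The inequality v(z) <= v(z w) + |v(z w) - v(z)| is integrated over \<open>w\<close> in a
  sheared box of volume r^(2n+2), where the side r^2 in \<open>t\<close> accounts for two powers.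
  The first integral is at most \<open>m\<close>, since the map from \<open>w\<close> to the
  translate preserves Lebesgue measure; any excess over \<open>m\<close> divided by the volume must
  therefore be paid for by the L^1 modulus.\<close>

theorem truncation_bound:
  assumes v0: "\<And>z. v z \<ge> 0" and m: "(\<integral>\<^sup>+z. ennreal (v z) \<partial>lborel) \<le> ennreal m" "m \<ge> 0" and r: "r > 0"
  shows "(\<integral>\<^sup>+z. ennreal (v z - m / r ^ (CARD('n + 'n) + 2)) \<partial>lborel) \<le> ennreal (5 * r * (\<Sum>j\<in>UNIV. K j))"
proof -
  let ?d = "CARD('n + 'n) + 2"
  let ?\<kappa> = "\<Sum>j\<in>UNIV. K j"
  define \<Omega> where "\<Omega> = cbox (0 :: 'n heis) ((\<chi> i. r), r\<^sup>2)"
  have \<Omega>: "\<Omega> = cbox 0 (\<chi> i. r) \<times> cbox 0 (r\<^sup>2)"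
    unfolding \<Omega>_def zero_prod_def by (rule cbox_Pair_eq)
  have [measurable]: "\<Omega> \<in> sets borel" by (simp add: \<Omega>_def)
  have vol: "emeasure lborel \<Omega> = ennreal (r ^ ?d)"
  proof -
    have "emeasure lborel \<Omega> = emeasure (lborel \<Otimes>\<^sub>M lborel) (cbox (0 :: real ^ ('n + 'n)) (\<chi> i. r) \<times> cbox 0 (r\<^sup>2))"
      by (simp add: lborel_prod \<Omega>)
    also have "\<dots> = emeasure lborel (cbox (0 :: real ^ ('n + 'n)) (\<chi> i. r)) * emeasure lborel (cbox 0 (r\<^sup>2))"
      by (intro lborel.emeasure_pair_measure_Times) auto
    also have "emeasure lborel (cbox (0 :: real ^ ('n + 'n)) (\<chi> i. r)) = ennreal (r ^ CARD('n + 'n))"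
      using r by (subst emeasure_lborel_cbox) (auto simp: Basis_vec_def inner_axis axis_eq_axis
          prod.UNION_disjoint UNION_singleton_eq_range prod.reindex inj_on_def)
    also have "emeasure lborel (cbox 0 (r\<^sup>2)) = ennreal (r\<^sup>2)" using r by simp
    finally show ?thesis using r by (simp add: ennreal_mult[symmetric] power_add power2_eq_square)
  qed
  \<comment> \<open>The offset shears the box so that \<open>rdist_le\<close> applies to each of its
    points; volumes are unaffected.\<close>
  define \<gamma> where "\<gamma> w = (fst w, offset (fst w) + snd w)" for w :: "'n heis"
  have off: "offset \<in> borel_measurable borel"
    unfolding offset_def by (intro borel_measurable_continuous_onI continuous_intros)
  have [measurable]: "\<gamma> \<in> borel_measurable borel"
    unfolding \<gamma>_def offset_def by (intro borel_measurable_continuous_onI continuous_intros)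
  define I where "I z = (\<integral>\<^sup>+w. ennreal \<bar>v (heis_mult k z (\<gamma> w)) - v z\<bar> * indicator \<Omega> w \<partial>lborel)" for z
  have inner: "(\<integral>\<^sup>+w. ennreal (v (heis_mult k z (\<gamma> w))) \<partial>lborel) \<le> ennreal m" for z
  proof -
    define G where "G x = snd z + offset x + (\<Sum>i\<in>UNIV. twist k i * (fst z $ Inl i * x $ Inr i - x $ Inl i * fst z $ Inr i))" for x
    have "continuous_on UNIV G" unfolding G_def offset_def by (intro continuous_intros)
    then have "G \<in> borel_measurable borel" by (rule borel_measurable_continuous_onI)
    moreover have "heis_mult k z (\<gamma> w) = (fst z + fst w, G (fst w) + snd w)" for w
      by (simp add: heis_mult_def G_def \<gamma>_def)
    ultimately show ?thesis using nn_integral_lborel_shear[of "\<lambda>z. ennreal (v z)" G "fst z"] m(1) by simp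
  qed
  have pt: "ennreal (r ^ ?d) * ennreal (v z - m / r ^ ?d) \<le> I z" for z
  proof -
    have "ennreal (r ^ ?d * v z) = (\<integral>\<^sup>+w. ennreal (v z) * indicator \<Omega> w \<partial>lborel)"
      using r v0 by (simp add: nn_integral_cmult_indicator vol ennreal_mult mult.commute)
    also have "\<dots> \<le> (\<integral>\<^sup>+w. ennreal (v (heis_mult k z (\<gamma> w))) + ennreal \<bar>v (heis_mult k z (\<gamma> w)) - v z\<bar> * indicator \<Omega> w \<partial>lborel)"
      by (intro nn_integral_mono) (auto simp: indicator_def v0 ennreal_plus[symmetric] simp del: ennreal_plus)
    also have "\<dots> = (\<integral>\<^sup>+w. ennreal (v (heis_mult k z (\<gamma> w))) \<partial>lborel) + I z"
      unfolding I_def by (intro nn_integral_add) auto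
    also have "\<dots> \<le> ennreal m + I z" by (intro add_right_mono inner)
    finally have *: "ennreal (r ^ ?d * v z) \<le> ennreal m + I z" .
    have "ennreal (r ^ ?d) * ennreal (v z - m / r ^ ?d) = ennreal (r ^ ?d * v z - m)"
      using r by (simp add: ennreal_mult'[symmetric] right_diff_distrib)
    also have "\<dots> = ennreal (r ^ ?d * v z) - ennreal m" using m(2) by (simp add: ennreal_minus)
    also have "\<dots> \<le> I z" using * by (simp add: ennreal_minus_le_iff)
    finally show ?thesis .
  qed
  have [measurable]: "(\<lambda>(z, w). ennreal \<bar>v (heis_mult k z (\<gamma> w)) - v z\<bar> * indicator \<Omega> w) \<in> borel_measurable (lborel \<Otimes>\<^sub>M lborel)"
    by measurable
  have "ennreal (r ^ ?d) * (\<integral>\<^sup>+z. ennreal (v z - m / r ^ ?d) \<partial>lborel) = (\<integral>\<^sup>+z. ennreal (r ^ ?d) * ennreal (v z - m / r ^ ?d) \<partial>lborel)"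
    by (intro nn_integral_cmult[symmetric]) measurable
  also have "\<dots> \<le> (\<integral>\<^sup>+z. I z \<partial>lborel)" by (intro nn_integral_mono pt)
  also have "\<dots> = (\<integral>\<^sup>+w. \<integral>\<^sup>+z. ennreal \<bar>v (heis_mult k z (\<gamma> w)) - v z\<bar> * indicator \<Omega> w \<partial>lborel \<partial>lborel)"
    unfolding I_def by (rule lborel_pair.Fubini'[symmetric]) measurable
  also have "\<dots> \<le> (\<integral>\<^sup>+w. ennreal (5 * r * ?\<kappa>) * indicator \<Omega> w \<partial>lborel)"
  proof (intro nn_integral_mono)
    fix w :: "'n heis"
    have "(\<integral>\<^sup>+z. ennreal \<bar>v (heis_mult k z (\<gamma> w)) - v z\<bar> * indicator \<Omega> w \<partial>lborel) = rdist k v (\<gamma> w) * indicator \<Omega> w"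
      unfolding rdist_def by (rule nn_integral_multc) measurable
    also have "\<dots> \<le> ennreal (5 * r * ?\<kappa>) * indicator \<Omega> w"
    proof (cases "w \<in> \<Omega>")
      case True
      then have "0 \<le> fst w $ j \<and> fst w $ j \<le> r" "0 \<le> snd w" "snd w \<le> r\<^sup>2" for j
        unfolding \<Omega> by (auto simp: mem_box_cart)
      then have "rdist k v (\<gamma> w) \<le> ennreal (5 * r * ?\<kappa>)"
        unfolding \<gamma>_def using r by (intro rdist_le) auto
      then show ?thesis by (intro mult_right_mono) auto
    qed simp
    finally show "(\<integral>\<^sup>+z. ennreal \<bar>v (heis_mult k z (\<gamma> w)) - v z\<bar> * indicator \<Omega> w \<partial>lborel) \<le> ennreal (5 * r * ?\<kappa>) * indicator \<Omega> w" .
  qed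
  also have "\<dots> = ennreal (r ^ ?d) * ennreal (5 * r * ?\<kappa>)"
    by (subst nn_integral_cmult_indicator) (simp, simp only: vol mult.commute)
  finally show ?thesis
    using zero_less_power[OF r, of ?d] by (subst (asm) ennreal_mult_le_mult_iff) (simp_all add: ennreal_eq_0_iff del: power_Suc)
qed

end

section \<open>Calculus of the homogeneous norm\<close>

lemma heis_A_eq: "heis_A k z = (\<Sum>j\<in>UNIV. (fst z $ j)\<^sup>2) / 2"
proof -
  have "(\<Sum>j\<in>UNIV. (fst z $ j)\<^sup>2) = (\<Sum>j\<in>insert (Inl k) (insert (Inr k) (UNIV - {Inl k, Inr k})). (fst z $ j)\<^sup>2)"
    by (rule sum.cong) auto
  also have "\<dots> = (fst z $ Inl k)\<^sup>2 + ((fst z $ Inr k)\<^sup>2 + (\<Sum>j\<in>UNIV - {Inl k, Inr k}. (fst z $ j)\<^sup>2))"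
    by (subst sum.insert; simp)
  finally show ?thesis unfolding heis_A_def by simp
qed

lemma heis_B_eq: "heis_B k z = (\<Sum>j\<in>UNIV. hw k j * (fst z $ j)\<^sup>2) / 2"
proof -
  have "(\<Sum>j\<in>UNIV. hw k j * (fst z $ j)\<^sup>2) = (\<Sum>j\<in>insert (Inl k) (insert (Inr k) (UNIV - {Inl k, Inr k})). hw k j * (fst z $ j)\<^sup>2)"
    by (rule sum.cong) auto
  also have "\<dots> = (fst z $ Inl k)\<^sup>2 / 2 + ((fst z $ Inr k)\<^sup>2 / 2 + (\<Sum>j\<in>UNIV - {Inl k, Inr k}. hw k j * (fst z $ j)\<^sup>2))"
    by (subst sum.insert; simp add: twist_def)
  also have "(\<Sum>j\<in>UNIV - {Inl k, Inr k}. hw k j * (fst z $ j)\<^sup>2) = (\<Sum>j\<in>UNIV - {Inl k, Inr k}. (fst z $ j)\<^sup>2)"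
  proof (rule sum.cong[OF refl])
    fix j assume "j \<in> UNIV - {Inl k, Inr k}"
    then show "hw k j * (fst z $ j)\<^sup>2 = (fst z $ j)\<^sup>2" by (cases j) (auto simp: twist_def)
  qed
  finally show ?thesis unfolding heis_B_def by simp
qed

lemma heis_A_nonneg: "heis_A k z \<ge> 0"
  unfolding heis_A_eq by (simp add: sum_nonneg)

lemma heis_B_nonneg: "heis_B k z \<ge> 0"
  unfolding heis_B_eq using hw_bounds[of k] by (auto intro!: sum_nonneg mult_nonneg_nonneg order_trans[OF _ hw_bounds(1)])

lemma heis_B_le_A: "heis_B k z \<le> heis_A k z"
  unfolding heis_A_eq heis_B_eq using hw_bounds(2)[of k]
  by (intro divide_right_mono sum_mono mult_left_le_one_le) (auto intro: order_trans[OF _ hw_bounds(1)])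

lemma heis_A_le_B: "heis_A k z \<le> 2 * heis_B k z"
proof -
  have "(fst z $ j)\<^sup>2 \<le> 2 * (hw k j * (fst z $ j)\<^sup>2)" for j
    using mult_right_mono[OF hw_bounds(1)[of k j], of "(fst z $ j)\<^sup>2"] by simp
  then have "(\<Sum>j\<in>UNIV. (fst z $ j)\<^sup>2) \<le> (\<Sum>j\<in>UNIV. 2 * (hw k j * (fst z $ j)\<^sup>2))"
    by (intro sum_mono)
  then show ?thesis unfolding heis_A_eq heis_B_eq by (simp add: sum_distrib_left)
qed

lemma sum_hx2: "(\<Sum>j\<in>UNIV. hw k j * (fst z $ j)\<^sup>2) = 2 * heis_B k z"
  and sum_x2: "(\<Sum>j\<in>UNIV. (fst z $ j)\<^sup>2) = 2 * heis_A k z"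
  by (simp_all add: heis_A_eq heis_B_eq)

lemma sum_UNIV_plus:
  fixes f :: "'n::finite + 'n \<Rightarrow> real"
  shows "(\<Sum>j\<in>UNIV. f j) = (\<Sum>i\<in>UNIV. f (Inl i)) + (\<Sum>i\<in>UNIV. f (Inr i))"
proof -
  have "sum f UNIV = sum f (range Inl \<union> range Inr)" by (rule sum.cong[OF UNIV_sum]) auto
  then show ?thesis by (subst (asm) sum.union_disjoint) (auto simp: sum.reindex inj_on_def)
qed

text \<open>In every conjugate plane \<open>x\<close> and \<open>y\<close> are orthogonal and of
  equal length, and the weight is constant on each plane.\<close>

lemma sum_hxy: "(\<Sum>j\<in>UNIV. hw k j * (fst z $ j * hrot z j)) = 0"
  and sum_xy: "(\<Sum>j\<in>UNIV. fst z $ j * hrot z j) = 0"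
  and sum_hy2: "(\<Sum>j\<in>UNIV. hw k j * (hrot z j)\<^sup>2) = 2 * heis_B k z"
  and sum_y2: "(\<Sum>j\<in>UNIV. (hrot z j)\<^sup>2) = 2 * heis_A k z"
  unfolding sum_hx2[symmetric] sum_x2[symmetric] sum_UNIV_plus
  by (simp_all add: sum.distrib[symmetric] algebra_simps)

lemma fst_hflow: "fst (hflow k j s z) = fst z + s *\<^sub>R axis j 1"
  and snd_hflow: "snd (hflow k j s z) = snd z + s * (hw k j * hrot z j)"
  by (simp_all add: hflow_def hvec_eq)

lemma fst_hflow_nth: "fst (hflow k j s z) $ i = fst z $ i + (if i = j then s else 0)"
  by (auto simp: fst_hflow axis_def)

lemma sum_sq_update:
  fixes w x :: "'i::finite \<Rightarrow> real"
  shows "(\<Sum>i\<in>UNIV. w i * (x i + (if i = j then s else 0))\<^sup>2) = (\<Sum>i\<in>UNIV. w i * (x i)\<^sup>2) + w j * (2 * s * x j + s\<^sup>2)"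
proof -
  have "(\<Sum>i\<in>UNIV. w i * (x i + (if i = j then s else 0))\<^sup>2)
      = (\<Sum>i\<in>UNIV. w i * (x i)\<^sup>2 + (if i = j then w i * (2 * s * x i + s\<^sup>2) else 0))"
    by (intro sum.cong) (auto simp: power2_eq_square algebra_simps)
  then show ?thesis by (simp add: sum.distrib)
qed

lemma heis_A_hflow: "heis_A k (hflow k j s z) = heis_A k z + (s * fst z $ j + s\<^sup>2 / 2)"
  using sum_sq_update[of "\<lambda>_. 1" "($) (fst z)" j s] by (simp add: heis_A_eq fst_hflow_nth field_simps)

lemma heis_B_hflow: "heis_B k (hflow k j s z) = heis_B k z + hw k j * (s * fst z $ j + s\<^sup>2 / 2)"
  using sum_sq_update[of "hw k" "($) (fst z)" j s] by (simp add: heis_B_eq fst_hflow_nth field_simps)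

lemma has_hderiv_fst: "has_hderiv k j (\<lambda>z. fst z $ i) (if i = j then 1 else 0) z"
  unfolding fst_hflow_nth by (cases "i = j") (auto intro!: derivative_eq_intros)

lemma has_hderiv_snd: "has_hderiv k j snd (hw k j * hrot z j) z"
  unfolding snd_hflow by (auto intro!: derivative_eq_intros)

lemma has_hderiv_A: "has_hderiv k j (heis_A k) (fst z $ j) z"
  unfolding heis_A_hflow by (auto intro!: derivative_eq_intros)

lemma has_hderiv_B: "has_hderiv k j (heis_B k) (hw k j * fst z $ j) z"
  unfolding heis_B_hflow by (auto intro!: derivative_eq_intros)

lemma hrot_hflow [simp]: "hrot (hflow k j s z) j = hrot z j"
  by (cases j) (simp_all add: fst_hflow_nth)

definition hS :: "'n::finite \<Rightarrow> 'n heis \<Rightarrow> real" where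
  "hS k z = sqrt ((heis_B k z)\<^sup>2 + (snd z)\<^sup>2)"

text \<open>A polynomial bounded below by 1. Its real powers are differentiable everywhere and take
  the place of powers of \<open>S\<close> or \<open>N\<close> as weights, for which the origin would
  need separate care.\<close>

definition hP :: "'n::finite \<Rightarrow> 'n heis \<Rightarrow> real" where
  "hP k z = 1 + (heis_B k z)\<^sup>2 + (snd z)\<^sup>2"

lemma hS_nonneg: "hS k z \<ge> 0" by (simp add: hS_def)
lemma hS_sq: "(hS k z)\<^sup>2 = (heis_B k z)\<^sup>2 + (snd z)\<^sup>2" by (simp add: hS_def)
lemma hP_eq: "hP k z = 1 + (hS k z)\<^sup>2" by (simp add: hP_def hS_sq)
lemma hP_ge_1: "hP k z \<ge> 1" by (simp add: hP_def)
lemma hP_pos: "hP k z > 0" using hP_ge_1[of k z] by linarith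

lemma heis_B_le_S: "heis_B k z \<le> hS k z"
  unfolding hS_def by (rule real_le_rsqrt) simp

lemma hS_le_P: "hS k z \<le> hP k z powr (1/2)"
  unfolding hS_def hP_def by (simp add: powr_half_sqrt add_nonneg_nonneg)

lemma heis_A_eq_0: "heis_A k z = 0 \<longleftrightarrow> fst z = 0"
  by (auto simp: heis_A_eq sum_nonneg_eq_0_iff vec_eq_iff)

lemma hS_pos: "z \<noteq> 0 \<Longrightarrow> hS k z > 0"
proof -
  assume z: "z \<noteq> 0"
  have "hS k z \<noteq> 0"
  proof
    assume "hS k z = 0"
    then have "heis_B k z = 0" "snd z = 0" by (simp_all add: hS_def sum_power2_eq_zero_iff)
    then have "heis_A k z = 0" using heis_A_le_B[of k z] heis_A_nonneg[of k z] by linarith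
    then show False using z \<open>snd z = 0\<close> by (simp add: heis_A_eq_0 prod_eq_iff)
  qed
  then show ?thesis using hS_nonneg[of k z] by linarith
qed

text \<open>These follow from B <= S and B <= A <= 2 B. Both factors of the norm formula are thus
  comparable to \<open>S\<close>, and N^2 is comparable to \<open>S\<close>.\<close>

lemma hS_plus_bounds:
  "hS k z \<le> hS k z + heis_B k z" "hS k z + heis_B k z \<le> 2 * hS k z"
  "hS k z \<le> hS k z + heis_A k z - heis_B k z" "hS k z + heis_A k z - heis_B k z \<le> 2 * hS k z"
  using heis_B_nonneg[of k z] heis_B_le_S[of k z] heis_B_le_A[of k z] heis_A_le_B[of k z] by linarith+

lemma abs_fst_le: "\<bar>fst z $ j\<bar> \<le> 2 * hS k z powr (1/2)"
  and abs_hrot_le': "\<bar>hrot z j\<bar> \<le> 2 * hS k z powr (1/2)"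
proof -
  have *: "\<bar>x\<bar> \<le> 2 * hS k z powr (1/2)" if "x\<^sup>2 \<le> 2 * heis_A k z" for x
  proof -
    have "x\<^sup>2 \<le> 4 * hS k z"
      using that heis_A_le_B[of k z] heis_B_le_S[of k z] by linarith
    then have "\<bar>x\<bar> \<le> sqrt (4 * hS k z)" by (simp add: real_le_rsqrt)
    then show ?thesis using hS_nonneg[of k z] by (simp add: real_sqrt_mult powr_half_sqrt)
  qed
  show "\<bar>fst z $ j\<bar> \<le> 2 * hS k z powr (1/2)"
    unfolding sum_x2[of z, symmetric] by (intro *) (auto simp: sum_x2[symmetric] intro!: member_le_sum)
  show "\<bar>hrot z j\<bar> \<le> 2 * hS k z powr (1/2)"
    by (intro *) (auto simp: sum_y2[symmetric] intro!: member_le_sum)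
qed

lemma continuous_A [continuous_intros]: "continuous_on S f \<Longrightarrow> continuous_on S (\<lambda>x. heis_A k (f x))"
  unfolding heis_A_eq by (intro continuous_intros) auto
lemma continuous_B [continuous_intros]: "continuous_on S f \<Longrightarrow> continuous_on S (\<lambda>x. heis_B k (f x))"
  unfolding heis_B_eq by (intro continuous_intros) auto
lemma continuous_hS [continuous_intros]: "continuous_on S f \<Longrightarrow> continuous_on S (\<lambda>x. hS k (f x))"
  unfolding hS_def by (intro continuous_intros)
lemma continuous_hP [continuous_intros]: "continuous_on S f \<Longrightarrow> continuous_on S (\<lambda>x. hP k (f x))"
  unfolding hP_def by (intro continuous_intros)

section \<open>Horizontal derivatives of P, S and ln N\<close>

definition dP :: "'n::finite \<Rightarrow> 'n + 'n \<Rightarrow> 'n heis \<Rightarrow> real" where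
  "dP k j z = 2 * (heis_B k z * (hw k j * fst z $ j) + snd z * (hw k j * hrot z j))"

lemma has_hderiv_P: "has_hderiv k j (hP k) (dP k j z) z"
  unfolding hP_def dP_def by (rule derivative_eq_intros has_hderiv_B has_hderiv_snd refl | simp)+

lemma has_hderiv_S:
  assumes "z \<noteq> 0"
  shows "has_hderiv k j (hS k) ((heis_B k z * (hw k j * fst z $ j) + snd z * (hw k j * hrot z j)) / hS k z) z"
proof -
  have pos: "(heis_B k z)\<^sup>2 + (snd z)\<^sup>2 > 0" using hS_pos[OF assms, of k] by (simp add: hS_def)
  have D: "has_hderiv k j (\<lambda>z. (heis_B k z)\<^sup>2 + (snd z)\<^sup>2)
      (2 * (heis_B k z * (hw k j * fst z $ j) + snd z * (hw k j * hrot z j))) z"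
    by (rule derivative_eq_intros has_hderiv_B has_hderiv_snd refl | simp)+
  have "has_hderiv k j (\<lambda>z. sqrt ((heis_B k z)\<^sup>2 + (snd z)\<^sup>2))
      (inverse (sqrt ((heis_B k z)\<^sup>2 + (snd z)\<^sup>2)) / 2 * (2 * (heis_B k z * (hw k j * fst z $ j) + snd z * (hw k j * hrot z j)))) z"
    using DERIV_chain2[where f=sqrt and x=0 and s=UNIV and g="\<lambda>s. (heis_B k (hflow k j s z))\<^sup>2 + (snd (hflow k j s z))\<^sup>2", OF DERIV_real_sqrt D] pos
    by (simp only: hflow_0 simp_thms)
  moreover have "inverse s / 2 * (2 * c) = c / s" for s c :: real by (simp add: inverse_eq_divide)
  ultimately show ?thesis unfolding hS_def by (simp only:)
qed

text \<open>The logarithm of \<open>N\<close>, in the factorised form given by \<open>AB + t\<^sup>2 + AS = (S + B) (S + A - B)\<close>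
  with \<open>S = hS k z\<close>.\<close>

definition lnN :: "'n::finite \<Rightarrow> 'n heis \<Rightarrow> real" where
  "lnN k z = 1 / (2 * real CARD('n)) * ln (hS k z) - 1 / (4 * real CARD('n)) * ln (hS k z + heis_B k z)
     + (1 / 2 - 1 / (4 * real CARD('n))) * ln (hS k z + heis_A k z - heis_B k z)"

lemma heis_norm_eq_exp:
  fixes z :: "'n::finite heis"
  assumes "z \<noteq> 0"
  shows "heis_norm k z = exp (lnN k z)"
proof -
  define n where "n = real CARD('n)"
  define S where "S = hS k z"
  define A where "A = heis_A k z"
  define B where "B = heis_B k z"
  have S: "S > 0" using hS_pos[OF assms] by (simp add: S_def)
  have pos: "S + B > 0" "S + A - B > 0" using S hS_plus_bounds[of k z] by (simp_all add: A_def B_def S_def)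
  have t2: "(snd z)\<^sup>2 = S\<^sup>2 - B\<^sup>2" and BS: "B\<^sup>2 + (snd z)\<^sup>2 = S\<^sup>2" by (simp_all add: S_def B_def hS_sq)
  have f: "A * B + (snd z)\<^sup>2 + A * S = (S + B) * (S + A - B)"
    unfolding t2 by (simp add: algebra_simps power2_eq_square)
  have "heis_norm k z = (S\<^sup>2) powr (1 / (4 * n)) * ((S + B) * (S + A - B)) powr (1 / 2 - 1 / (4 * n)) / (S + B) powr (1/2)"
  proof -
    have sq: "sqrt (B\<^sup>2 + (snd z)\<^sup>2) = S" by (simp add: S_def hS_def B_def)
    have "heis_norm k z = (B\<^sup>2 + (snd z)\<^sup>2) powr (1 / (4 * n)) *
        (A * B + (snd z)\<^sup>2 + A * sqrt (B\<^sup>2 + (snd z)\<^sup>2)) powr (1 / 2 - 1 / (4 * n)) / (B + sqrt (B\<^sup>2 + (snd z)\<^sup>2)) powr (1/2)"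
      by (simp add: heis_norm_def Let_def assms A_def B_def n_def)
    then show ?thesis by (simp only: sq) (simp only: f BS add.commute[of B S])
  qed
  also have "\<dots> = exp (lnN k z)"
  proof -
    have l: "ln (S\<^sup>2) = 2 * ln S" "ln ((S + B) * (S + A - B)) = ln (S + B) + ln (S + A - B)"
      using S pos by (simp_all add: ln_mult ln_realpow)
    have nz: "S\<^sup>2 \<noteq> 0" "(S + B) * (S + A - B) \<noteq> 0" "S + B \<noteq> 0" using S pos by auto
    have "(S\<^sup>2) powr (1 / (4 * n)) * ((S + B) * (S + A - B)) powr (1 / 2 - 1 / (4 * n)) / (S + B) powr (1/2)
        = exp (1 / (4 * n) * (2 * ln S) + (1 / 2 - 1 / (4 * n)) * (ln (S + B) + ln (S + A - B)) - 1 / 2 * ln (S + B))"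
      unfolding powr_def l exp_diff exp_add using nz by (simp only: if_False)
    also have "1 / (4 * n) * (2 * ln S) + (1 / 2 - 1 / (4 * n)) * (ln (S + B) + ln (S + A - B)) - 1 / 2 * ln (S + B)
        = 1 / (2 * n) * ln S - 1 / (4 * n) * ln (S + B) + (1 / 2 - 1 / (4 * n)) * ln (S + A - B)"
      by (simp add: algebra_simps)
    finally show ?thesis unfolding lnN_def S_def A_def B_def n_def by simp
  qed
  finally show ?thesis .
qed

definition dlnN :: "'n::finite \<Rightarrow> 'n + 'n \<Rightarrow> 'n heis \<Rightarrow> real" where
  "dlnN k j z = (let x = fst z $ j; \<beta> = hw k j * fst z $ j; \<sigma> = (heis_B k z * \<beta> + snd z * (hw k j * hrot z j)) / hS k z in
     1 / (2 * real CARD('n)) * (\<sigma> / hS k z) - 1 / (4 * real CARD('n)) * ((\<sigma> + \<beta>) / (hS k z + heis_B k z))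
     + (1 / 2 - 1 / (4 * real CARD('n))) * ((\<sigma> + x - \<beta>) / (hS k z + heis_A k z - heis_B k z)))"

lemma has_hderiv_ln:
  assumes D: "has_hderiv k j f d z" and pos: "f z > 0"
  shows "has_hderiv k j (\<lambda>z. ln (f z)) (d / f z) z"
  using DERIV_chain2[where f=ln and x=0 and s=UNIV and g="\<lambda>s. f (hflow k j s z)", OF DERIV_ln_divide D] pos by simp

lemma has_hderiv_lnN:
  assumes "z \<noteq> 0"
  shows "has_hderiv k j (lnN k) (dlnN k j z) z"
proof -
  have pos: "hS k z > 0" "hS k z + heis_B k z > 0" "hS k z + heis_A k z - heis_B k z > 0"
    using hS_pos[OF assms, of k] hS_plus_bounds[of k z] by linarith+
  show ?thesis
    unfolding lnN_def dlnN_def Let_def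
    by (intro DERIV_add DERIV_diff DERIV_cmult has_hderiv_ln has_hderiv_S[OF assms] has_hderiv_A has_hderiv_B pos)
qed

lemma dlnN_aux:
  fixes S U V c1 c2 \<kappa> :: real
  defines "q \<equiv> c1 / S - c2 / U + \<kappa> / V"
  shows "c1 * ((B * \<beta> + t * \<tau>) / S / S) - c2 * (((B * \<beta> + t * \<tau>) / S + \<beta>) / U) + \<kappa> * (((B * \<beta> + t * \<tau>) / S + x - \<beta>) / V)
    = (B / S * q - c2 / U - \<kappa> / V) * \<beta> + \<kappa> / V * x + t / S * q * \<tau>"
  unfolding q_def divide_inverse by algebra

text \<open>Regrouped so that \<open>j\<close> occurs only in the three vectors hw x, x and hw y.
  Pairing with \<open>x\<close> or \<open>y\<close> then reduces to the sums 2 A, 2 B and 0.\<close>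

lemma dlnN_eq:
  fixes k :: "'n::finite" and z :: "'n heis"
  defines "c1 \<equiv> 1 / (2 * real CARD('n))" and "c2 \<equiv> 1 / (4 * real CARD('n))"
  defines "\<kappa> \<equiv> 1 / 2 - c2"
  defines "q \<equiv> c1 / hS k z - c2 / (hS k z + heis_B k z) + \<kappa> / (hS k z + heis_A k z - heis_B k z)"
  shows "dlnN k j z = (heis_B k z / hS k z * q - c2 / (hS k z + heis_B k z) - \<kappa> / (hS k z + heis_A k z - heis_B k z)) * (hw k j * fst z $ j)
     + \<kappa> / (hS k z + heis_A k z - heis_B k z) * fst z $ j + snd z / hS k z * q * (hw k j * hrot z j)"
  unfolding dlnN_def Let_def q_def \<kappa>_def c1_def c2_def by (rule dlnN_aux)

text \<open>The first part is Euler's relation for \<open>N\<close>, of degree 1 under dilations.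
  The second keeps a factor \<open>B\<close>, so the field \<open>- E\<close> does damage only in
  proportion to \<open>B\<close>, which vanishes on the \<open>t\<close>-axis. The third is the size
  expected of a gradient of degree -1, as \<open>S\<close> has degree 2.\<close>

lemma
  fixes z :: "'n::finite heis"
  assumes "z \<noteq> 0"
  shows euler_lnN: "(\<Sum>j\<in>UNIV. (heis_B k z * fst z $ j + snd z * hrot z j) * dlnN k j z) = heis_B k z"
    and radial_lnN: "(\<Sum>j\<in>UNIV. fst z $ j * dlnN k j z) \<le> 2 * heis_B k z / hS k z"
    and abs_dlnN_le: "\<bar>dlnN k j z\<bar> \<le> 20 * hS k z powr (1/2) / hS k z"
proof -
  define n where "n = real CARD('n)"
  define c1 where "c1 = 1 / (2 * n)"
  define c2 where "c2 = 1 / (4 * n)"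
  define \<kappa> where "\<kappa> = 1 / 2 - c2"
  define S where "S = hS k z"
  define A where "A = heis_A k z"
  define B where "B = heis_B k z"
  define t where "t = snd z"
  define q where "q = c1 / S - c2 / (S + B) + \<kappa> / (S + A - B)"
  define l1 where "l1 = B / S * q - c2 / (S + B) - \<kappa> / (S + A - B)"
  define l2 where "l2 = \<kappa> / (S + A - B)"
  define l3 where "l3 = t / S * q"
  have n: "n \<ge> 1" by (simp add: n_def Suc_leI)
  have c: "c1 = 2 * c2" "0 < c2" "c2 \<le> 1/4" "\<kappa> = 1/2 - c2" using n by (auto simp: c1_def c2_def \<kappa>_def field_simps)
  have S: "S > 0" using hS_pos[OF assms] by (simp add: S_def)
  have bd: "0 \<le> B" "B \<le> S" "B \<le> A" "A \<le> 2 * B"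
    using heis_B_nonneg[of k z] heis_B_le_S[of k z] heis_B_le_A[of k z] heis_A_le_B[of k z] by (simp_all add: S_def A_def B_def)
  have t2: "t * t = S * S - B * B" using hS_sq[of k z] by (simp add: S_def B_def t_def power2_eq_square)
  have eq: "dlnN k j z = l1 * (hw k j * fst z $ j) + l2 * fst z $ j + l3 * (hw k j * hrot z j)" for j
    using dlnN_eq[of k j z]
    unfolding l1_def l2_def l3_def q_def S_def A_def B_def t_def c1_def c2_def \<kappa>_def n_def .
  have 1: "(\<Sum>j\<in>UNIV. fst z $ j * dlnN k j z) = 2 * B * l1 + 2 * A * l2"
  proof -
    have "(\<Sum>j\<in>UNIV. fst z $ j * dlnN k j z) = l1 * (\<Sum>j\<in>UNIV. hw k j * (fst z $ j)\<^sup>2) + l2 * (\<Sum>j\<in>UNIV. (fst z $ j)\<^sup>2)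
        + l3 * (\<Sum>j\<in>UNIV. hw k j * (fst z $ j * hrot z j))"
      unfolding eq sum_distrib_left sum.distrib[symmetric] by (intro sum.cong) (auto simp: power2_eq_square algebra_simps)
    then show ?thesis by (simp add: sum_hx2 sum_x2[of _ k] sum_hxy A_def B_def)
  qed
  have 2: "(\<Sum>j\<in>UNIV. hrot z j * dlnN k j z) = 2 * B * l3"
  proof -
    have "(\<Sum>j\<in>UNIV. hrot z j * dlnN k j z) = l1 * (\<Sum>j\<in>UNIV. hw k j * (fst z $ j * hrot z j)) + l2 * (\<Sum>j\<in>UNIV. fst z $ j * hrot z j)
        + l3 * (\<Sum>j\<in>UNIV. hw k j * (hrot z j)\<^sup>2)"
      unfolding eq sum_distrib_left sum.distrib[symmetric] by (intro sum.cong) (auto simp: power2_eq_square algebra_simps)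
    then show ?thesis by (simp add: sum_hy2 sum_xy sum_hxy B_def)
  qed
  have "(\<Sum>j\<in>UNIV. (heis_B k z * fst z $ j + snd z * hrot z j) * dlnN k j z)
      = B * (\<Sum>j\<in>UNIV. fst z $ j * dlnN k j z) + t * (\<Sum>j\<in>UNIV. hrot z j * dlnN k j z)"
    unfolding sum_distrib_left sum.distrib[symmetric] B_def t_def by (intro sum.cong) (auto simp: algebra_simps)
  also have "\<dots> = 2 * B * (B * l1 + A * l2 + t * l3)" unfolding 1 2 by (simp add: algebra_simps)
  \<comment> \<open>\<open>A\<close>, \<open>B\<close> and \<open>t\<close> have degree 2 and
    \<open>N\<close> has degree 1, hence the value 1/2; in coefficients it is c1 - c2 +
    \<kappa>.\<close>
  also have "B * l1 + A * l2 + t * l3 = 1 / 2"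
  proof -
    have "B * l1 + A * l2 + t * l3 = (B * B + t * t) / S * q - c2 * (B / (S + B)) + \<kappa> * ((A - B) / (S + A - B))"
      using S unfolding l1_def l2_def l3_def by (simp add: add_divide_distrib diff_divide_distrib algebra_simps)
    also have "(B * B + t * t) / S = S" using S t2 by simp
    also have "S * q = c1 - c2 * (S / (S + B)) + \<kappa> * (S / (S + A - B))"
      using S unfolding q_def by (simp add: algebra_simps)
    also have "c1 - c2 * (S / (S + B)) + \<kappa> * (S / (S + A - B)) - c2 * (B / (S + B)) + \<kappa> * ((A - B) / (S + A - B))
       = c1 - c2 * ((S + B) / (S + B)) + \<kappa> * ((S + A - B) / (S + A - B))"
      unfolding divide_inverse by algebra
    also have "\<dots> = 1 / 2" using S bd c by simp
    finally show ?thesis .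
  qed
  finally show "(\<Sum>j\<in>UNIV. (heis_B k z * fst z $ j + snd z * hrot z j) * dlnN k j z) = heis_B k z" by (simp add: B_def)
  have inv: "1 / (2 * S) \<le> 1 / (S + B)" "1 / (S + A - B) \<le> 1 / S" "1 / (S + B) \<le> 1 / S"
    using S bd by (auto intro!: divide_left_mono)
  have q_le: "q \<le> (c1 + \<kappa>) / S" "- c2 / S \<le> q"
  proof -
    have "\<kappa> * (1 / (S + A - B)) \<le> \<kappa> * (1 / S)" using c inv(2) by (intro mult_left_mono) auto
    moreover have "c2 / (S + B) \<ge> 0" "\<kappa> / (S + A - B) \<ge> 0" "c1 / S \<ge> 0" using S bd c by auto
    moreover have "c2 * (1 / (S + B)) \<le> c2 * (1 / S)" using c inv(3) by (intro mult_left_mono) auto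
    ultimately show "q \<le> (c1 + \<kappa>) / S" "- c2 / S \<le> q" by (simp_all add: q_def add_divide_distrib)
  qed
  have "2 * B * l1 + 2 * A * l2 = 2 * B * (B / S) * q - 2 * B * c2 * (1 / (S + B)) + 2 * \<kappa> * (A - B) * (1 / (S + A - B))"
    unfolding l1_def l2_def by (simp add: algebra_simps)
  also have "\<dots> \<le> 2 * B * ((c1 + \<kappa>) / S) - 2 * B * c2 * (1 / (2 * S)) + 2 * \<kappa> * B * (1 / S)"
  proof -
    have "B / S * q \<le> 1 * ((c1 + \<kappa>) / S)"
    proof -
      have "B / S * q \<le> B / S * ((c1 + \<kappa>) / S)" using q_le bd S by (intro mult_left_mono) auto
      also have "\<dots> \<le> 1 * ((c1 + \<kappa>) / S)" using bd S c by (intro mult_right_mono) auto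
      finally show ?thesis .
    qed
    then have a: "2 * B * (B / S) * q \<le> 2 * B * ((c1 + \<kappa>) / S)"
      using mult_left_mono[of "B / S * q" "1 * ((c1 + \<kappa>) / S)" "2 * B"] bd by (simp add: mult.assoc)
    have b: "2 * B * c2 * (1 / (2 * S)) \<le> 2 * B * c2 * (1 / (S + B))"
      using inv(1) bd c by (intro mult_left_mono) auto
    have c': "2 * \<kappa> * (A - B) * (1 / (S + A - B)) \<le> 2 * \<kappa> * B * (1 / S)"
      using inv(2) bd c S by (intro mult_mono) auto
    show ?thesis using a b c' by linarith
  qed
  also have "\<dots> = (2 * c1 + 4 * \<kappa> - c2) * (B / S)" using S by (simp add: field_simps)
  also have "\<dots> \<le> 2 * (B / S)" using bd S c by (intro mult_right_mono) auto
  finally show "(\<Sum>j\<in>UNIV. fst z $ j * dlnN k j z) \<le> 2 * heis_B k z / hS k z"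
    unfolding 1 by (simp add: B_def S_def)
  define r where "r = 2 * S powr (1/2)"
  have r: "r \<ge> 0" "\<bar>fst z $ j\<bar> \<le> r" "\<bar>hrot z j\<bar> \<le> r" "\<bar>hw k j * fst z $ j\<bar> \<le> r" "\<bar>hw k j * hrot z j\<bar> \<le> r"
  proof -
    show r0: "r \<ge> 0" "\<bar>fst z $ j\<bar> \<le> r" "\<bar>hrot z j\<bar> \<le> r"
      using abs_fst_le[of z j k] abs_hrot_le'[of z j k] by (auto simp: r_def S_def)
    have "\<bar>hw k j\<bar> \<le> 1" using hw_bounds[of k j] by auto
    then have "\<bar>hw k j * a\<bar> \<le> 1 * \<bar>a\<bar>" for a unfolding abs_mult by (intro mult_right_mono) auto
    from this[of "fst z $ j"] this[of "hrot z j"] r0 show "\<bar>hw k j * fst z $ j\<bar> \<le> r" "\<bar>hw k j * hrot z j\<bar> \<le> r" by auto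
  qed
  have qS: "\<bar>q\<bar> \<le> 2 / S"
  proof -
    have "(c1 + \<kappa>) / S \<le> 2 / S" "- (2 / S) \<le> - c2 / S"
      using S c divide_right_mono[of "c1 + \<kappa>" 2 S] divide_right_mono[of "- 2" "- c2" S] by auto
    with q_le show ?thesis unfolding abs_le_iff by linarith
  qed
  have "\<bar>B / S\<bar> \<le> 1" "\<bar>t / S\<bar> \<le> 1"
  proof -
    show "\<bar>B / S\<bar> \<le> 1" using bd S by simp
    have "\<bar>t\<bar> \<le> S" unfolding S_def hS_def t_def by (rule real_le_rsqrt) simp
    then show "\<bar>t / S\<bar> \<le> 1" using S by simp
  qed
  then have qq: "\<bar>B / S * q\<bar> \<le> 1 * (2 / S)" "\<bar>t / S * q\<bar> \<le> 1 * (2 / S)"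
    unfolding abs_mult using qS by (intro mult_mono; simp)+
  have "\<bar>c2 / (S + B)\<bar> \<le> 1 / S" "\<bar>\<kappa> / (S + A - B)\<bar> \<le> 1 / S"
    using S bd c by (auto simp: abs_of_nonneg intro!: frac_le)
  with qq have l: "\<bar>l1\<bar> \<le> 4 / S" "\<bar>l2\<bar> \<le> 1 / S" "\<bar>l3\<bar> \<le> 2 / S"
    unfolding l1_def l2_def l3_def mult_1 divide_inverse[of _ S] by linarith+
  have "\<bar>dlnN k j z\<bar> \<le> \<bar>l1\<bar> * \<bar>hw k j * fst z $ j\<bar> + \<bar>l2\<bar> * \<bar>fst z $ j\<bar> + \<bar>l3\<bar> * \<bar>hw k j * hrot z j\<bar>"
    unfolding eq abs_mult[symmetric] by (rule order_trans[OF abs_triangle_ineq add_right_mono[OF abs_triangle_ineq]])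
  also have "\<dots> \<le> 4 / S * r + 1 / S * r + 2 / S * r"
    using l r S by (intro add_mono mult_mono) auto
  also have "\<dots> = 14 * S powr (1/2) / S" by (simp add: r_def)
  also have "\<dots> \<le> 20 * S powr (1/2) / S" using S by (intro divide_right_mono mult_right_mono) auto
  finally show "\<bar>dlnN k j z\<bar> \<le> 20 * hS k z powr (1/2) / hS k z" by (simp add: S_def)
qed

text \<open>The logarithms in \<open>lnN\<close> differ from \<open>ln S\<close> by at most
  \<open>ln 2\<close> and their coefficients add up to 1/2, so \<open>lnN\<close> is
  \<open>ln S / 2\<close> up to an error of \<open>ln 2 / 2\<close>.\<close>

lemma
  fixes z :: "'n::finite heis"
  assumes p: "p \<ge> 0"
  shows heis_norm_powr_le: "heis_norm k z powr p \<le> 2 powr (p / 2) * hS k z powr (p / 2)"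
    and heis_norm_powr_ge: "hS k z powr (p / 2) \<le> 2 powr (p / 2) * heis_norm k z powr p"
proof -
  have "heis_norm k z powr p \<le> 2 powr (p / 2) * hS k z powr (p / 2) \<and> hS k z powr (p / 2) \<le> 2 powr (p / 2) * heis_norm k z powr p"
  proof (cases "z = 0")
    case True
    then show ?thesis by (simp add: heis_norm_def hS_def heis_B_eq)
  next
    case False
    define n where "n = real CARD('n)"
    define c2 where "c2 = 1 / (4 * n)"
    define S where "S = hS k z"
    define A where "A = heis_A k z"
    define B where "B = heis_B k z"
    have n: "n \<ge> 1" by (simp add: n_def Suc_leI)
    have c: "0 < c2" "c2 \<le> 1/4" using n by (auto simp: c2_def field_simps)
    have S: "S > 0" using hS_pos[OF False] by (simp add: S_def)
    have bd: "S \<le> S + B" "S + B \<le> 2 * S" "S \<le> S + A - B" "S + A - B \<le> 2 * S"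
      using hS_plus_bounds[of k z] by (simp_all add: S_def A_def B_def)
    have N: "lnN k z = 2 * c2 * ln S - c2 * ln (S + B) + (1 / 2 - c2) * ln (S + A - B)"
      unfolding lnN_def S_def A_def B_def c2_def n_def by simp
    have ln: "ln S \<le> ln (S + B)" "ln (S + B) \<le> ln 2 + ln S" "ln S \<le> ln (S + A - B)" "ln (S + A - B) \<le> ln 2 + ln S"
      using S bd ln_mult[of 2 S] ln_mono[of "S + B" "2 * S"] ln_mono[of "S + A - B" "2 * S"] by simp_all
    have l2: "0 < ln (2::real)" by simp
    have "lnN k z \<le> 2 * c2 * ln S - c2 * ln S + (1 / 2 - c2) * (ln 2 + ln S)"
      unfolding N using ln c by (intro add_mono diff_mono mult_left_mono) auto
    also have "\<dots> \<le> (ln 2 + ln S) / 2" using c l2 by (simp add: algebra_simps)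
    finally have up: "lnN k z \<le> (ln 2 + ln S) / 2" .
    have "- (ln 2 / 2) + ln S / 2 \<le> 2 * c2 * ln S - c2 * (ln 2 + ln S) + (1 / 2 - c2) * ln S"
      using mult_right_mono[of c2 "1/2" "ln 2"] c l2 by (simp add: algebra_simps)
    also have "\<dots> \<le> lnN k z"
      unfolding N using ln c by (intro add_mono diff_mono mult_left_mono) auto
    finally have lo: "(- ln 2 + ln S) / 2 \<le> lnN k z" by simp
    have Np: "heis_norm k z powr p = exp (p * lnN k z)"
      by (simp add: heis_norm_eq_exp[OF False] powr_def)
    have e: "2 powr (p / 2) = exp (p * (ln 2 / 2))" "S powr (p / 2) = exp (p * (ln S / 2))"
      using S by (simp_all add: powr_def)
    have "p * lnN k z \<le> p * ((ln 2 + ln S) / 2)" "p * ((- ln 2 + ln S) / 2) \<le> p * lnN k z"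
      by (rule mult_left_mono[OF up p], rule mult_left_mono[OF lo p])
    then show ?thesis
      unfolding S_def[symmetric] Np e exp_add[symmetric] exp_le_cancel_iff by (simp add: algebra_simps add_divide_distrib diff_divide_distrib)
  qed
  then show "heis_norm k z powr p \<le> 2 powr (p / 2) * hS k z powr (p / 2)"
    and "hS k z powr (p / 2) \<le> 2 powr (p / 2) * heis_norm k z powr p" by auto
qed

section \<open>The Gibbs weight and the horizontal vector field\<close>

lemma has_hderiv_compose:
  assumes D: "has_hderiv k j f d z" and \<phi>: "(\<phi> has_real_derivative e) (at (f z))"
  shows "has_hderiv k j (\<lambda>z. \<phi> (f z)) (e * d) z"
  using DERIV_chain2[where f=\<phi> and x=0 and s=UNIV and g="\<lambda>s. f (hflow k j s z)", OF _ D] \<phi> by simp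

lemma has_hderiv_P_powr:
  "has_hderiv k j (\<lambda>z. hP k z powr a)
     (a * hP k z powr (a - 1) * dP k j z) z"
  by (rule has_hderiv_compose[OF has_hderiv_P has_real_derivative_powr[OF hP_pos]])

lemma has_hderiv_mult:
  "has_hderiv k j f d z \<Longrightarrow> has_hderiv k j g e z \<Longrightarrow> has_hderiv k j (\<lambda>z. f z * g z) (d * g z + f z * e) z"
  by (drule (1) DERIV_mult) (simp add: algebra_simps)

lemma hregI':
  assumes "continuous_on UNIV f" "\<And>j z. has_hderiv k j f (f' j z) z" "\<And>j. continuous_on UNIV (f' j)"
  shows "hreg k f"
  by (rule hregI[OF assms(1,2) continuous_bounded_on_ball[OF assms(3)]])

lemma hreg_const: "hreg k (\<lambda>_. c)"
  by (rule hregI'[where f' = "\<lambda>_ _. 0"]) auto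

lemma continuous_hrot [continuous_intros]: "continuous_on S f \<Longrightarrow> continuous_on S (\<lambda>x. hrot (f x) j)"
  unfolding hrot_def by (cases j) (auto intro!: continuous_intros)

lemma continuous_P_powr [continuous_intros]: "continuous_on S f \<Longrightarrow> continuous_on S (\<lambda>x. hP k (f x) powr a)"
  using hP_pos[of k] by (intro continuous_intros) (auto simp: less_imp_neq[symmetric])

lemma continuous_dP [continuous_intros]: "continuous_on S f \<Longrightarrow> continuous_on S (\<lambda>x. dP k j (f x))"
  unfolding dP_def by (intro continuous_intros)

lemma hreg_P_powr: "hreg k (\<lambda>z. hP k z powr a)"
  by (rule hregI'[OF _ has_hderiv_P_powr]) (intro continuous_intros)+

locale heis_potential =
  fixes k :: "'n::finite" and \<alpha> p :: real
  assumes \<alpha>: "\<alpha> > 0" and p: "p \<ge> 4"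
begin

definition U :: "'n heis \<Rightarrow> real" where
  "U z = \<alpha> * heis_norm k z powr p"

definition dU :: "'n + 'n \<Rightarrow> 'n heis \<Rightarrow> real" where
  "dU j z = \<alpha> * p * heis_norm k z powr p * dlnN k j z"

lemma U_nonneg: "U z \<ge> 0"
  using \<alpha> by (simp add: U_def)

lemma U_le_S: "U z \<le> \<alpha> * 2 powr (p / 2) * hS k z powr (p / 2)"
  using heis_norm_powr_le[of p k z] \<alpha> p by (simp add: U_def mult.assoc)

lemma U_eq_exp: "z \<noteq> 0 \<Longrightarrow> U z = \<alpha> * exp (p * lnN k z)"
  by (simp add: U_def heis_norm_eq_exp powr_def)

lemma U_0 [simp]: "U 0 = 0"
  by (simp add: U_def heis_norm_def)

text \<open>Away from the origin small times avoid 0 and the formula through \<open>lnN\<close> is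
  differentiated. At the origin \<open>S\<close> is of order s^2 along the flow and U <= C S^(p/2)
  with p/2 >= 1, so \<open>U\<close> is at most of order s^2 and has derivative 0; \<open>dU\<close>
  agrees because the norm vanishes there.\<close>

lemma has_hderiv_U: "has_hderiv k j U (dU j z) z"
proof (cases "z = 0")
  case False
  have "\<forall>\<^sub>F s in nhds 0. hflow k j s z \<noteq> 0"
  proof -
    have "open ((\<lambda>s. hflow k j s z) -` (- {0}))"
      by (rule open_vimage) (auto simp: continuous_on_hflow)
    then show ?thesis using False by (auto simp: eventually_nhds intro!: exI[of _ "(\<lambda>s. hflow k j s z) -` (- {0})"])
  qed
  then have ev: "\<forall>\<^sub>F s in nhds 0. U (hflow k j s z) = \<alpha> * exp (p * lnN k (hflow k j s z))"
    by eventually_elim (rule U_eq_exp)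
  have D: "has_hderiv k j (\<lambda>z. \<alpha> * exp (p * lnN k z)) (\<alpha> * (exp (p * lnN k z) * (p * dlnN k j z))) z"
    by (intro DERIV_cmult has_hderiv_compose[where \<phi>=exp] has_hderiv_lnN[OF False] DERIV_exp)
  have "\<alpha> * (exp (p * lnN k z) * (p * dlnN k j z)) = dU j z"
    using U_eq_exp[OF False] \<alpha> by (simp add: dU_def U_def algebra_simps)
  with D show ?thesis by (subst DERIV_cong_ev[OF refl ev refl]) simp
next
  case True
  define C where "C = \<alpha> * 2 powr (p / 2)"
  have C: "C \<ge> 0" using \<alpha> by (simp add: C_def)
  have bd: "\<bar>U (hflow k j s 0)\<bar> \<le> C * s\<^sup>2" if "\<bar>s\<bar> \<le> 1" for s
  proof -
    have "hS k (hflow k j s 0) = hw k j * (s\<^sup>2 / 2)"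
    proof -
      have "heis_B k 0 = 0" by (simp add: heis_B_eq)
      moreover have "hrot 0 j = 0" by (cases j) simp_all
      ultimately show ?thesis using hw_bounds[of k j] by (simp add: hS_def heis_B_hflow snd_hflow)
    qed
    also have "\<dots> \<le> 1 * s\<^sup>2" using hw_bounds[of k j] by (intro mult_mono) auto
    finally have "hS k (hflow k j s 0) powr (p / 2) \<le> (s\<^sup>2) powr (p / 2)"
      using p hS_nonneg[of k "hflow k j s 0"] by (intro powr_mono2) simp_all
    also have "(s\<^sup>2) powr (p / 2) \<le> (s\<^sup>2) powr 1"
    proof -
      have "s\<^sup>2 \<le> 1" using that by (simp add: abs_square_le_1)
      then show ?thesis using p by (intro powr_mono') auto
    qed
    finally have "C * hS k (hflow k j s 0) powr (p / 2) \<le> C * s\<^sup>2"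
      using C by (intro mult_left_mono) auto
    then show ?thesis using U_le_S[of "hflow k j s 0"] U_nonneg[of "hflow k j s 0"] by (simp add: C_def)
  qed
  have "((\<lambda>s. U (hflow k j s 0) / s) \<longlongrightarrow> 0) (at 0)"
  proof (rule Lim_null_comparison)
    show "((\<lambda>s::real. C * \<bar>s\<bar>) \<longlongrightarrow> 0) (at 0)" by (auto intro!: tendsto_eq_intros)
    have "\<forall>\<^sub>F s in at (0::real). \<bar>s\<bar> \<le> 1"
      unfolding eventually_at by (intro exI[of _ 1]) auto
    then show "\<forall>\<^sub>F s in at 0. norm (U (hflow k j s 0) / s) \<le> C * \<bar>s\<bar>"
    proof eventually_elim
      case (elim s)
      then show ?case using bd[OF elim]
        by (cases "s = 0") (auto simp: abs_divide divide_le_eq power2_eq_square mult.assoc)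
    qed
  qed
  then show ?thesis using True by (simp add: DERIV_def dU_def heis_norm_def)
qed

lemma continuous_U: "continuous_on UNIV U"
proof -
  have "isCont U z" for z
  proof (cases "z = 0")
    case False
    have ln: "continuous_on (- {0}) (lnN k)"
      unfolding lnN_def
      using hS_pos[of _ k] hS_plus_bounds[of k]
      by (intro continuous_intros) (metis ComplD less_le_trans less_irrefl singletonI)+
    have "continuous_on (- {0}) (\<lambda>z. \<alpha> * exp (p * lnN k z))"
      by (intro continuous_intros ln)
    then have "continuous_on (- {0}) U"
      by (rule continuous_on_eq) (simp add: U_eq_exp)
    then show ?thesis using False by (simp add: continuous_on_eq_continuous_at open_Compl)
  next
    case True
    have c: "continuous_on UNIV (\<lambda>z. \<alpha> * 2 powr (p / 2) * hS k z powr (p / 2))"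
      using p by (intro continuous_on_mult continuous_on_powr' continuous_hS continuous_on_id continuous_on_const) (simp_all add: hS_nonneg)
    have "((\<lambda>z. \<alpha> * 2 powr (p / 2) * hS k z powr (p / 2)) \<longlongrightarrow> \<alpha> * 2 powr (p / 2) * hS k 0 powr (p / 2)) (at 0)"
      using c unfolding continuous_on_eq_continuous_at[OF open_UNIV] isCont_def by blast
    then have "((\<lambda>z. \<alpha> * 2 powr (p / 2) * hS k z powr (p / 2)) \<longlongrightarrow> 0) (at 0)"
      by (simp add: hS_def heis_B_eq)
    then have "(U \<longlongrightarrow> 0) (at 0)"
      by (rule Lim_null_comparison[rotated]) (use U_le_S U_nonneg in simp)
    then show ?thesis using True by (simp add: isCont_def)
  qed
  then show ?thesis by (simp add: continuous_at_imp_continuous_on)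
qed

text \<open>\<open>U\<close> has size S^(p/2) and the gradient of \<open>lnN\<close> has size
  S^(-1/2), which gives P^((p-1)/4). This is rounded up to the exponent p/4, the one that
  \<open>damp\<close> cancels.\<close>

lemma abs_dU_le: "\<bar>dU j z\<bar> \<le> 20 * \<alpha> * p * 2 powr (p / 2) * hP k z powr (p / 4)"
proof (cases "z = 0")
  case True
  then show ?thesis using \<alpha> p by (simp add: dU_def heis_norm_def)
next
  case False
  define S where "S = hS k z"
  have S: "S > 0" using hS_pos[OF False] by (simp add: S_def)
  have "\<bar>dU j z\<bar> = \<alpha> * p * heis_norm k z powr p * \<bar>dlnN k j z\<bar>"
    using \<alpha> p by (simp add: dU_def abs_mult)
  also have "\<dots> \<le> \<alpha> * p * (2 powr (p / 2) * S powr (p / 2)) * (20 * S powr (1/2) / S)"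
    using \<alpha> p heis_norm_powr_le[of p k z] abs_dlnN_le[OF False, of k j]
    by (intro mult_mono) (auto simp: S_def intro!: divide_nonneg_nonneg hS_nonneg)
  also have "\<dots> = 20 * \<alpha> * p * 2 powr (p / 2) * (S powr (p / 2) * S powr (1/2) / S powr 1)"
    using S by simp
  also have "S powr (p / 2) * S powr (1/2) / S powr 1 = S powr ((p - 1) / 2)"
    unfolding powr_add[symmetric] powr_diff[symmetric] by (simp add: diff_divide_distrib)
  also have "S powr ((p - 1) / 2) \<le> (hP k z powr (1/2)) powr ((p - 1) / 2)"
    using S p hS_le_P[of k z] by (intro powr_mono2) (auto simp: S_def)
  also have "\<dots> = hP k z powr ((p - 1) / 4)" by (simp add: powr_powr)
  also have "\<dots> \<le> hP k z powr (p / 4)" using hP_ge_1[of k z] by (intro powr_mono) auto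
  finally show ?thesis using \<alpha> p by (simp add: mult_left_mono)
qed

definition wt :: "'n heis \<Rightarrow> real" where "wt z = exp (- U z)"

abbreviation wint :: "('n heis \<Rightarrow> real) \<Rightarrow> real" where
  "wint h \<equiv> \<integral>z. h z * wt z \<partial>lborel"

abbreviation wintegrable :: "('n heis \<Rightarrow> real) \<Rightarrow> bool" where
  "wintegrable h \<equiv> integrable lborel (\<lambda>z. h z * wt z)"

lemma wt_pos: "wt z > 0" by (simp add: wt_def)

lemma wt_le_1: "wt z \<le> 1" using U_nonneg by (simp add: wt_def)

lemma has_hderiv_wt: "has_hderiv k j wt (- dU j z * wt z) z"
proof -
  have "((\<lambda>u. exp (- u)) has_real_derivative - exp (- U z)) (at (U z))"
    by (auto intro!: derivative_eq_intros)
  from has_hderiv_compose[OF has_hderiv_U[of j z] this]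
  show ?thesis unfolding wt_def by (simp add: mult.commute)
qed

lemma continuous_wt [continuous_intros]: "continuous_on S f \<Longrightarrow> continuous_on S (\<lambda>x. wt (f x))"
  unfolding wt_def by (intro continuous_intros continuous_on_compose2[OF continuous_U]) auto

lemma wt_borel [measurable]: "wt \<in> borel_measurable borel"
  by (intro borel_measurable_continuous_onI continuous_intros)

lemma hreg_wt: "hreg k wt"
proof (rule hregI[OF _ has_hderiv_wt])
  show "continuous_on UNIV wt" by (intro continuous_intros)
  fix j :: "'n + 'n" and R
  have "continuous_on UNIV (\<lambda>z. 20 * \<alpha> * p * 2 powr (p / 2) * hP k z powr (p / 4))"
    using hP_pos[of k] by (intro continuous_intros) (auto simp: less_imp_neq[symmetric])
  from continuous_bounded_on_ball[OF this, of R] obtain M where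
    M: "\<And>z. norm z \<le> R \<Longrightarrow> \<bar>20 * \<alpha> * p * 2 powr (p / 2) * hP k z powr (p / 4)\<bar> \<le> M" by blast
  show "\<exists>M. \<forall>z. norm z \<le> R \<longrightarrow> \<bar>- dU j z * wt z\<bar> \<le> M"
  proof (intro exI allI impI)
    fix z :: "'n heis" assume z: "norm z \<le> R"
    have "\<bar>- dU j z * wt z\<bar> \<le> \<bar>dU j z\<bar> * 1"
      unfolding abs_mult using wt_pos[of z] wt_le_1[of z] by (intro mult_mono) auto
    also have "\<dots> \<le> M" using abs_dU_le[of j z] M[OF z] by linarith
    finally show "\<bar>- dU j z * wt z\<bar> \<le> M" .
  qed
qed

text \<open>In terms of \<open>E = \<Sum> x\<^sub>j X\<^sub>j\<close> and \<open>R = \<Sum> y\<^sub>j X\<^sub>j\<close> this is the field \<open>\<epsilon> P\<^bsup>(p-4)/4\<^esup> (B E + t R) - b P\<^bsup>(p-2)/4\<^esup> E\<close>.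
  The first term is large along \<open>\<nabla>U\<close> away from the \<open>t\<close>-axis; the divergence of the second is at most
  \<open>- 2 n b P\<^bsup>(p-2)/4\<^esup>\<close> everywhere.\<close>

definition V :: "real \<Rightarrow> real \<Rightarrow> 'n + 'n \<Rightarrow> 'n heis \<Rightarrow> real" where
  "V \<epsilon> b j z = \<epsilon> * hP k z powr ((p - 4) / 4) * (heis_B k z * fst z $ j + snd z * hrot z j)
     - b * hP k z powr ((p - 2) / 4) * fst z $ j"

definition dV :: "real \<Rightarrow> real \<Rightarrow> 'n + 'n \<Rightarrow> 'n heis \<Rightarrow> real" where
  "dV \<epsilon> b j z =
      \<epsilon> * ((p - 4) / 4 * hP k z powr ((p - 4) / 4 - 1) * dP k j z) * (heis_B k z * fst z $ j + snd z * hrot z j)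
      + \<epsilon> * hP k z powr ((p - 4) / 4) * (hw k j * fst z $ j * fst z $ j + heis_B k z + hw k j * hrot z j * hrot z j)
      - b * ((p - 2) / 4 * hP k z powr ((p - 2) / 4 - 1) * dP k j z) * fst z $ j - b * hP k z powr ((p - 2) / 4)"

lemma has_hderiv_V: "has_hderiv k j (V \<epsilon> b j) (dV \<epsilon> b j z) z"
proof -
  have x: "has_hderiv k j (\<lambda>z. fst z $ j) 1 z" using has_hderiv_fst[where i=j and j=j and k=k and z=z] by simp
  have y: "has_hderiv k j (\<lambda>z. hrot z j) 0 z" by simp
  have 1: "has_hderiv k j (\<lambda>z. heis_B k z * fst z $ j + snd z * hrot z j)
     (hw k j * fst z $ j * fst z $ j + heis_B k z * 1 + (hw k j * hrot z j * hrot z j + snd z * 0)) z"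
    by (intro DERIV_add has_hderiv_mult has_hderiv_B has_hderiv_snd x y)
  have 2: "has_hderiv k j (\<lambda>z. \<epsilon> * (hP k z powr ((p - 4) / 4) * (heis_B k z * fst z $ j + snd z * hrot z j))
     - b * (hP k z powr ((p - 2) / 4) * fst z $ j))
    (\<epsilon> * ((p - 4) / 4 * hP k z powr ((p - 4) / 4 - 1) * dP k j z
         * (heis_B k z * fst z $ j + snd z * hrot z j)
       + hP k z powr ((p - 4) / 4) * (hw k j * fst z $ j * fst z $ j + heis_B k z * 1 + (hw k j * hrot z j * hrot z j + snd z * 0)))
     - b * ((p - 2) / 4 * hP k z powr ((p - 2) / 4 - 1) * dP k j z * fst z $ j
       + hP k z powr ((p - 2) / 4) * 1)) z"
    by (intro DERIV_diff DERIV_cmult has_hderiv_mult has_hderiv_P_powr 1 x)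
  show ?thesis
    using 2 unfolding V_def dV_def by (simp add: algebra_simps)
qed

lemma hreg_V: "hreg k (V \<epsilon> b j)"
proof -
  have f: "hreg k (\<lambda>z. fst z $ i)" for i
    by (rule hregI'[OF _ has_hderiv_fst]) (intro continuous_intros)+
  have r: "hreg k (\<lambda>z. hrot z j)"
    using f hreg_mult[OF hreg_const[of k "- 1"] f] by (cases j) simp_all
  have s: "hreg k snd" by (rule hregI'[OF _ has_hderiv_snd]) (intro continuous_intros)+
  have B: "hreg k (heis_B k)" by (rule hregI'[OF _ has_hderiv_B]) (intro continuous_intros)+
  have "hreg k (\<lambda>z. (\<epsilon> * hP k z powr ((p - 4) / 4)) * (heis_B k z * fst z $ j + snd z * hrot z j)
     + (- b * hP k z powr ((p - 2) / 4)) * fst z $ j)"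
    by (intro hreg_add hreg_mult hreg_const f r s B hreg_P_powr)
  then show ?thesis unfolding V_def by simp
qed

end

context heis_potential
begin

section \<open>Pointwise drift estimate for the field V\<close>

definition Wt :: "'n heis \<Rightarrow> real" where "Wt z = hP k z powr ((p - 2) / 4)"

lemma sum_V_dU:
  "(\<Sum>j\<in>UNIV. V \<epsilon> b j z * dU j z) = \<alpha> * p * heis_norm k z powr p *
     (\<epsilon> * hP k z powr ((p - 4) / 4) * heis_B k z - b * Wt z * (\<Sum>j\<in>UNIV. fst z $ j * dlnN k j z))"
proof (cases "z = 0")
  case True then show ?thesis by (simp add: dU_def heis_norm_def)
next
  case False
  define m where "m = hP k z powr ((p - 4) / 4)"
  define w where "w = hP k z powr ((p - 2) / 4)"
  define X where "X = (\<lambda>j. heis_B k z * fst z $ j + snd z * hrot z j)"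
  have "(\<Sum>j\<in>UNIV. V \<epsilon> b j z * dU j z)
     = (\<Sum>j\<in>UNIV. \<alpha> * p * heis_norm k z powr p * (\<epsilon> * m * (X j * dlnN k j z) - b * w * (fst z $ j * dlnN k j z)))"
    by (intro sum.cong) (simp_all add: V_def dU_def m_def w_def X_def algebra_simps)
  also have "\<dots> = \<alpha> * p * heis_norm k z powr p * (\<epsilon> * m * (\<Sum>j\<in>UNIV. X j * dlnN k j z) - b * w * (\<Sum>j\<in>UNIV. fst z $ j * dlnN k j z))"
    by (simp only: sum_distrib_left[symmetric] sum_subtractf)
  also have "(\<Sum>j\<in>UNIV. X j * dlnN k j z) = heis_B k z" unfolding X_def by (rule euler_lnN[OF False])
  finally show ?thesis by (simp add: Wt_def m_def w_def)
qed

lemma sum_dV: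
  fixes z :: "'n heis"
  defines "B \<equiv> heis_B k z" and "n \<equiv> real CARD('n)"
  shows "(\<Sum>j\<in>UNIV. dV \<epsilon> b j z) =
     \<epsilon> * (hP k z powr ((p - 4) / 4) * (2 * n + 4) * B + (p - 4) * hP k z powr ((p - 4) / 4 - 1) * B * (B\<^sup>2 + (snd z)\<^sup>2))
     - b * (2 * n * Wt z + (p - 2) * hP k z powr ((p - 2) / 4 - 1) * B\<^sup>2)"
proof -
  define m where "m = hP k z powr ((p - 4) / 4)"
  define m' where "m' = (p - 4) / 4 * hP k z powr ((p - 4) / 4 - 1)"
  define w where "w = hP k z powr ((p - 2) / 4)"
  define w' where "w' = (p - 2) / 4 * hP k z powr ((p - 2) / 4 - 1)"
  define t where "t = snd z"
  let ?h = "hw k" let ?x = "\<lambda>j. fst z $ j" let ?y = "hrot z"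
  \<comment> \<open>Coefficients of the weighted monomials x_j^2, x_j y_j, y_j^2 and of 1, none
    depending on \<open>j\<close>. The mixed sum is 0, so \<open>c2\<close> drops out.\<close>
  define c1 c2 c3 c4 where "c1 = 2 * \<epsilon> * m' * B * B + \<epsilon> * m - 2 * b * w' * B" and "c2 = 4 * \<epsilon> * m' * B * t - 2 * b * w' * t"
    and "c3 = 2 * \<epsilon> * m' * t * t + \<epsilon> * m" and "c4 = \<epsilon> * m * B - b * w"
  have "(\<Sum>j\<in>UNIV. dV \<epsilon> b j z) = (\<Sum>j\<in>UNIV.
      c1 * (?h j * (?x j)\<^sup>2) + c2 * (?h j * (?x j * ?y j)) + c3 * (?h j * (?y j)\<^sup>2) + c4)"
    unfolding dV_def dP_def m_def[symmetric] m'_def[symmetric] w_def[symmetric] w'_def[symmetric] t_def[symmetric] B_def[symmetric]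
    by (intro sum.cong) (simp_all add: c1_def c2_def c3_def c4_def power2_eq_square algebra_simps)
  also have "\<dots> = c1 * (\<Sum>j\<in>UNIV. ?h j * (?x j)\<^sup>2) + c2 * (\<Sum>j\<in>UNIV. ?h j * (?x j * ?y j)) + c3 * (\<Sum>j\<in>UNIV. ?h j * (?y j)\<^sup>2) + c4 * (2 * n)"
    unfolding sum_distrib_left by (simp add: sum.distrib n_def)
  also have "\<dots> = c1 * (2 * B) + c3 * (2 * B) + c4 * (2 * n)"
    unfolding sum_hx2 sum_hxy sum_hy2 B_def by simp
  also have "\<dots> = 2 * \<epsilon> * m' * (B * B * (2 * B) + t * t * (2 * B)) + \<epsilon> * m * (2 * B + 2 * B + 2 * n * B)
      - 2 * b * w' * (B * (2 * B)) - b * w * (2 * n)"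
    by (simp add: c1_def c3_def c4_def algebra_simps)
  also have "\<dots> = \<epsilon> * (m * (2 * n + 4) * B + 4 * m' * B * (B\<^sup>2 + t\<^sup>2)) - b * (2 * n * w + 4 * w' * B\<^sup>2)"
    by (simp add: power2_eq_square algebra_simps)
  finally show ?thesis by (simp add: m_def w_def m'_def w'_def Wt_def t_def)
qed

text \<open>Pythagoras: \<open>x\<close> and \<open>y\<close> are orthogonal, both of squared length
  2 A.\<close>

lemma sum_V_sq:
  "(\<Sum>j\<in>UNIV. (V \<epsilon> b j z)\<^sup>2) = 2 * heis_A k z *
     ((\<epsilon> * hP k z powr ((p - 4) / 4) * heis_B k z - b * Wt z)\<^sup>2 + (\<epsilon> * hP k z powr ((p - 4) / 4) * snd z)\<^sup>2)"
proof -
  define u where "u = \<epsilon> * hP k z powr ((p - 4) / 4) * heis_B k z - b * Wt z"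
  define v where "v = \<epsilon> * hP k z powr ((p - 4) / 4) * snd z"
  have "V \<epsilon> b j z = u * fst z $ j + v * hrot z j" for j
    by (simp add: V_def u_def v_def Wt_def algebra_simps)
  then have "(\<Sum>j\<in>UNIV. (V \<epsilon> b j z)\<^sup>2) = (\<Sum>j\<in>UNIV. u\<^sup>2 * (fst z $ j)\<^sup>2 + 2 * u * v * (fst z $ j * hrot z j) + v\<^sup>2 * (hrot z j)\<^sup>2)"
    by (intro sum.cong) (simp_all add: power2_eq_square algebra_simps)
  also have "\<dots> = u\<^sup>2 * (2 * heis_A k z) + v\<^sup>2 * (2 * heis_A k z)"
    by (simp add: sum.distrib sum_distrib_left[symmetric] sum_x2[of _ k] sum_y2[of _ k] sum_xy)
  finally show ?thesis unfolding u_def v_def by (simp add: algebra_simps)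
qed

lemma Wt_pos: "Wt z > 0"
  using hP_pos[of k z] by (simp add: Wt_def)

lemma P_powr_Wt: "hP k z powr ((p - 4) / 4) * hP k z powr (1 / 2) = Wt z"
  unfolding Wt_def powr_add[symmetric] by (simp add: field_simps)

text \<open>With m = P^((p-4)/4) the exponents give m P^(p/4) = Wt^2, so gain and damage are both
  measured by B Wt^2. The lower bound for N^p loses an additive constant near the origin, which
  leaves an error of size m B; \<open>radial_lnN\<close> bounds the damage done by the second
  field.\<close>

lemma V_dU_lower:
  assumes "\<epsilon> \<ge> 0" "b \<ge> 0"
  defines "a1 \<equiv> \<alpha> * p * 2 powr (- p / 2)" and "a2 \<equiv> \<alpha> * p * 2 powr (p / 2) * 2"
  shows "(\<Sum>j\<in>UNIV. V \<epsilon> b j z * dU j z) \<ge>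
    \<epsilon> * a1 * (2 powr (- p / 4) * heis_B k z * (Wt z)\<^sup>2 - hP k z powr ((p - 4) / 4) * heis_B k z) - b * a2 * heis_B k z * (Wt z)\<^sup>2"
proof (cases "z = 0")
  case True
  then show ?thesis by (simp add: dU_def heis_norm_def heis_B_eq)
next
  case False
  define B where "B = heis_B k z"
  define S where "S = hS k z"
  define P where "P = hP k z"
  define N where "N = heis_norm k z powr p"
  define m where "m = hP k z powr ((p - 4) / 4)"
  define R where "R = (\<Sum>j\<in>UNIV. fst z $ j * dlnN k j z)"
  have S: "S > 0" using hS_pos[OF False] by (simp add: S_def)
  have B: "B \<ge> 0" using heis_B_nonneg by (simp add: B_def)
  have P: "P \<ge> 1" "P = 1 + S\<^sup>2" using hP_ge_1 by (simp_all add: P_def S_def hP_eq)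
  have m: "m \<ge> 0" by (simp add: m_def)
  have R: "R \<le> 2 * B / S" using radial_lnN[OF False, of k] by (simp add: R_def B_def S_def)
  have N0: "N \<ge> 0" by (simp add: N_def)
  have N1: "N \<le> 2 powr (p / 2) * S powr (p / 2)" and N2: "S powr (p / 2) \<le> 2 powr (p / 2) * N"
    using heis_norm_powr_le[of p k z] heis_norm_powr_ge[of p k z] p by (simp_all add: N_def S_def)
  have mW: "m * P powr (p / 4) = (Wt z)\<^sup>2"
  proof -
    have e: "(p - 4) / 4 + p / 4 = (p - 2) / 4 + (p - 2) / 4" by (simp add: field_simps)
    show ?thesis unfolding m_def Wt_def P_def power2_eq_square powr_add[symmetric] e ..
  qed
  \<comment> \<open>For P >= 2 one has S^2 = P - 1 >= P / 2; for P < 2 the left side is at most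
    0.\<close>
  have Slow: "2 powr (- p / 4) * P powr (p / 4) - 1 \<le> S powr (p / 2)"
  proof (cases "P \<ge> 2")
    case True
    have "2 powr (- p / 4) * P powr (p / 4) = (P / 2) powr (p / 4)"
      using P by (simp add: powr_divide powr_minus_divide)
    also have "\<dots> \<le> (S\<^sup>2) powr (p / 4)" using True P p by (intro powr_mono2) auto
    also have "(S\<^sup>2) powr (p / 4) = S powr (p / 2)"
      using S by (simp add: powr_powr flip: powr_numeral)
    finally show ?thesis by simp
  next
    case False
    have "2 powr (- p / 4) * P powr (p / 4) \<le> 2 powr (- p / 4) * 2 powr (p / 4)"
      using False P p by (intro mult_left_mono powr_mono2) auto
    also have "\<dots> = 1" by (simp add: powr_add[symmetric])
    finally show ?thesis using powr_ge_zero[of S "p / 2"] by linarith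
  qed
  have "2 powr (- p / 2) * S powr (p / 2) \<le> 2 powr (- p / 2) * (2 powr (p / 2) * N)"
    using N2 by (intro mult_left_mono) auto
  also have "\<dots> = N" by (simp add: mult.assoc[symmetric] powr_add[symmetric])
  finally have Nlow: "2 powr (- p / 2) * S powr (p / 2) \<le> N" .
  have 1: "\<epsilon> * a1 * (2 powr (- p / 4) * B * (Wt z)\<^sup>2 - m * B) \<le> \<alpha> * p * N * (\<epsilon> * m * B)"
  proof -
    have "2 powr (- p / 2) * (2 powr (- p / 4) * P powr (p / 4) - 1) \<le> 2 powr (- p / 2) * S powr (p / 2)"
      using Slow by (intro mult_left_mono) auto
    also note Nlow
    finally have "\<alpha> * p * (\<epsilon> * m * B) * (2 powr (- p / 2) * (2 powr (- p / 4) * P powr (p / 4) - 1)) \<le> \<alpha> * p * (\<epsilon> * m * B) * N"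
      using \<alpha> p assms(1) m B by (intro mult_left_mono) auto
    also have "\<alpha> * p * (\<epsilon> * m * B) * (2 powr (- p / 2) * (2 powr (- p / 4) * P powr (p / 4) - 1))
        = \<epsilon> * a1 * (2 powr (- p / 4) * B * (m * P powr (p / 4)) - m * B)"
      by (simp add: a1_def algebra_simps)
    finally show ?thesis unfolding mW by (simp add: algebra_simps)
  qed
  have 2: "\<alpha> * p * N * (b * Wt z * R) \<le> b * a2 * B * (Wt z)\<^sup>2"
  proof -
    have "N * R \<le> N * (2 * B / S)" using R N0 by (intro mult_left_mono)
    also have "\<dots> \<le> (2 powr (p / 2) * S powr (p / 2)) * (2 * B / S)"
      using N1 B S by (intro mult_right_mono) auto
    also have "\<dots> = 2 powr (p / 2) * 2 * B * (S powr (p / 2) / S powr 1)" using S by simp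
    also have "S powr (p / 2) / S powr 1 = S powr (p / 2 - 1)" by (simp only: powr_diff)
    also have "S powr (p / 2 - 1) \<le> (P powr (1/2)) powr (p / 2 - 1)"
      using S p hS_le_P[of k z] by (intro powr_mono2) (auto simp: S_def P_def)
    also have "(P powr (1/2)) powr (p / 2 - 1) = Wt z" by (simp add: Wt_def P_def powr_powr field_simps)
    finally have "N * R \<le> 2 powr (p / 2) * 2 * B * Wt z" using B by (simp add: mult_left_mono)
    then have "\<alpha> * p * (b * Wt z) * (N * R) \<le> \<alpha> * p * (b * Wt z) * (2 powr (p / 2) * 2 * B * Wt z)"
      using \<alpha> p assms(2) Wt_pos[of z] by (intro mult_left_mono) auto
    then show ?thesis by (simp add: a2_def power2_eq_square algebra_simps)
  qed
  show ?thesis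
    unfolding sum_V_dU using 1 2
    unfolding B_def[symmetric] N_def[symmetric] m_def[symmetric] R_def[symmetric]
    by (simp add: algebra_simps)
qed

text \<open>From the second field only - 2 n b Wt is kept, as its other term has the same sign. With
  S^2 <= P the first field contributes at most a multiple of m B, the size of the error already
  present in \<open>V_dU_lower\<close>.\<close>

lemma dV_upper:
  assumes "\<epsilon> \<ge> 0" "b \<ge> 0"
  shows "(\<Sum>j\<in>UNIV. dV \<epsilon> b j z) \<le> \<epsilon> * (2 * real CARD('n) + p) * (hP k z powr ((p - 4) / 4) * heis_B k z) - 2 * real CARD('n) * b * Wt z"
proof -
  define B where "B = heis_B k z"
  define n where "n = real CARD('n)"
  define m where "m = hP k z powr ((p - 4) / 4)"
  define P where "P = hP k z"
  have B: "B \<ge> 0" using heis_B_nonneg by (simp add: B_def)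
  have P: "P > 0" using hP_pos by (simp add: P_def)
  have "hP k z powr ((p - 4) / 4 - 1) * (B\<^sup>2 + (snd z)\<^sup>2) \<le> hP k z powr ((p - 4) / 4 - 1) * P"
    by (intro mult_left_mono) (auto simp: P_def hP_def B_def)
  also have "\<dots> = m" using P by (simp add: powr_diff m_def P_def)
  finally have "(p - 4) * B * (hP k z powr ((p - 4) / 4 - 1) * (B\<^sup>2 + (snd z)\<^sup>2)) \<le> (p - 4) * B * m"
    using p B by (intro mult_left_mono) auto
  then have "\<epsilon> * (m * (2 * n + 4) * B + (p - 4) * hP k z powr ((p - 4) / 4 - 1) * B * (B\<^sup>2 + (snd z)\<^sup>2)) \<le> \<epsilon> * ((2 * n + p) * (m * B))"
    using assms(1) by (intro mult_left_mono) (auto simp: algebra_simps)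
  moreover have "0 \<le> b * ((p - 2) * hP k z powr ((p - 2) / 4 - 1) * B\<^sup>2)"
    using assms(2) p by simp
  ultimately show ?thesis
    unfolding sum_dV B_def[symmetric] n_def[symmetric] m_def[symmetric] by (simp add: algebra_simps n_def)
qed

text \<open>The factor A <= 2 B in |V|^2 is essential: it puts this term on the scale B Wt^2 of the
  gain, which degenerates on the \<open>t\<close>-axis.\<close>

lemma V_sq_upper:
  shows "(\<Sum>j\<in>UNIV. (V \<epsilon> b j z)\<^sup>2) / 2 \<le> 4 * (\<epsilon>\<^sup>2 + b\<^sup>2) * heis_B k z * (Wt z)\<^sup>2"
proof -
  define B where "B = heis_B k z"
  define m where "m = hP k z powr ((p - 4) / 4)"
  define P where "P = hP k z"
  define t where "t = snd z"
  have B: "B \<ge> 0" using heis_B_nonneg by (simp add: B_def)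
  have mP: "m\<^sup>2 * P = (Wt z)\<^sup>2"
  proof -
    have "P powr (1/2) * P powr (1/2) = P" using hP_pos[of k z] unfolding powr_add[symmetric] by (simp add: P_def)
    then have "m\<^sup>2 * P = (m * P powr (1/2))\<^sup>2" by (simp add: power2_eq_square algebra_simps)
    then show ?thesis using P_powr_Wt[of z] by (simp add: m_def P_def)
  qed
  have "(\<epsilon> * m * B - b * Wt z)\<^sup>2 \<le> 2 * (\<epsilon> * m * B)\<^sup>2 + 2 * (b * Wt z)\<^sup>2"
    using sum_squares_bound[of "\<epsilon> * m * B" "- (b * Wt z)"] by (simp add: power2_eq_square algebra_simps)
  then have "(\<epsilon> * m * B - b * Wt z)\<^sup>2 + (\<epsilon> * m * t)\<^sup>2 \<le> 2 * \<epsilon>\<^sup>2 * (m\<^sup>2 * (B\<^sup>2 + t\<^sup>2)) + 2 * b\<^sup>2 * (Wt z)\<^sup>2"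
    by (simp add: power_mult_distrib algebra_simps add_increasing)
  also have "\<dots> \<le> 2 * \<epsilon>\<^sup>2 * (m\<^sup>2 * P) + 2 * b\<^sup>2 * (Wt z)\<^sup>2"
    by (intro add_right_mono mult_left_mono) (auto simp: P_def hP_def B_def t_def)
  also have "\<dots> = 2 * (\<epsilon>\<^sup>2 + b\<^sup>2) * (Wt z)\<^sup>2" unfolding mP by (simp add: algebra_simps)
  finally have *: "(\<epsilon> * m * B - b * Wt z)\<^sup>2 + (\<epsilon> * m * t)\<^sup>2 \<le> 2 * (\<epsilon>\<^sup>2 + b\<^sup>2) * (Wt z)\<^sup>2" .
  have "(\<Sum>j\<in>UNIV. (V \<epsilon> b j z)\<^sup>2) / 2 = heis_A k z * ((\<epsilon> * m * B - b * Wt z)\<^sup>2 + (\<epsilon> * m * t)\<^sup>2)"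
    unfolding sum_V_sq by (simp add: m_def B_def t_def)
  also have "\<dots> \<le> (2 * B) * (2 * (\<epsilon>\<^sup>2 + b\<^sup>2) * (Wt z)\<^sup>2)"
    using * heis_A_le_B[of k z] B by (intro mult_mono) (auto simp: B_def)
  finally show ?thesis by (simp add: B_def algebra_simps)
qed

text \<open>On the scale B Wt^2 the gain \<epsilon> a3 is linear in \<epsilon>, the term |V|^2 is
  quadratic, and the second field costs b a2. Small parameters leave half of the gain, which absorbs
  the error K m B up to a constant. What survives is 2 n b Wt from the divergence of the second
  field.\<close>

lemma drift_bound:
  obtains \<epsilon> b c C where "c > 0" "C \<ge> 0"
    "\<And>z. (\<Sum>j\<in>UNIV. V \<epsilon> b j z * dU j z) - (\<Sum>j\<in>UNIV. dV \<epsilon> b j z) - (\<Sum>j\<in>UNIV. (V \<epsilon> b j z)\<^sup>2) / 2 \<ge> c * Wt z - C"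
proof -
  define a1 where "a1 = \<alpha> * p * 2 powr (- p / 2)"
  define a2 where "a2 = \<alpha> * p * 2 powr (p / 2) * 2"
  define a3 where "a3 = a1 * 2 powr (- p / 4)"
  have a: "a1 > 0" "a2 > 0" "a3 > 0" using \<alpha> p by (auto simp: a1_def a2_def a3_def)
  \<comment> \<open>The choice of \<eta> bounds b a2 by a quarter of the gain, and the choice of
    \<epsilon> bounds 4 (\<epsilon>^2 + b^2) <= 8 \<epsilon>^2 by another quarter.\<close>
  define \<eta> where "\<eta> = min 1 (a3 / (4 * a2))"
  define \<epsilon> where "\<epsilon> = min 1 (a3 / 32)"
  define b where "b = \<eta> * \<epsilon>"
  have \<eta>: "0 < \<eta>" "\<eta> \<le> 1" "\<eta> * a2 \<le> a3 / 4"
    using a by (auto simp: \<eta>_def min_def field_simps)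
  have \<epsilon>: "0 < \<epsilon>" "8 * \<epsilon> \<le> a3 / 4" using a by (auto simp: \<epsilon>_def)
  have b: "0 < b" "b \<le> \<epsilon>" using \<eta> \<epsilon> by (auto simp: b_def mult_le_cancel_right1)
  define \<theta> where "\<theta> = \<epsilon> * a3 / 2"
  have \<theta>: "\<theta> > 0" using \<epsilon> a by (simp add: \<theta>_def)
  define n where "n = real CARD('n)"
  define K where "K = \<epsilon> * a1 + \<epsilon> * (2 * n + p)"
  have K: "K \<ge> 0" using \<epsilon> a p by (simp add: K_def n_def)
  have n: "n \<ge> 1" by (simp add: n_def Suc_leI)
  have main: "2 * n * b * Wt z - K\<^sup>2 / \<theta> \<le> (\<Sum>j\<in>UNIV. V \<epsilon> b j z * dU j z) - (\<Sum>j\<in>UNIV. dV \<epsilon> b j z) - (\<Sum>j\<in>UNIV. (V \<epsilon> b j z)\<^sup>2) / 2" for z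
  proof -
    define B where "B = heis_B k z"
    define m where "m = hP k z powr ((p - 4) / 4)"
    define W where "W = Wt z"
    have B: "B \<ge> 0" using heis_B_nonneg by (simp add: B_def)
    have m: "0 \<le> m" "m \<le> W"
      unfolding m_def W_def Wt_def using hP_ge_1[of k z] by (auto intro: powr_mono)
    have mB: "m * B \<le> W"
    proof -
      have "m * B \<le> m * hP k z powr (1/2)"
        using order_trans[OF heis_B_le_S hS_le_P, of k z] m by (intro mult_left_mono) (auto simp: B_def)
      then show ?thesis using P_powr_Wt[of z] by (simp add: m_def W_def)
    qed
    have bW: "B * W\<^sup>2 \<ge> 0" using B by simp
    \<comment> \<open>For large \<open>W\<close> the error is compared with W B W through m <= W;
      for bounded \<open>W\<close> the estimate m B <= W leaves a constant.\<close>
    have absorb: "K * (m * B) \<le> \<theta> * (B * W\<^sup>2) + K\<^sup>2 / \<theta>"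
    proof (cases "K \<le> \<theta> * W")
      case True
      have "K * (m * B) \<le> (\<theta> * W) * (W * B)"
        using True m B K \<theta> by (intro mult_mono) auto
      also have "\<dots> = \<theta> * (B * W\<^sup>2)" by (simp add: power2_eq_square algebra_simps)
      finally show ?thesis using K \<theta> by (simp add: add_increasing2)
    next
      case False
      have "W \<le> K / \<theta>" using False \<theta> by (simp add: le_divide_eq mult.commute)
      then have "K * (m * B) \<le> K * (K / \<theta>)"
        using mB K by (intro mult_left_mono) auto
      also have "\<dots> = K\<^sup>2 / \<theta>" by (simp add: power2_eq_square)
      finally show ?thesis using bW \<theta> by (simp add: add_increasing)
    qed
    have coef: "\<theta> \<le> \<epsilon> * a3 - b * a2 - 4 * (\<epsilon>\<^sup>2 + b\<^sup>2)"
    proof -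
      have "b * a2 \<le> \<epsilon> * (a3 / 4)" using \<eta>(3) \<epsilon> by (simp add: b_def mult.assoc mult.left_commute)
      moreover have "b\<^sup>2 \<le> \<epsilon>\<^sup>2" using b by (intro power_mono) auto
      moreover have "\<epsilon> * (8 * \<epsilon>) \<le> \<epsilon> * (a3 / 4)" using \<epsilon> by (intro mult_left_mono) auto
      ultimately show ?thesis by (simp add: \<theta>_def power2_eq_square)
    qed
    have "\<theta> * (B * W\<^sup>2) \<le> (\<epsilon> * a3 - b * a2 - 4 * (\<epsilon>\<^sup>2 + b\<^sup>2)) * (B * W\<^sup>2)"
      using coef bW by (rule mult_right_mono)
    then have 1: "\<theta> * (B * W\<^sup>2) \<le> \<epsilon> * a3 * (B * W\<^sup>2) - b * a2 * (B * W\<^sup>2) - 4 * (\<epsilon>\<^sup>2 + b\<^sup>2) * (B * W\<^sup>2)"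
      by (simp add: algebra_simps)
    have 2: "\<epsilon> * a3 * (B * W\<^sup>2) - \<epsilon> * a1 * (m * B) - b * a2 * (B * W\<^sup>2) \<le> (\<Sum>j\<in>UNIV. V \<epsilon> b j z * dU j z)"
      using V_dU_lower[of \<epsilon> b z] \<epsilon> b unfolding a1_def[symmetric] a2_def[symmetric]
      by (simp add: a3_def B_def m_def W_def algebra_simps)
    have 3: "(\<Sum>j\<in>UNIV. dV \<epsilon> b j z) \<le> \<epsilon> * (2 * n + p) * (m * B) - 2 * n * b * W"
      using dV_upper[of \<epsilon> b z] \<epsilon> b by (simp add: B_def m_def W_def n_def)
    have 4: "(\<Sum>j\<in>UNIV. (V \<epsilon> b j z)\<^sup>2) / 2 \<le> 4 * (\<epsilon>\<^sup>2 + b\<^sup>2) * (B * W\<^sup>2)"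
      using V_sq_upper[of \<epsilon> b z] by (simp add: B_def W_def mult.assoc)
    have "K * (m * B) = \<epsilon> * a1 * (m * B) + \<epsilon> * (2 * n + p) * (m * B)" by (simp add: K_def algebra_simps)
    then show ?thesis using 1 2 3 4 absorb unfolding W_def[symmetric] by linarith
  qed
  show ?thesis
    by (rule that[of "2 * n * b" "K\<^sup>2 / \<theta>", OF _ _ main]) (use n b \<theta> in auto)
qed

end

section \<open>Cutoffs and the weighted U-bound\<close>

text \<open>Fatou. As \<open>ennreal\<close> clips negative values, the integrals may also be those
  of positive parts, such as that of v - s.\<close>

lemma nn_integral_tendsto_le:
  fixes f :: "nat \<Rightarrow> 'a \<Rightarrow> real"
  assumes [measurable]: "\<And>i. f i \<in> borel_measurable M" and lim: "\<And>z. (\<lambda>i. f i z) \<longlonglongrightarrow> g z"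
    and le: "\<And>i. (\<integral>\<^sup>+z. ennreal (f i z) \<partial>M) \<le> K"
  shows "(\<integral>\<^sup>+z. ennreal (g z) \<partial>M) \<le> K"
proof -
  have "(\<integral>\<^sup>+z. ennreal (g z) \<partial>M) = (\<integral>\<^sup>+z. liminf (\<lambda>i. ennreal (f i z)) \<partial>M)"
    using lim by (intro nn_integral_cong) (metis lim_imp_Liminf tendsto_ennrealI trivial_limit_sequentially)
  also have "\<dots> \<le> liminf (\<lambda>i. \<integral>\<^sup>+z. ennreal (f i z) \<partial>M)" by (rule nn_integral_liminf) measurable
  also have "\<dots> \<le> liminf (\<lambda>i. K)" by (intro Liminf_mono always_eventually allI le)
  also have "\<dots> = K" by (simp add: Liminf_const)
  finally show ?thesis .
qed

text \<open>The dominating function \<open>H\<close> is not tied to \<open>h\<close> by a formula. A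
  cutoff therefore produces another such pair, with constants independent of its radius, and the
  estimates can be run on compactly supported functions.\<close>

definition hdom :: "'n::finite \<Rightarrow> ('n heis \<Rightarrow> real) \<Rightarrow> ('n heis \<Rightarrow> real) \<Rightarrow> bool" where
  "hdom k h H \<longleftrightarrow> hreg k h \<and> (\<forall>z. 0 \<le> h z) \<and> H \<in> borel_measurable borel \<and> (\<forall>z. 0 \<le> H z) \<and>
     (\<forall>j. AE z in lborel. (hderiv k j h z)\<^sup>2 \<le> h z * H z)"

lemma hdomD:
  assumes "hdom k h H"
  shows "hreg k h" "0 \<le> h z" "H \<in> borel_measurable borel" "0 \<le> H z" "AE z in lborel. (hderiv k j h z)\<^sup>2 \<le> h z * H z"
  using assms by (simp_all add: hdom_def del: split_paired_All)

text \<open>The square makes the function continuously differentiable along the flows and bounds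
  |X_j cutoff|^2 by a multiple of the cutoff itself, which is what keeps products within
  \<open>hdom\<close>.\<close>

definition cutoff :: "'n::finite \<Rightarrow> real \<Rightarrow> 'n heis \<Rightarrow> real" where
  "cutoff k R z = (max 0 (1 - hP k z / R))\<^sup>2"

lemma cutoff_nonneg: "0 \<le> cutoff k R z" by (simp add: cutoff_def)

lemma cutoff_le_1: "R \<ge> 1 \<Longrightarrow> cutoff k R z \<le> 1"
  unfolding cutoff_def using hP_pos[of k z] by (intro power_le_one) auto

text \<open>For q > 1 the one-sided power is differentiable across 0, since its quotient there is at
  most |h|^(q-1). This serves the cutoff and both halves of |f|^q.\<close>

lemma DERIV_max_powr:
  fixes q :: real
  assumes q: "q > 1"
  shows "((\<lambda>y. (max 0 y) powr q) has_real_derivative q * (max 0 y) powr (q - 1)) (at y)"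
proof -
  consider "y > 0" | "y < 0" | "y = 0" by linarith
  then show ?thesis
  proof cases
    case 1
    have ev: "\<forall>\<^sub>F x in nhds y. (max 0 x) powr q = x powr q"
      using eventually_nhds_in_open[of "{0<..}" y] 1 by (auto elim!: eventually_mono)
    show ?thesis using 1 has_real_derivative_powr[of y q]
      by (subst DERIV_cong_ev[OF refl ev refl]) (simp add: max_def)
  next
    case 2
    have ev: "\<forall>\<^sub>F x in nhds y. (max 0 x) powr q = 0"
      using eventually_nhds_in_open[of "{..<0}" y] 2 by (auto elim!: eventually_mono)
    show ?thesis using 2 by (subst DERIV_cong_ev[OF refl ev refl]) (simp add: max_def)
  next
    case 3
    have "((\<lambda>h::real. (max 0 h) powr q / h) \<longlongrightarrow> 0) (at 0)"
    proof (rule Lim_null_comparison)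
      have "continuous_on UNIV (\<lambda>h::real. \<bar>h\<bar> powr (q - 1))"
        using q by (intro continuous_on_powr' continuous_intros) auto
      then have "((\<lambda>h::real. \<bar>h\<bar> powr (q - 1)) \<longlongrightarrow> \<bar>0\<bar> powr (q - 1)) (at 0)"
        unfolding continuous_on_eq_continuous_at[OF open_UNIV] isCont_def by blast
      then show "((\<lambda>h::real. \<bar>h\<bar> powr (q - 1)) \<longlongrightarrow> 0) (at 0)" by simp
      show "\<forall>\<^sub>F h in at (0::real). norm ((max 0 h) powr q / h) \<le> \<bar>h\<bar> powr (q - 1)"
      proof (intro always_eventually allI)
        fix h :: real
        show "norm ((max 0 h) powr q / h) \<le> \<bar>h\<bar> powr (q - 1)"
        proof (cases "h > 0")
          case True then show ?thesis by (simp add: powr_diff)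
        next
          case False
          then have "norm ((max 0 h) powr q / h) = 0" by (simp add: max_def)
          also have "\<dots> \<le> \<bar>h\<bar> powr (q - 1)" by simp
          finally show ?thesis .
        qed
      qed
    qed
    then show ?thesis using 3 by (simp add: DERIV_def)
  qed
qed

lemma DERIV_max_sq: "((\<lambda>y::real. (max 0 y)\<^sup>2) has_real_derivative 2 * max 0 y) (at y)"
  using DERIV_max_powr[of 2 y] by simp

definition dcutoff :: "'n::finite \<Rightarrow> real \<Rightarrow> 'n + 'n \<Rightarrow> 'n heis \<Rightarrow> real" where
  "dcutoff k R j z = - 2 * max 0 (1 - hP k z / R) / R * dP k j z"

lemma has_hderiv_cutoff: "has_hderiv k j (cutoff k R) (dcutoff k R j z) z"
proof -
  have 1: "((\<lambda>x. 1 - x / R) has_real_derivative - (1 / R)) (at x)" for x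
    by (cases "R = 0") (auto intro!: derivative_eq_intros)
  have 2: "((\<lambda>x. (max 0 (1 - x / R))\<^sup>2) has_real_derivative 2 * max 0 (1 - x / R) * - (1 / R)) (at x)" for x
    by (rule DERIV_chain2[OF DERIV_max_sq 1])
  have "2 * max 0 (1 - hP k z / R) * - (1 / R) * dP k j z = dcutoff k R j z"
    by (simp add: dcutoff_def)
  with has_hderiv_compose[OF has_hderiv_P[of k j z] 2] show ?thesis
    unfolding cutoff_def by simp
qed

lemma hreg_cutoff: "hreg k (cutoff k R)"
proof (rule hregI'[OF _ has_hderiv_cutoff])
  show "continuous_on UNIV (cutoff k R)"
    unfolding cutoff_def divide_inverse by (intro continuous_intros)
  show "continuous_on UNIV (dcutoff k R j)" for j
    unfolding dcutoff_def divide_inverse by (intro continuous_intros)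
qed

lemma dP_sq_le:
  "(dP k j z)\<^sup>2 \<le> 64 * ((hS k z)\<^sup>2 * hS k z)"
proof -
  define S where "S = hS k z"
  define r where "r = 2 * S powr (1/2)"
  have S: "S \<ge> 0" by (simp add: S_def hS_nonneg)
  have w: "\<bar>hw k j * a\<bar> \<le> \<bar>a\<bar>" for a
    using hw_bounds[of k j] mult_right_mono[of "\<bar>hw k j\<bar>" 1 "\<bar>a\<bar>"] by (simp add: abs_mult)
  have t: "\<bar>snd z\<bar> \<le> S" unfolding S_def hS_def by (rule real_le_rsqrt) simp
  have "\<bar>heis_B k z * (hw k j * fst z $ j) + snd z * (hw k j * hrot z j)\<bar>
      \<le> \<bar>heis_B k z\<bar> * \<bar>hw k j * fst z $ j\<bar> + \<bar>snd z\<bar> * \<bar>hw k j * hrot z j\<bar>"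
    unfolding abs_mult[symmetric] by (rule abs_triangle_ineq)
  also have "\<dots> \<le> S * r + S * r"
    using heis_B_nonneg[of k z] heis_B_le_S[of k z] t S order_trans[OF w abs_fst_le[of z j k]] order_trans[OF w abs_hrot_le'[of z j k]]
    by (intro add_mono mult_mono) (auto simp: S_def r_def)
  finally have d: "\<bar>dP k j z\<bar> \<le> 4 * S * r" by (simp add: dP_def)
  have "(dP k j z)\<^sup>2 \<le> (4 * S * r)\<^sup>2"
    using d S by (intro abs_le_square_iff[THEN iffD1]) (auto simp: r_def)
  also have "\<dots> = 64 * (S\<^sup>2 * S)"
    using S powr_add[of S "1/2" "1/2"] by (simp add: r_def power2_eq_square)
  finally show ?thesis by (simp add: S_def)
qed

lemma hS_le_hP: "hS k z \<le> hP k z"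
  using sum_squares_bound[of "hS k z" 1] hS_nonneg[of k z] by (simp add: hP_eq)

text \<open>On the support P < R, where S^2 <= P and S <= P bound (X_j P)^2 by 64 R^2. This cancels
  the R^2 from the slope of the cutoff, so the constant is uniform in \<open>R\<close>.\<close>

lemma dcutoff_sq_le:
  assumes R: "R \<ge> 1"
  shows "(dcutoff k R j z)\<^sup>2 \<le> 256 * cutoff k R z"
proof (cases "hP k z < R")
  case False
  then show ?thesis using R by (simp add: dcutoff_def cutoff_def max_def)
next
  case True
  note dP_sq_le[of k j z]
  also have "64 * ((hS k z)\<^sup>2 * hS k z) \<le> 64 * (R * R)"
    using True R hS_le_hP[of k z] hS_nonneg[of k z] hP_eq[of k z] by (intro mult_left_mono mult_mono) auto
  finally have D: "(dP k j z)\<^sup>2 \<le> 64 * (R * R)" .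
  have "(dcutoff k R j z)\<^sup>2 = 4 * cutoff k R z / (R * R) * (dP k j z)\<^sup>2"
    unfolding dcutoff_def cutoff_def power_mult_distrib power_divide by (simp add: power2_eq_square)
  also have "\<dots> \<le> 4 * cutoff k R z / (R * R) * (64 * (R * R))"
    using D cutoff_nonneg[of k R z] R by (intro mult_left_mono) auto
  also have "\<dots> = 256 * cutoff k R z" using R by simp
  finally show ?thesis .
qed

lemma hdom_cutoff:
  assumes h: "hdom k h H" and R: "R \<ge> 1"
  shows "hdom k (\<lambda>z. h z * cutoff k R z) (\<lambda>z. 2 * H z + 512 * h z)"
  unfolding hdom_def
proof (intro conjI allI)
  note [measurable] = hdomD(3)[OF h] hreg_borel[OF hdomD(1)[OF h]]
  show "hreg k (\<lambda>z. h z * cutoff k R z)" by (rule hreg_mult[OF hdomD(1)[OF h] hreg_cutoff])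
  show "0 \<le> h z * cutoff k R z" for z using hdomD(2)[OF h, of z] cutoff_nonneg[of k R z] by simp
  show "(\<lambda>z. 2 * H z + 512 * h z) \<in> borel_measurable borel" by measurable
  show "0 \<le> 2 * H z + 512 * h z" for z using hdomD(2)[OF h, of z] hdomD(4)[OF h, of z] by simp
  fix j
  show "AE z in lborel. (hderiv k j (\<lambda>z. h z * cutoff k R z) z)\<^sup>2 \<le> h z * cutoff k R z * (2 * H z + 512 * h z)"
    using hreg_AE[OF hdomD(1)[OF h], of j] hdomD(5)[OF h, of j]
  proof eventually_elim
    case (elim z)
    define d where "d = hderiv k j h z"
    define c where "c = cutoff k R z"
    define e where "e = dcutoff k R j z"
    have "hderiv k j (\<lambda>z. h z * cutoff k R z) z = d * c + h z * e"
      unfolding d_def c_def e_def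
      by (intro hderiv_eqI has_hderiv_mult has_hderiv_hderiv has_hderiv_cutoff elim)
    moreover have "(d * c + h z * e)\<^sup>2 \<le> 2 * (d\<^sup>2 * c\<^sup>2) + 2 * ((h z)\<^sup>2 * e\<^sup>2)"
      using sum_squares_bound[of "d * c" "h z * e"] by (simp add: power2_eq_square algebra_simps)
    moreover have "d\<^sup>2 * c\<^sup>2 \<le> (h z * H z) * c"
    proof (intro mult_mono)
      show "c\<^sup>2 \<le> c" using cutoff_nonneg[of k R z] cutoff_le_1[OF R, of k z]
        by (simp add: c_def power2_eq_square mult_left_le)
    qed (use elim hdomD(2)[OF h, of z] hdomD(4)[OF h, of z] in \<open>auto simp: d_def\<close>)
    moreover have "(h z)\<^sup>2 * e\<^sup>2 \<le> (h z)\<^sup>2 * (256 * c)"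
      using dcutoff_sq_le[OF R, of k j z] by (intro mult_left_mono) (auto simp: e_def c_def)
    ultimately show ?case
      unfolding c_def[symmetric] by (simp add: power2_eq_square algebra_simps)
  qed
qed

text \<open>Makes the sublevel sets of \<open>P\<close>, and with them the supports of the cutoffs,
  bounded in the Euclidean norm.\<close>

lemma norm_le_hP: "norm z \<le> 3 * hP k z"
proof -
  have B: "heis_B k z \<le> hP k z" and t: "\<bar>snd z\<bar> \<le> hP k z"
  proof -
    have a: "a \<le> 1 + a\<^sup>2" for a :: real
      using zero_le_power2[of "a - 1/2"] by (simp add: power2_eq_square algebra_simps)
    show "heis_B k z \<le> hP k z" "\<bar>snd z\<bar> \<le> hP k z"
      using a[of "heis_B k z"] a[of "\<bar>snd z\<bar>"] zero_le_power2[of "snd z"] zero_le_power2[of "heis_B k z"]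
      unfolding hP_def power2_abs by linarith+
  qed
  have "(norm (fst z))\<^sup>2 = 2 * heis_A k z"
    by (simp add: norm_vec_def L2_set_def sum_nonneg heis_A_eq)
  also have "\<dots> \<le> 4 * hP k z" using heis_A_le_B[of k z] B by linarith
  also have "\<dots> \<le> 4 * (hP k z * hP k z)" using hP_ge_1[of k z] by (intro mult_left_mono) auto
  also have "\<dots> = (2 * hP k z)\<^sup>2" by (simp add: power2_eq_square)
  finally have "norm (fst z) \<le> 2 * hP k z"
    by (rule power2_le_imp_le) (use hP_pos[of k z] in simp)
  moreover have "norm z \<le> norm (fst z) + norm (snd z)" using norm_Pair_le[of "fst z" "snd z"] by simp
  ultimately show ?thesis using t unfolding real_norm_def by linarith
qed

lemma cutoff_support: "R > 0 \<Longrightarrow> norm z > 3 * R \<Longrightarrow> cutoff k R z = 0"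
  using norm_le_hP[of z k] by (simp add: cutoff_def max_def)

lemma cutoff_tendsto: "(\<lambda>i. cutoff k (real (Suc i)) z) \<longlonglongrightarrow> 1"
proof -
  have "(\<lambda>i. hP k z / real (Suc i)) \<longlonglongrightarrow> 0" by (rule LIMSEQ_Suc[OF lim_const_over_n])
  then have "(\<lambda>i. (max 0 (1 - hP k z / real (Suc i)))\<^sup>2) \<longlonglongrightarrow> (max 0 (1 - 0))\<^sup>2"
    by (intro tendsto_intros)
  then show ?thesis by (simp add: cutoff_def)
qed

context heis_potential
begin

text \<open>The divergence of h wt V integrates to 0. Young's inequality splits X_j h V_j into H / 2
  and h V_j^2 / 2, and the latter is already accounted for in \<open>drift_bound\<close>; the 2 n
  indices with weight 1/2 give the factor \<open>n\<close>.\<close>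

lemma U_bound_compact:
  obtains C where "C \<ge> 0"
    "\<And>h H R. hdom k h H \<Longrightarrow> \<forall>z. norm z > R \<longrightarrow> h z = 0 \<Longrightarrow> wintegrable H \<Longrightarrow>
      (\<integral>z. h z * Wt z * wt z \<partial>lborel) \<le> C * (wint h + wint H)"
proof -
  obtain \<epsilon> b c C0 where c: "c > 0" and C0: "C0 \<ge> 0" and
    drift: "\<And>z. (\<Sum>j\<in>UNIV. V \<epsilon> b j z * dU j z) - (\<Sum>j\<in>UNIV. dV \<epsilon> b j z) - (\<Sum>j\<in>UNIV. (V \<epsilon> b j z)\<^sup>2) / 2 \<ge> c * Wt z - C0"
    by (rule drift_bound) (rule that)
  define n where "n = real CARD('n)"
  show ?thesis
  proof (rule that[of "C0 / c + n / c"])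
    fix h H R
    assume h: "hdom k h H" and supp': "\<forall>z. norm z > R \<longrightarrow> h z = 0" and Hint: "wintegrable H"
    then have supp: "\<And>z. norm z > R \<Longrightarrow> h z = 0" by blast
    define g where "g j z = h z * (V \<epsilon> b j z * wt z)" for j z
    have hc: "continuous_on UNIV h" by (rule hreg_continuous[OF hdomD(1)[OF h]])
    have Wc: "continuous_on UNIV Wt" unfolding Wt_def by (intro continuous_intros)
    have "hreg k (g j)" for j
      unfolding g_def by (intro hreg_mult hdomD(1)[OF h] hreg_V hreg_wt)
    moreover have "norm z > R \<Longrightarrow> g j z = 0" for j z using supp by (simp add: g_def)
    ultimately have gi: "integrable lborel (hderiv k j (g j))" and g0: "(\<integral>z. hderiv k j (g j) z \<partial>lborel) = 0" for j
      using hderiv_integral(1,2)[of k "g j" R j] by auto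
    have i1: "integrable lborel (\<lambda>z. h z * Wt z * wt z)" and i2: "wintegrable h"
      using supp by (auto intro!: integrable_compact_support[of _ R] continuous_intros hc Wc)
    have "AE z in lborel. \<forall>j\<in>UNIV. hdifferentiable k j h z \<and> (hderiv k j h z)\<^sup>2 \<le> h z * H z"
      using hreg_AE[OF hdomD(1)[OF h]] hdomD(5)[OF h] by (intro AE_finite_allI) auto
    then have ae: "AE z in lborel. (\<Sum>j\<in>UNIV. hderiv k j (g j) z) \<le> n * (H z * wt z) + C0 * (h z * wt z) - c * (h z * Wt z * wt z)"
    proof eventually_elim
      case (elim z)
      have d: "hderiv k j (g j) z = (hderiv k j h z * V \<epsilon> b j z + h z * (dV \<epsilon> b j z - V \<epsilon> b j z * dU j z)) * wt z" for j
      proof -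
        have "has_hderiv k j (g j) (hderiv k j h z * (V \<epsilon> b j z * wt z) + h z * (dV \<epsilon> b j z * wt z + V \<epsilon> b j z * (- dU j z * wt z))) z"
          unfolding g_def using elim by (intro has_hderiv_mult has_hderiv_hderiv has_hderiv_V has_hderiv_wt) auto
        from hderiv_eqI[OF this] show ?thesis by (simp add: algebra_simps)
      qed
      \<comment> \<open>From (X_j h)^2 <= h H and h H v^2 <= ((H + h v^2) / 2)^2, in a form without
        division by \<open>h\<close>, which may vanish.\<close>
      have y: "hderiv k j h z * V \<epsilon> b j z \<le> (H z + h z * (V \<epsilon> b j z)\<^sup>2) / 2" for j
      proof -
        define d where "d = hderiv k j h z"
        define v where "v = V \<epsilon> b j z"
        have dd: "d\<^sup>2 \<le> h z * H z" using elim by (simp add: d_def)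
        have "(d * v)\<^sup>2 \<le> (h z * H z) * v\<^sup>2" unfolding power_mult_distrib by (intro mult_right_mono dd) auto
        also have "\<dots> \<le> ((H z + h z * v\<^sup>2) / 2)\<^sup>2"
          using zero_le_power2[of "H z - h z * v\<^sup>2"] by (simp add: power2_eq_square algebra_simps)
        finally have "\<bar>d * v\<bar> \<le> \<bar>(H z + h z * v\<^sup>2) / 2\<bar>" by (simp only: abs_le_square_iff)
        also have "\<dots> = (H z + h z * v\<^sup>2) / 2" using hdomD(2)[OF h, of z] hdomD(4)[OF h, of z] by simp
        finally show ?thesis by (simp add: d_def v_def)
      qed
      have "(\<Sum>j\<in>UNIV. hderiv k j h z * V \<epsilon> b j z) \<le> (\<Sum>j\<in>UNIV. (H z + h z * (V \<epsilon> b j z)\<^sup>2) / 2)"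
        by (intro sum_mono y)
      also have "\<dots> = n * H z + h z * ((\<Sum>j\<in>UNIV. (V \<epsilon> b j z)\<^sup>2) / 2)"
        by (simp add: sum.distrib sum_divide_distrib[symmetric] sum_distrib_left[symmetric] n_def add_divide_distrib)
      finally have "(\<Sum>j\<in>UNIV. hderiv k j h z * V \<epsilon> b j z) + h z * ((\<Sum>j\<in>UNIV. dV \<epsilon> b j z) - (\<Sum>j\<in>UNIV. V \<epsilon> b j z * dU j z))
         \<le> n * H z - h z * ((\<Sum>j\<in>UNIV. V \<epsilon> b j z * dU j z) - (\<Sum>j\<in>UNIV. dV \<epsilon> b j z) - (\<Sum>j\<in>UNIV. (V \<epsilon> b j z)\<^sup>2) / 2)"
        by (simp add: algebra_simps)
      also have "\<dots> \<le> n * H z - h z * (c * Wt z - C0)"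
        using drift[of z] hdomD(2)[OF h, of z] by (intro diff_left_mono mult_left_mono) auto
      finally have *: "(\<Sum>j\<in>UNIV. hderiv k j h z * V \<epsilon> b j z) + h z * ((\<Sum>j\<in>UNIV. dV \<epsilon> b j z) - (\<Sum>j\<in>UNIV. V \<epsilon> b j z * dU j z))
         \<le> n * H z - h z * (c * Wt z - C0)" .
      have "(\<Sum>j\<in>UNIV. hderiv k j (g j) z) = ((\<Sum>j\<in>UNIV. hderiv k j h z * V \<epsilon> b j z)
          + h z * ((\<Sum>j\<in>UNIV. dV \<epsilon> b j z) - (\<Sum>j\<in>UNIV. V \<epsilon> b j z * dU j z))) * wt z"
        unfolding d by (simp add: sum_distrib_left sum_distrib_right sum.distrib sum_subtractf algebra_simps)
      also have "\<dots> \<le> (n * H z - h z * (c * Wt z - C0)) * wt z"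
        using * wt_pos[of z] by (intro mult_right_mono) auto
      finally show ?case by (simp add: algebra_simps)
    qed
    have "0 = (\<integral>z. (\<Sum>j\<in>UNIV. hderiv k j (g j) z) \<partial>lborel)"
      using gi g0 by (simp add: Bochner_Integration.integral_sum)
    also have "\<dots> \<le> (\<integral>z. n * (H z * wt z) + C0 * (h z * wt z) - c * (h z * Wt z * wt z) \<partial>lborel)"
      using gi Hint i1 i2 ae
      by (intro integral_mono_AE Bochner_Integration.integrable_sum Bochner_Integration.integrable_add
          Bochner_Integration.integrable_diff integrable_mult_right) auto
    also have "\<dots> = n * (wint H) + C0 * (wint h) - c * (\<integral>z. h z * Wt z * wt z \<partial>lborel)"
      using Hint i1 i2 by simp
    finally have "c * (\<integral>z. h z * Wt z * wt z \<partial>lborel) \<le> C0 * (wint h) + n * (wint H)" by simp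
    also have "\<dots> \<le> (C0 + n) * (wint h + wint H)"
    proof -
      have "0 \<le> (wint h)" "0 \<le> (wint H)" "0 \<le> n"
        using hdomD(2,4)[OF h] by (auto intro!: integral_nonneg_AE AE_I2 mult_nonneg_nonneg less_imp_le[OF wt_pos] simp: n_def)
      then show ?thesis using C0 by (simp add: algebra_simps)
    qed
    finally have "c * (\<integral>z. h z * Wt z * wt z \<partial>lborel) \<le> (C0 + n) * (wint h + wint H)" .
    then show "(\<integral>z. h z * Wt z * wt z \<partial>lborel) \<le> (C0 / c + n / c) * (wint h + wint H)"
      using c by (simp add: pos_le_divide_eq mult.commute flip: add_divide_distrib)
  qed (use c C0 in \<open>auto simp: n_def\<close>)
qed

theorem U_bound:
  obtains C where "C \<ge> 0"
    "\<And>h H. hdom k h H \<Longrightarrow> wintegrable h \<Longrightarrow> wintegrable H \<Longrightarrow>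
      (\<integral>\<^sup>+z. ennreal (h z * Wt z * wt z) \<partial>lborel) \<le> ennreal (C * (wint h + wint H))"
proof -
  obtain C where C: "C \<ge> 0" and
    bd: "\<And>h H R. hdom k h H \<Longrightarrow> \<forall>z. norm z > R \<longrightarrow> h z = 0 \<Longrightarrow> wintegrable H \<Longrightarrow>
      (\<integral>z. h z * Wt z * wt z \<partial>lborel) \<le> C * (wint h + wint H)"
    by (rule U_bound_compact) (rule that)
  show ?thesis
  \<comment> \<open>The cut pair is \<open>h * cutoff\<close> and \<open>2 * H + 512 * h\<close>,
    whose integrals together are at most 513 times those of \<open>h\<close> and
    \<open>H\<close>.\<close>
  proof (rule that[of "513 * C"])
    fix h H
    assume h: "hdom k h H" and hi: "wintegrable h" and Hi: "wintegrable H"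
    have [measurable]: "h \<in> borel_measurable borel" by (rule hreg_borel[OF hdomD(1)[OF h]])
    have [measurable]: "cutoff k R \<in> borel_measurable borel" for R by (rule hreg_borel[OF hreg_cutoff])
    have Wc: "continuous_on UNIV Wt" unfolding Wt_def by (intro continuous_intros)
    then have [measurable]: "Wt \<in> borel_measurable borel" by (rule borel_measurable_continuous_onI)
    let ?c = "\<lambda>i. cutoff k (real (Suc i))"
    let ?K = "513 * C * (wint h + wint H)"
    have I: "(wint h) \<ge> 0" "(wint H) \<ge> 0"
      using hdomD(2,4)[OF h] wt_pos by (auto intro!: integral_nonneg_AE AE_I2 mult_nonneg_nonneg less_imp_le[OF wt_pos])
    show "(\<integral>\<^sup>+z. ennreal (h z * Wt z * wt z) \<partial>lborel) \<le> ennreal ?K"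
    proof (rule nn_integral_tendsto_le[where f = "\<lambda>i z. h z * ?c i z * Wt z * wt z"])
      show "(\<lambda>i. h z * ?c i z * Wt z * wt z) \<longlonglongrightarrow> h z * Wt z * wt z" for z
        using tendsto_mult[OF tendsto_mult[OF tendsto_mult[OF tendsto_const[of "h z"] cutoff_tendsto[of k z]] tendsto_const[of "Wt z"]] tendsto_const[of "wt z"]] by simp
      fix i
      have R: "real (Suc i) \<ge> 1" by simp
      note hd = hdom_cutoff[OF h R]
      have supp: "norm z > 3 * real (Suc i) \<Longrightarrow> h z * ?c i z = 0" for z
        using cutoff_support[of "real (Suc i)" z k] by simp
      then have supp': "\<forall>z. norm z > 3 * real (Suc i) \<longrightarrow> h z * ?c i z = 0" by blast
      have hc: "continuous_on UNIV (\<lambda>z. h z * ?c i z)" by (rule hreg_continuous[OF hdomD(1)[OF hd]])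
      have Hi': "integrable lborel (\<lambda>z. (2 * H z + 512 * h z) * wt z)"
        using hi Hi by (simp add: distrib_right mult.assoc)
      have i2: "integrable lborel (\<lambda>z. h z * ?c i z * wt z)"
        by (rule integrable_compact_support[of _ "3 * real (Suc i)"])
          (intro continuous_on_mult[OF hc] continuous_wt continuous_on_id, simp only: supp mult_zero_left)
      have i1: "integrable lborel (\<lambda>z. h z * ?c i z * Wt z * wt z)"
        by (rule integrable_compact_support[of _ "3 * real (Suc i)"])
          (intro continuous_on_mult[OF continuous_on_mult[OF hc Wc]] continuous_wt continuous_on_id, simp only: supp mult_zero_left)
      have "(\<integral>\<^sup>+z. ennreal (h z * ?c i z * Wt z * wt z) \<partial>lborel) = ennreal (\<integral>z. h z * ?c i z * Wt z * wt z \<partial>lborel)"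
      proof (rule nn_integral_eq_integral[OF i1 AE_I2])
        show "0 \<le> h z * ?c i z * Wt z * wt z" for z
          using hdomD(2)[OF hd, of z] Wt_pos[of z] wt_pos[of z] by (simp only: mult_nonneg_nonneg less_imp_le)
      qed
      also have "\<dots> \<le> ennreal ?K"
      proof (rule ennreal_leI)
        have "(\<integral>z. h z * ?c i z * Wt z * wt z \<partial>lborel) \<le> C * ((\<integral>z. h z * ?c i z * wt z \<partial>lborel) + (\<integral>z. (2 * H z + 512 * h z) * wt z \<partial>lborel))"
          by (rule bd[OF hd supp' Hi'])
        also have "\<dots> \<le> C * ((wint h) + (2 * (wint H) + 512 * (wint h)))"
        proof (intro mult_left_mono add_mono C)
          show "(\<integral>z. h z * ?c i z * wt z \<partial>lborel) \<le> (wint h)"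
          proof (intro integral_mono i2 hi mult_right_mono less_imp_le[OF wt_pos])
            show "h z * ?c i z \<le> h z" for z
              using hdomD(2)[OF h, of z] cutoff_le_1[OF R, of k z] by (simp add: mult_left_le)
          qed
          show "(\<integral>z. (2 * H z + 512 * h z) * wt z \<partial>lborel) \<le> 2 * (wint H) + 512 * (wint h)"
            using hi Hi by (simp add: distrib_right mult.assoc)
        qed
        also have "\<dots> \<le> C * (513 * (wint h + wint H))"
          using I C by (intro mult_left_mono) auto
        finally show "(\<integral>z. h z * ?c i z * Wt z * wt z \<partial>lborel) \<le> ?K" by (simp add: algebra_simps)
      qed
      finally show "(\<integral>\<^sup>+z. ennreal (h z * ?c i z * Wt z * wt z) \<partial>lborel) \<le> ennreal ?K" .
    qed measurable
  qed (use C in auto)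
qed

end

section \<open>Higher integrability of the damped density\<close>

context heis_potential
begin

text \<open>The exponent is chosen to make \<open>damp z * \<bar>dU j z\<bar>\<close> bounded.\<close>

definition damp :: "'n heis \<Rightarrow> real" where "damp z = hP k z powr (- p / 4)"

lemma damp_pos: "damp z > 0" using hP_pos[of k z] by (simp add: damp_def)

lemma damp_le_1: "damp z \<le> 1"
  unfolding damp_def using powr_mono[of "- p / 4" 0 "hP k z"] hP_ge_1[of k z] p by simp

lemma damp_borel [measurable]: "damp \<in> borel_measurable borel"
  unfolding damp_def by (rule hreg_borel[OF hreg_P_powr])

definition ddamp :: "'n + 'n \<Rightarrow> 'n heis \<Rightarrow> real" where
  "ddamp j z = - p / 4 * hP k z powr (- p / 4 - 1) * dP k j z"

lemma has_hderiv_damp: "has_hderiv k j damp (ddamp j z) z"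
  unfolding damp_def ddamp_def by (rule has_hderiv_P_powr)

lemma abs_ddamp_le: "\<bar>ddamp j z\<bar> \<le> 2 * p"
proof -
  define d where "d = dP k j z"
  have P: "hP k z \<ge> 1" by (rule hP_ge_1)
  have "d\<^sup>2 \<le> 64 * ((hS k z)\<^sup>2 * hS k z)" unfolding d_def by (rule dP_sq_le)
  also have "\<dots> \<le> 64 * (hP k z * hP k z)"
    using hS_le_hP[of k z] hS_nonneg[of k z] P by (intro mult_left_mono mult_mono) (auto simp: hP_eq)
  also have "\<dots> = (8 * hP k z)\<^sup>2" by (simp add: power2_eq_square)
  finally have "\<bar>d\<bar> \<le> \<bar>8 * hP k z\<bar>" by (simp only: abs_le_square_iff)
  then have d: "\<bar>d\<bar> \<le> 8 * hP k z" using P by simp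
  have "\<bar>ddamp j z\<bar> = p / 4 * hP k z powr (- p / 4 - 1) * \<bar>d\<bar>"
    using p by (simp add: ddamp_def d_def abs_mult)
  also have "\<dots> \<le> p / 4 * hP k z powr (- p / 4 - 1) * (8 * hP k z)"
    using d p by (intro mult_left_mono) auto
  also have "\<dots> = 2 * p * damp z"
    using P by (simp add: damp_def powr_diff)
  also have "\<dots> \<le> 2 * p * 1" using damp_le_1[of z] p by (intro mult_left_mono) auto
  finally show ?thesis by simp
qed

lemma damped_dU_le: "damp z * \<bar>dU j z\<bar> \<le> 20 * \<alpha> * p * 2 powr (p / 2)"
proof -
  have "damp z * \<bar>dU j z\<bar> \<le> damp z * (20 * \<alpha> * p * 2 powr (p / 2) * hP k z powr (p / 4))"
    using damp_pos[of z] by (intro mult_left_mono abs_dU_le) auto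
  also have "\<dots> = 20 * \<alpha> * p * 2 powr (p / 2) * (hP k z powr (- p / 4) * hP k z powr (p / 4))"
    by (simp add: damp_def)
  also have "hP k z powr (- p / 4) * hP k z powr (p / 4) = 1"
    using hP_pos[of k z] by (simp add: powr_add[symmetric])
  finally show ?thesis by simp
qed

text \<open>The first summand bounds \<open>damp\<close> times |X_j U|, the second |X_j damp|, and
  300 covers the 257 that comes from differentiating \<open>h * cutoff\<close>.\<close>

definition grad_const :: real where "grad_const = 20 * \<alpha> * p * 2 powr (p / 2) + 2 * p + 300"

lemma grad_const_pos: "grad_const > 0"
  using \<alpha> p by (simp add: grad_const_def add_pos_nonneg)

text \<open>The derivative falls on \<open>h * cutoff\<close>, on \<open>wt\<close> or on
  \<open>damp\<close>. Only the second case brings in a growing factor, which \<open>damp\<close>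
  compensates. The bound is uniform in \<open>R\<close>.\<close>

lemma damped_gradient_le:
  assumes h: "hdom k h H" and R: "R \<ge> 1"
  shows "AE z in lborel. \<bar>hderiv k j (\<lambda>z. h z * cutoff k R z * (wt z * damp z)) z\<bar> \<le> grad_const * (h z * wt z + H z * wt z)"
proof -
  note hd = hdom_cutoff[OF h R]
  show ?thesis
    using hreg_AE[OF hdomD(1)[OF hd], of j] hdomD(5)[OF hd, of j]
  proof eventually_elim
    case (elim z)
    define g where "g = h z * cutoff k R z"
    define d where "d = hderiv k j (\<lambda>z. h z * cutoff k R z) z"
    define e where "e = - dU j z * wt z * damp z + wt z * ddamp j z"
    have g: "0 \<le> g" "g \<le> h z"
      using hdomD(2)[OF h, of z] cutoff_nonneg[of k R z] cutoff_le_1[OF R, of k z] by (simp_all add: g_def mult_left_le)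
    have H: "0 \<le> H z" "0 \<le> h z" using hdomD(2,4)[OF h, of z] by auto
    have "d\<^sup>2 \<le> g * (2 * H z + 512 * h z)" using elim by (simp add: g_def d_def)
    also have "\<dots> \<le> h z * (2 * H z + 512 * h z)" using g H by (intro mult_right_mono) auto
    also have "\<dots> \<le> (H z + 256 * h z + h z)\<^sup>2"
      using H by (simp add: power2_eq_square algebra_simps)
    finally have "\<bar>d\<bar> \<le> \<bar>H z + 256 * h z + h z\<bar>" by (simp only: abs_le_square_iff)
    then have d: "\<bar>d\<bar> \<le> H z + 257 * h z" using H by simp
    have "\<bar>e\<bar> \<le> wt z * (damp z * \<bar>dU j z\<bar>) + wt z * \<bar>ddamp j z\<bar>"
      unfolding e_def using wt_pos[of z] damp_pos[of z]
      by (intro order_trans[OF abs_triangle_ineq]) (simp add: abs_mult mult_ac)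
    also have "\<dots> \<le> wt z * (20 * \<alpha> * p * 2 powr (p / 2)) + wt z * (2 * p)"
      using wt_pos[of z] by (intro add_mono mult_left_mono damped_dU_le abs_ddamp_le) auto
    finally have e: "\<bar>e\<bar> \<le> wt z * (20 * \<alpha> * p * 2 powr (p / 2) + 2 * p)" by (simp add: distrib_left)
    have "hderiv k j (\<lambda>z. h z * cutoff k R z * (wt z * damp z)) z = d * (wt z * damp z) + g * e"
      unfolding d_def g_def e_def
      using elim by (intro hderiv_eqI has_hderiv_mult has_hderiv_hderiv has_hderiv_wt has_hderiv_damp) auto
    also have "\<bar>\<dots>\<bar> \<le> \<bar>d\<bar> * (wt z * damp z) + g * \<bar>e\<bar>"
      using wt_pos[of z] damp_pos[of z] g by (intro order_trans[OF abs_triangle_ineq]) (simp add: abs_mult)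
    also have "\<dots> \<le> (H z + 257 * h z) * (wt z * 1) + h z * (wt z * (20 * \<alpha> * p * 2 powr (p / 2) + 2 * p))"
      using d e g H wt_pos[of z] damp_pos[of z] damp_le_1[of z] by (intro add_mono mult_mono) auto
    also have "\<dots> = wt z * (H z + (grad_const - 43) * h z)"
      by (simp add: grad_const_def algebra_simps)
    also have "\<dots> \<le> wt z * (grad_const * H z + grad_const * h z)"
    proof (intro mult_left_mono add_mono)
      have "1 * H z \<le> grad_const * H z" using H \<alpha> p by (intro mult_right_mono) (auto simp: grad_const_def add_increasing)
      then show "H z \<le> grad_const * H z" by simp
      show "(grad_const - 43) * h z \<le> grad_const * h z" using H by (intro mult_right_mono) auto
    qed (use wt_pos[of z] in auto)
    finally show ?case by (simp add: algebra_simps)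
  qed
qed

text \<open>With \<open>r\<close> chosen so that m / r^(2n+2) = s, a bound linear in
  \<open>r\<close> becomes decay like s^(-1/(2n+2)). It is applied to the cut functions, and Fatou
  removes the cutoff.\<close>

lemma damped_truncation_bound:
  assumes h: "hdom k h H" and hi: "wintegrable h" and Hi: "wintegrable H"
    and m: "(wint h) \<le> m" "m > 0" and s: "s > 0"
  shows "(\<integral>\<^sup>+z. ennreal (h z * wt z * damp z - s) \<partial>lborel)
     \<le> ennreal (5 * real CARD('n + 'n) * grad_const * (m / s) powr (1 / real (CARD('n + 'n) + 2)) * (wint h + wint H))"
proof -
  note [measurable] = hreg_borel[OF hdomD(1)[OF h]]
  have [measurable]: "cutoff k R \<in> borel_measurable borel" for R by (rule hreg_borel[OF hreg_cutoff])
  define J where "J = wint h + wint H"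
  define r where "r = (m / s) powr (1 / real (CARD('n + 'n) + 2))"
  have r: "r > 0" using m s by (simp add: r_def)
  have rs: "m / r ^ (CARD('n + 'n) + 2) = s"
  proof -
    have "r ^ (CARD('n + 'n) + 2) = r powr real (CARD('n + 'n) + 2)" by (rule powr_realpow[OF r, symmetric])
    also have "\<dots> = m / s" using m s unfolding r_def powr_powr by simp
    finally show ?thesis using m s by simp
  qed
  let ?c = "\<lambda>i. cutoff k (real (Suc i))"
  let ?v = "\<lambda>i z. h z * ?c i z * (wt z * damp z)"
  show ?thesis
    unfolding J_def[symmetric] r_def[symmetric]
  proof (rule nn_integral_tendsto_le[where f = "\<lambda>i z. ?v i z - s"])
    show "(\<lambda>i. ?v i z - s) \<longlonglongrightarrow> h z * wt z * damp z - s" for z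
      using tendsto_diff[OF tendsto_mult[OF tendsto_mult[OF tendsto_const[of "h z"] cutoff_tendsto[of k z]] tendsto_const[of "wt z * damp z"]] tendsto_const[of s]]
      by (simp add: mult.assoc)
    fix i
    have R: "real (Suc i) \<ge> 1" by simp
    define v where "v = ?v i"
    define K where "K j = (\<integral>z. \<bar>hderiv k j v z\<bar> \<partial>lborel)" for j
    have vr: "hreg k v"
      unfolding v_def damp_def by (intro hreg_mult hdomD(1)[OF h] hreg_cutoff hreg_wt hreg_P_powr)
    have supp: "norm z > 3 * real (Suc i) \<Longrightarrow> v z = 0" for z
      using cutoff_support[of "real (Suc i)" z k] by (simp add: v_def)
    have v0: "v z \<ge> 0" and vle: "v z \<le> h z * wt z" for z
    proof -
      have h0: "h z \<ge> 0" by (rule hdomD(2)[OF h])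
      show "v z \<ge> 0" unfolding v_def using h0 cutoff_nonneg[of k "real (Suc i)" z] wt_pos[of z] damp_pos[of z] by simp
      have "h z * ?c i z * (wt z * damp z) \<le> h z * 1 * (wt z * 1)"
        using h0 cutoff_nonneg[of k "real (Suc i)" z] cutoff_le_1[OF R, of k z] wt_pos[of z] damp_pos[of z] damp_le_1[of z]
        by (intro mult_mono) auto
      then show "v z \<le> h z * wt z" by (simp add: v_def)
    qed
    interpret horizontal_modulus k v K
    proof
      show "v \<in> borel_measurable borel" by (rule hreg_borel[OF vr])
      show "K j \<ge> 0" for j by (simp add: K_def)
      show "rdist k v (s *\<^sub>R axis j 1, 0) \<le> ennreal (\<bar>s\<bar> * K j)" for s j
        using hderiv_integral(3)[OF vr supp, where s=s and j=j]
        by (simp add: rdist_def K_def hflow_eq_mult)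
    qed
    have K: "K j \<le> grad_const * J" for j
    proof -
      have "K j \<le> (\<integral>z. grad_const * (h z * wt z + H z * wt z) \<partial>lborel)"
        unfolding K_def using damped_gradient_le[OF h R, of j] hi Hi hderiv_integral(1)[OF vr supp, where j=j]
        by (intro integral_mono_AE integrable_mult_right Bochner_Integration.integrable_add integrable_abs) (simp_all add: v_def)
      also have "\<dots> = grad_const * J" using hi Hi by (simp add: J_def)
      finally show ?thesis .
    qed
    have "(\<integral>\<^sup>+z. ennreal (v z) \<partial>lborel) \<le> (\<integral>\<^sup>+z. ennreal (h z * wt z) \<partial>lborel)"
      by (intro nn_integral_mono ennreal_leI vle)
    also have "\<dots> = ennreal (wint h)"
    proof (rule nn_integral_eq_integral[OF hi AE_I2])
      show "0 \<le> h z * wt z" for z using hdomD(2)[OF h, of z] wt_pos[of z] by simp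
    qed
    also have "\<dots> \<le> ennreal m" using m by (intro ennreal_leI)
    finally have "(\<integral>\<^sup>+z. ennreal (v z) \<partial>lborel) \<le> ennreal m" .
    from truncation_bound[OF v0 this _ r] m have "(\<integral>\<^sup>+z. ennreal (v z - s) \<partial>lborel) \<le> ennreal (5 * r * (\<Sum>j\<in>UNIV. K j))"
      by (simp only: rs less_imp_le)
    also have "\<dots> \<le> ennreal (5 * real CARD('n + 'n) * grad_const * r * J)"
    proof (rule ennreal_leI)
      have "(\<Sum>j\<in>UNIV. K j) \<le> of_nat CARD('n + 'n) * (grad_const * J)" by (intro sum_bounded_above K)
      then have "5 * r * (\<Sum>j\<in>UNIV. K j) \<le> 5 * r * (of_nat CARD('n + 'n) * (grad_const * J))"
        using r by (intro mult_left_mono) auto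
      then show "5 * r * (\<Sum>j\<in>UNIV. K j) \<le> 5 * real CARD('n + 'n) * grad_const * r * J" by (simp add: algebra_simps)
    qed
    finally show "(\<integral>\<^sup>+z. ennreal (?v i z - s) \<partial>lborel) \<le> ennreal (5 * real CARD('n + 'n) * grad_const * r * J)"
      by (simp add: v_def)
  qed measurable
qed

end

text \<open>A single term suffices, the level with x/4 <= 2^i <= x/2. There x <= 2 (x - 2^i) and
  x^\<epsilon> <= 4 (2^i)^\<epsilon>, whence the 8. The other terms are nonnegative because
  \<open>ennreal\<close> takes positive parts.\<close>

lemma powr_le_dyadic_sum:
  fixes x \<epsilon> :: real
  assumes x: "x \<ge> 2" and \<epsilon>: "0 < \<epsilon>" "\<epsilon> \<le> 1"
  shows "ennreal (x powr (1 + \<epsilon>)) \<le> 8 * (\<Sum>i. ennreal (2 powr (\<epsilon> * real i)) * ennreal (x - 2 ^ i))"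
proof -
  define i where "i = nat \<lfloor>log 2 (x / 2)\<rfloor>"
  have l: "0 \<le> log 2 (x / 2)" using x by simp
  have i: "real i \<le> log 2 (x / 2)" "log 2 (x / 2) < real i + 1"
    using l by (simp_all add: i_def)
  have pow: "(2::real) ^ i = 2 powr real i" by (simp add: powr_realpow)
  have lo: "2 ^ i \<le> x / 2" and hi: "x / 4 \<le> 2 ^ i"
  proof -
    have "2 powr real i \<le> 2 powr log 2 (x / 2)" using i by (intro powr_mono) auto
    then show "2 ^ i \<le> x / 2" using x by (simp add: pow)
    have "2 powr log 2 (x / 2) \<le> 2 powr (real i + 1)" using i by (intro powr_mono) auto
    then show "x / 4 \<le> 2 ^ i" using x by (simp add: pow powr_add)
  qed
  have "x powr (1 + \<epsilon>) = 4 powr \<epsilon> * (x / 4) powr \<epsilon> * x"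
    using x by (simp add: powr_divide powr_add)
  also have "\<dots> \<le> 4 * (2 ^ i) powr \<epsilon> * (2 * (x - 2 ^ i))"
  proof (intro mult_mono)
    show "(4::real) powr \<epsilon> \<le> 4" using powr_mono[of \<epsilon> 1 "4::real"] \<epsilon> by simp
    show "(x / 4) powr \<epsilon> \<le> (2 ^ i) powr \<epsilon>" using hi x \<epsilon> by (intro powr_mono2) auto
  qed (use lo x in auto)
  also have "(2 ^ i) powr \<epsilon> = 2 powr (\<epsilon> * real i)" unfolding pow powr_powr by (simp add: mult.commute)
  finally have "ennreal (x powr (1 + \<epsilon>)) \<le> ennreal (8 * (2 powr (\<epsilon> * real i) * (x - 2 ^ i)))"
    by (intro ennreal_leI) (simp add: algebra_simps)
  also have "\<dots> = 8 * (ennreal (2 powr (\<epsilon> * real i)) * ennreal (x - 2 ^ i))"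
    using lo x by (simp add: ennreal_mult)
  also have "\<dots> \<le> 8 * (\<Sum>i. ennreal (2 powr (\<epsilon> * real i)) * ennreal (x - 2 ^ i))"
    using sum_le_suminf[of "\<lambda>i. ennreal (2 powr (\<epsilon> * real i)) * ennreal (x - 2 ^ i)" "{i}"]
    by (intro mult_left_mono) auto
  finally show ?thesis .
qed

context heis_potential
begin

text \<open>Half of the decay is spent: as 1/(2n+2) = 2 \<epsilon>, the level 2^i contributes
  2^(\<epsilon> i) 2^(-2 \<epsilon> i), a geometric series of ratio 2^(-\<epsilon>). The constant
  depends on the pair only through the mass bound \<open>m\<close>.\<close>

lemma damped_power_bound:
  assumes m: "m > 0"
  defines "\<epsilon> \<equiv> 1 / (2 * real (CARD('n + 'n) + 2))"
  obtains C where "C \<ge> 0"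
    "\<And>h H. hdom k h H \<Longrightarrow> wintegrable h \<Longrightarrow> wintegrable H \<Longrightarrow>
      (wint h) \<le> m \<Longrightarrow>
      (\<integral>\<^sup>+z. ennreal (if h z * wt z * damp z \<ge> 2 then (h z * wt z * damp z) powr (1 + \<epsilon>) else 0) \<partial>lborel)
        \<le> ennreal (C * (wint h + wint H))"
proof -
  define \<rho> where "\<rho> = 2 powr (- \<epsilon>)"
  define A where "A = 5 * real CARD('n + 'n) * grad_const * m powr (1 / real (CARD('n + 'n) + 2))"
  have \<epsilon>: "0 < \<epsilon>" "\<epsilon> \<le> 1" "1 / real (CARD('n + 'n) + 2) = 2 * \<epsilon>" by (simp_all add: \<epsilon>_def field_simps)
  have \<rho>: "0 < \<rho>" "\<rho> < 1" using powr_less_mono[of "- \<epsilon>" 0 "2::real"] \<epsilon> by (simp_all add: \<rho>_def)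
  have A: "A \<ge> 0" using grad_const_pos by (simp add: A_def)
  show ?thesis
  proof (rule that[of "8 * A / (1 - \<rho>)"])
    show "8 * A / (1 - \<rho>) \<ge> 0" using A \<rho> by simp
    fix h H
    assume h: "hdom k h H" and hi: "wintegrable h" and Hi: "wintegrable H"
      and hm: "(wint h) \<le> m"
    note [measurable] = hreg_borel[OF hdomD(1)[OF h]]
    define J where "J = wint h + wint H"
    have J: "J \<ge> 0"
      unfolding J_def using hdomD(2,4)[OF h] by (auto intro!: add_nonneg_nonneg integral_nonneg_AE AE_I2 mult_nonneg_nonneg less_imp_le[OF wt_pos])
    define v where "v z = h z * wt z * damp z" for z
    have [measurable]: "v \<in> borel_measurable borel" unfolding v_def by measurable
    have summand: "ennreal (2 powr (\<epsilon> * real i)) * (\<integral>\<^sup>+z. ennreal (v z - 2 ^ i) \<partial>lborel) \<le> ennreal (A * J * \<rho> ^ i)" for i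
    proof -
      have "ennreal (2 powr (\<epsilon> * real i)) * (\<integral>\<^sup>+z. ennreal (v z - 2 ^ i) \<partial>lborel)
         \<le> ennreal (2 powr (\<epsilon> * real i)) * ennreal (5 * real CARD('n + 'n) * grad_const * (m / 2 ^ i) powr (1 / real (CARD('n + 'n) + 2)) * J)"
        unfolding v_def J_def by (intro mult_left_mono damped_truncation_bound h hi Hi hm m) auto
      also have "\<dots> = ennreal (2 powr (\<epsilon> * real i) * (5 * real CARD('n + 'n) * grad_const * (m / 2 ^ i) powr (1 / real (CARD('n + 'n) + 2)) * J))"
        by (simp add: ennreal_mult')
      also have "2 powr (\<epsilon> * real i) * (5 * real CARD('n + 'n) * grad_const * (m / 2 ^ i) powr (1 / real (CARD('n + 'n) + 2)) * J) = A * J * \<rho> ^ i"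
      proof -
        have "(m / 2 ^ i) powr (1 / real (CARD('n + 'n) + 2)) = m powr (1 / real (CARD('n + 'n) + 2)) * 2 powr (- (2 * \<epsilon> * real i))"
          using m unfolding \<epsilon>(3) by (simp add: powr_divide powr_minus_divide powr_powr mult.commute flip: powr_realpow)
        moreover have "2 powr (\<epsilon> * real i) * 2 powr (- (2 * \<epsilon> * real i)) = \<rho> ^ i"
          by (simp add: \<rho>_def powr_powr powr_add[symmetric] flip: powr_realpow)
        ultimately show ?thesis by (simp add: A_def algebra_simps)
      qed
      finally show ?thesis .
    qed
    have "(\<integral>\<^sup>+z. ennreal (if v z \<ge> 2 then v z powr (1 + \<epsilon>) else 0) \<partial>lborel)
        \<le> (\<integral>\<^sup>+z. 8 * (\<Sum>i. ennreal (2 powr (\<epsilon> * real i)) * ennreal (v z - 2 ^ i)) \<partial>lborel)"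
      using \<epsilon> by (intro nn_integral_mono) (auto intro!: powr_le_dyadic_sum)
    also have "\<dots> = 8 * (\<integral>\<^sup>+z. (\<Sum>i. ennreal (2 powr (\<epsilon> * real i)) * ennreal (v z - 2 ^ i)) \<partial>lborel)"
      by (rule nn_integral_cmult) measurable
    also have "(\<integral>\<^sup>+z. (\<Sum>i. ennreal (2 powr (\<epsilon> * real i)) * ennreal (v z - 2 ^ i)) \<partial>lborel)
        = (\<Sum>i. \<integral>\<^sup>+z. ennreal (2 powr (\<epsilon> * real i)) * ennreal (v z - 2 ^ i) \<partial>lborel)"
      by (rule nn_integral_suminf) measurable
    also have "\<dots> = (\<Sum>i. ennreal (2 powr (\<epsilon> * real i)) * (\<integral>\<^sup>+z. ennreal (v z - 2 ^ i) \<partial>lborel))"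
      by (intro suminf_cong nn_integral_cmult) measurable
    also have "\<dots> \<le> (\<Sum>i. ennreal (A * J * \<rho> ^ i))" by (intro suminf_le summand) auto
    also have "\<dots> = ennreal (\<Sum>i. A * J * \<rho> ^ i)"
      using A J \<rho> by (intro suminf_ennreal2) (auto intro!: summable_mult summable_geometric)
    also have "(\<Sum>i. A * J * \<rho> ^ i) = A * J * (1 / (1 - \<rho>))"
      using \<rho> by (subst suminf_mult) (auto simp: suminf_geometric summable_geometric)
    also have "8 * ennreal (A * J * (1 / (1 - \<rho>))) = ennreal (8 * A / (1 - \<rho>) * J)"
      using A J \<rho> by (subst ennreal_numeral[symmetric], subst ennreal_mult[symmetric]) auto
    finally show "(\<integral>\<^sup>+z. ennreal (if h z * wt z * damp z \<ge> 2 then (h z * wt z * damp z) powr (1 + \<epsilon>) else 0) \<partial>lborel)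
        \<le> ennreal (8 * A / (1 - \<rho>) * (wint h + wint H))"
      unfolding J_def v_def by this (rule mult_left_mono, simp_all)
  qed
qed

end

section \<open>The logarithmic estimate\<close>

text \<open>Splitting |x|^q into its two one-sided halves gives a single formula for the derivative,
  continuous through 0, whose square is free of signs.\<close>

lemma
  fixes q c :: real
  assumes q: "q > 1"
  defines "d \<equiv> \<lambda>x. c * (q * (max 0 x) powr (q - 1) - q * (max 0 (- x)) powr (q - 1))"
  shows DERIV_abs_powr: "((\<lambda>x. c * \<bar>x\<bar> powr q) has_real_derivative d x) (at x)"
    and continuous_dabs_powr: "continuous_on UNIV d"
    and dabs_powr_sq: "(d x)\<^sup>2 = (c * q * \<bar>x\<bar> powr (q - 1))\<^sup>2"
proof -
  have n: "((\<lambda>x. (max 0 (- x)) powr q) has_real_derivative q * (max 0 (- x)) powr (q - 1) * - 1) (at x)"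
    by (rule DERIV_chain2[OF DERIV_max_powr[OF q]]) (auto intro!: derivative_eq_intros)
  have "((\<lambda>x. c * ((max 0 x) powr q + (max 0 (- x)) powr q)) has_real_derivative
      c * (q * (max 0 x) powr (q - 1) + q * (max 0 (- x)) powr (q - 1) * - 1)) (at x)"
    by (intro DERIV_cmult DERIV_add DERIV_max_powr q n)
  moreover have "c * ((max 0 x) powr q + (max 0 (- x)) powr q) = c * \<bar>x\<bar> powr q" for x
    by (auto simp: max_def)
  ultimately show "((\<lambda>x. c * \<bar>x\<bar> powr q) has_real_derivative d x) (at x)" by (simp add: d_def)
  show "continuous_on UNIV d"
    unfolding d_def using q by (intro continuous_on_mult continuous_on_diff continuous_on_const continuous_on_powr' continuous_intros) auto
  show "(d x)\<^sup>2 = (c * q * \<bar>x\<bar> powr (q - 1))\<^sup>2"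
    by (cases "x \<ge> 0") (auto simp: d_def max_def power2_eq_square)
qed

text \<open>The squared derivative is at most c^2 q^2 |f|^q times |f|^(q-2) |grad f|^2. Replacing
  both |f| and |grad f| by the larger of the two bounds the last product by |f|^q + |grad f|^q,
  where q >= 2 keeps the exponents nonnegative. The factor \<open>c\<close> serves to normalise the
  mass.\<close>

lemma hdom_abs_powr:
  assumes f: "locally_lipschitz f" and q: "q \<ge> 2" and c: "c > 0"
  shows "hdom k (\<lambda>z. c * \<bar>f z\<bar> powr q) (\<lambda>z. c * q\<^sup>2 * (\<bar>f z\<bar> powr q + subgrad_norm k f z powr q))"
  unfolding hdom_def
proof (intro conjI allI)
  have fr: "hreg k f" by (rule locally_lipschitz_hreg[OF f])
  note [measurable] = hreg_borel[OF fr] borel_measurable_hderiv[OF hreg_continuous[OF fr]]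
  have q1: "q > 1" using q by simp
  show "hreg k (\<lambda>z. c * \<bar>f z\<bar> powr q)"
    by (rule hreg_compose[OF fr DERIV_abs_powr[OF q1] continuous_dabs_powr[OF q1]])
  show "0 \<le> c * \<bar>f z\<bar> powr q" for z using c by simp
  show "(\<lambda>z. c * q\<^sup>2 * (\<bar>f z\<bar> powr q + subgrad_norm k f z powr q)) \<in> borel_measurable borel"
    unfolding subgrad_norm_def by measurable
  show "0 \<le> c * q\<^sup>2 * (\<bar>f z\<bar> powr q + subgrad_norm k f z powr q)" for z using c by simp
  fix j
  show "AE z in lborel. (hderiv k j (\<lambda>z. c * \<bar>f z\<bar> powr q) z)\<^sup>2 \<le> c * \<bar>f z\<bar> powr q * (c * q\<^sup>2 * (\<bar>f z\<bar> powr q + subgrad_norm k f z powr q))"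
    using hreg_AE[OF fr, of j]
  proof eventually_elim
    case (elim z)
    define F where "F = \<bar>f z\<bar>"
    define G where "G = subgrad_norm k f z"
    have G0: "G \<ge> 0" by (simp add: G_def subgrad_norm_def sum_nonneg)
    have dG: "(hderiv k j f z)\<^sup>2 \<le> G\<^sup>2"
      unfolding G_def subgrad_norm_def by (auto simp: sum_nonneg intro!: member_le_sum)
    let ?d = "c * (q * (max 0 (f z)) powr (q - 1) - q * (max 0 (- f z)) powr (q - 1))"
    have "hderiv k j (\<lambda>z. c * \<bar>f z\<bar> powr q) z = ?d * hderiv k j f z"
      by (intro hderiv_eqI has_hderiv_compose[OF has_hderiv_hderiv[OF elim] DERIV_abs_powr[OF q1]])
    then have "(hderiv k j (\<lambda>z. c * \<bar>f z\<bar> powr q) z)\<^sup>2 = (c * q * F powr (q - 1))\<^sup>2 * (hderiv k j f z)\<^sup>2"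
      by (simp only: power_mult_distrib[of ?d] dabs_powr_sq[OF q1] F_def)
    also have "\<dots> \<le> (c * q * F powr (q - 1))\<^sup>2 * G\<^sup>2" using dG by (intro mult_left_mono) auto
    also have "\<dots> \<le> c * F powr q * (c * q\<^sup>2 * (F powr q + G powr q))"
    proof (cases "F = 0")
      case True then show ?thesis by simp
    next
      case False
      then have F: "F > 0" by (simp add: F_def)
      have e: "(F powr (q - 1))\<^sup>2 = F powr q * F powr (q - 2)"
        unfolding power2_eq_square powr_add[symmetric] by (simp add: field_simps)
      have "F powr (q - 2) * G\<^sup>2 \<le> F powr q + G powr q"
      proof (cases "G \<le> F")
        case True
        have "F powr (q - 2) * G\<^sup>2 \<le> F powr (q - 2) * F powr 2"
          using True G0 F by (intro mult_left_mono) (auto simp: power_mono)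
        also have "\<dots> = F powr q" by (simp only: powr_add[symmetric]) simp
        finally show ?thesis by (simp add: add_increasing2)
      next
        case False
        then have "F powr (q - 2) * G\<^sup>2 \<le> G powr (q - 2) * G powr 2"
          using q F by (intro mult_mono powr_mono2) auto
        also have "\<dots> = G powr q" by (simp only: powr_add[symmetric]) simp
        finally show ?thesis by (simp add: add_increasing)
      qed
      then have "c\<^sup>2 * q\<^sup>2 * F powr q * (F powr (q - 2) * G\<^sup>2) \<le> c\<^sup>2 * q\<^sup>2 * F powr q * (F powr q + G powr q)"
        by (intro mult_left_mono) auto
      then show ?thesis unfolding power_mult_distrib e by (simp add: power2_eq_square algebra_simps)
    qed
    finally show ?case by (simp add: F_def G_def)
  qed
qed

lemma powr_add_le:
  fixes a b \<beta> :: real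
  assumes "a \<ge> 0" "b \<ge> 0" "0 < \<beta>" "\<beta> \<le> 1"
  shows "(a + b) powr \<beta> \<le> 2 * (a powr \<beta> + b powr \<beta>)"
proof -
  have "(a + b) powr \<beta> \<le> (2 * max a b) powr \<beta>" using assms by (intro powr_mono2) auto
  also have "\<dots> = 2 powr \<beta> * max a b powr \<beta>" using assms by (simp add: powr_mult)
  also have "\<dots> \<le> 2 * (a powr \<beta> + b powr \<beta>)"
  proof (intro mult_mono)
    show "(2::real) powr \<beta> \<le> 2" using powr_mono[of \<beta> 1 "2::real"] assms by simp
    show "max a b powr \<beta> \<le> a powr \<beta> + b powr \<beta>" by (simp add: max_def)
  qed auto
  finally show ?thesis .
qed

lemma powr_le_one_plus:
  fixes x \<beta> :: real
  assumes "x \<ge> 0" "0 < \<beta>" "\<beta> \<le> 1"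
  shows "x powr \<beta> \<le> 1 + x"
proof (cases "x \<le> 1")
  case True
  then show ?thesis using powr_mono2[of \<beta> x 1] assms by simp
next
  case False
  then show ?thesis using powr_mono[of \<beta> 1 x] assms by simp
qed

context heis_potential
begin

text \<open>The choice of \<open>\<Gamma>\<close> makes \<open>v powr (1 + \<epsilon>) = u * q powr \<epsilon>\<close> for \<open>u = h exp (- U)\<close> and \<open>q = u P\<^bsup>-\<Gamma>\<^esup>\<close>,
  so that \<open>u ln q\<close> is bounded by \<open>v powr (1 + \<epsilon>) / \<epsilon>\<close>.\<close>

lemma entropy_integrand_bound:
  fixes h \<beta> \<epsilon> :: real and z :: "'n heis"
  assumes h: "h \<ge> 0" and \<beta>: "0 < \<beta>" "\<beta> * p \<le> p - 3" and \<epsilon>: "0 < \<epsilon>" "\<epsilon> \<le> 1"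
  defines "\<Gamma> \<equiv> p / 4 * (1 + \<epsilon>) / \<epsilon>"
  defines "v \<equiv> h * wt z * damp z"
  shows "h * \<bar>ln h\<bar> powr \<beta> * wt z \<le>
    2 * wt z + 2 * (\<Gamma> + \<alpha> * 2 powr (p / 2)) powr \<beta> * (h * Wt z * wt z) + (2 + 4 / \<epsilon>) * (h * wt z)
    + 2 / \<epsilon> * (if v \<ge> 2 then v powr (1 + \<epsilon>) else 0)"
proof -
  define X where "X = (if v \<ge> 2 then v powr (1 + \<epsilon>) else 0)"
  define K where "K = \<Gamma> + \<alpha> * 2 powr (p / 2)"
  define u where "u = h * wt z"
  have w: "wt z > 0" by (rule wt_pos)
  have \<beta>1: "\<beta> \<le> 1"
  proof (rule ccontr)
    assume "\<not> \<beta> \<le> 1"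
    then have "1 * p \<le> \<beta> * p" using p by (intro mult_right_mono) auto
    then show False using \<beta>(2) by simp
  qed
  have \<Gamma>: "\<Gamma> > 0" using \<epsilon> p by (simp add: \<Gamma>_def)
  have K: "K > 0" using \<Gamma> \<alpha> by (simp add: K_def add_pos_pos)
  have u0: "u \<ge> 0" using h w by (simp add: u_def)
  have X0: "X \<ge> 0" by (simp add: X_def)
  have W0: "h * Wt z * wt z \<ge> 0" using h w Wt_pos[of z] by simp
  have "h * \<bar>ln h\<bar> powr \<beta> * wt z \<le> 2 * wt z + 2 * K powr \<beta> * (h * Wt z * wt z) + (2 + 4 / \<epsilon>) * u + 2 / \<epsilon> * X"
  proof (cases "h < 1")
    case True
    \<comment> \<open>Small values are harmless: |ln h| <= 1/h - 1 gives h |ln h|^\<beta> <=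
      1.\<close>
    have "h * \<bar>ln h\<bar> powr \<beta> \<le> 2"
    proof (cases "h = 0")
      case False
      then have h: "0 < h" using h by simp
      have "\<bar>ln h\<bar> powr \<beta> \<le> 1 + \<bar>ln h\<bar>" using \<beta> \<beta>1 by (intro powr_le_one_plus) auto
      also have "\<bar>ln h\<bar> \<le> 1 / h - 1"
        using True h ln_le_minus_one[of "1 / h"] by (simp add: ln_div)
      finally have "h * \<bar>ln h\<bar> powr \<beta> \<le> h * (1 / h)" using h by (intro mult_left_mono) auto
      then show ?thesis using h by simp
    qed simp
    then have "h * \<bar>ln h\<bar> powr \<beta> * wt z \<le> 2 * wt z" using w by (intro mult_right_mono) auto
    moreover have "0 \<le> 2 * K powr \<beta> * (h * Wt z * wt z)" using W0 by simp
    moreover have "0 \<le> (2 + 4 / \<epsilon>) * u" using u0 \<epsilon> by simp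
    moreover have "0 \<le> 2 / \<epsilon> * X" using X0 \<epsilon> by simp
    ultimately show ?thesis by linarith
  next
    case False
    then have h1: "h \<ge> 1" by simp
    define P where "P = hP k z"
    have P: "P \<ge> 1" by (simp add: P_def hP_ge_1)
    have u: "u > 0" using h1 w by (simp add: u_def)
    define q where "q = u * P powr (- \<Gamma>)"
    have q: "q > 0" using u P by (simp add: q_def)
    define L where "L = max 0 (ln q)"
    \<comment> \<open>The first two terms are at most multiples of P^(p/4) and fall to the weight
      \<open>Wt\<close>; only \<open>ln q\<close> needs the higher integrability.\<close>
    have lnh: "ln h = U z + \<Gamma> * ln P + ln q"
    proof -
      have "ln u = ln h - U z" unfolding u_def using h1 w by (subst ln_mult) (auto simp: wt_def)
      moreover have "ln q = ln u - \<Gamma> * ln P" unfolding q_def using u P by (subst ln_mult) (auto simp: ln_powr)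
      ultimately show ?thesis by simp
    qed
    have PP: "P \<le> P powr (p / 4)" using powr_mono[of 1 "p / 4" P] P p by simp
    have "ln P \<le> P powr (p / 4)" using ln_le_minus_one[of P] P PP by linarith
    then have 1: "\<Gamma> * ln P \<le> \<Gamma> * P powr (p / 4)" using \<Gamma> by (intro mult_left_mono) auto
    have 2: "U z \<le> \<alpha> * 2 powr (p / 2) * P powr (p / 4)"
    proof -
      note U_le_S[of z]
      also have "hS k z powr (p / 2) \<le> (P powr (1/2)) powr (p / 2)"
        using hS_le_P[of k z] hS_nonneg[of k z] p by (intro powr_mono2) (auto simp: P_def)
      also have "\<dots> = P powr (p / 4)" by (simp add: powr_powr)
      finally show ?thesis using \<alpha> by (simp add: mult_left_mono)
    qed
    have "\<bar>ln h\<bar> \<le> K * P powr (p / 4) + L"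
    proof -
      have "\<bar>ln h\<bar> = ln h" using h1 by simp
      then show ?thesis using 1 2 lnh unfolding K_def L_def distrib_right by linarith
    qed
    then have "\<bar>ln h\<bar> powr \<beta> \<le> (K * P powr (p / 4) + L) powr \<beta>"
      using \<beta> by (intro powr_mono2) auto
    also have "\<dots> \<le> 2 * ((K * P powr (p / 4)) powr \<beta> + L powr \<beta>)"
      using K P \<beta> \<beta>1 by (intro powr_add_le) (auto simp: L_def)
    also have "(K * P powr (p / 4)) powr \<beta> = K powr \<beta> * P powr (p / 4 * \<beta>)"
      using K P by (simp add: powr_mult powr_powr)
    \<comment> \<open>The bound on \<beta> enters here, as \<beta> p <= p - 3 <= p - 2.\<close>
    also have "P powr (p / 4 * \<beta>) \<le> Wt z"
      unfolding Wt_def P_def[symmetric] using P \<beta>(2) by (intro powr_mono) (auto simp: mult.commute)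
    also have "L powr \<beta> \<le> 1 + L" using \<beta> \<beta>1 by (intro powr_le_one_plus) (auto simp: L_def)
    finally have "\<bar>ln h\<bar> powr \<beta> \<le> 2 * (K powr \<beta> * Wt z + (1 + L))" by (simp add: mult_left_mono)
    then have "\<bar>ln h\<bar> powr \<beta> * u \<le> 2 * (K powr \<beta> * Wt z + (1 + L)) * u"
      using u by (intro mult_right_mono) auto
    then have main: "h * \<bar>ln h\<bar> powr \<beta> * wt z \<le> 2 * K powr \<beta> * (h * Wt z * wt z) + 2 * u + 2 * (u * L)"
      by (simp add: u_def algebra_simps)
    have v: "v = u * P powr (- p / 4)" by (simp add: v_def u_def damp_def P_def)
    have vq: "v powr (1 + \<epsilon>) = u * q powr \<epsilon>"
    proof -
      have e: "- p / 4 * (1 + \<epsilon>) = - \<Gamma> * \<epsilon>" using \<epsilon> by (simp add: \<Gamma>_def)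
      have "v powr (1 + \<epsilon>) = u powr (1 + \<epsilon>) * P powr (- p / 4 * (1 + \<epsilon>))"
        unfolding v using u P by (simp add: powr_mult powr_powr)
      also have "\<dots> = u * (u powr \<epsilon> * P powr (- \<Gamma> * \<epsilon>))"
        unfolding e using u by (simp add: powr_add)
      also have "\<dots> = u * q powr \<epsilon>"
        unfolding q_def using u P by (simp add: powr_mult powr_powr)
      finally show ?thesis .
    qed
    \<comment> \<open>Below the level 2 the power is at most 2 v, hence at most 2 u because
      \<open>damp\<close> is at most 1.\<close>
    have vX: "v powr (1 + \<epsilon>) \<le> X + 2 * u"
    proof (cases "v \<ge> 2")
      case True then show ?thesis using u by (simp add: X_def)
    next
      case False
      have vpos: "v > 0" unfolding v using u P by simp
      have vu: "v \<le> u"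
        unfolding v_def u_def[symmetric] using damp_le_1[of z] u by (simp add: mult_left_le)
      have "v powr (1 + \<epsilon>) = v * v powr \<epsilon>" using vpos by (simp add: powr_add)
      also have "\<dots> \<le> v * 2"
      proof (intro mult_left_mono)
        have "v powr \<epsilon> \<le> 2 powr \<epsilon>" using False vpos \<epsilon> by (intro powr_mono2) auto
        also have "\<dots> \<le> 2" using powr_mono[of \<epsilon> 1 "2::real"] \<epsilon> by simp
        finally show "v powr \<epsilon> \<le> 2" .
      qed (use vpos in auto)
      finally show ?thesis using vu X0 by linarith
    qed
    have "u * L \<le> 1 / \<epsilon> * (X + 2 * u)"
    proof -
      have "L \<le> q powr \<epsilon> / \<epsilon>"
      proof -
        have "\<epsilon> * ln q \<le> q powr \<epsilon>" using ln_le_minus_one[of "q powr \<epsilon>"] q by (simp add: ln_powr)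
        then have "ln q \<le> q powr \<epsilon> / \<epsilon>" using \<epsilon> by (simp add: pos_le_divide_eq mult.commute)
        then show ?thesis using \<epsilon> by (simp add: L_def)
      qed
      then have "u * L \<le> u * (q powr \<epsilon> / \<epsilon>)" using u by (intro mult_left_mono) auto
      also have "\<dots> = 1 / \<epsilon> * v powr (1 + \<epsilon>)" unfolding vq by simp
      also have "\<dots> \<le> 1 / \<epsilon> * (X + 2 * u)" using vX \<epsilon> by (intro mult_left_mono) auto
      finally show ?thesis .
    qed
    then have "2 * (u * L) \<le> 2 * (1 / \<epsilon> * (X + 2 * u))" by (rule mult_left_mono) simp
    also have "\<dots> = 2 / \<epsilon> * X + 4 / \<epsilon> * u" by (simp add: distrib_left)
    finally have "2 * (u * L) \<le> 2 / \<epsilon> * X + 4 / \<epsilon> * u" .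
    with main have "h * \<bar>ln h\<bar> powr \<beta> * wt z \<le> 2 * K powr \<beta> * (h * Wt z * wt z) + (2 + 4 / \<epsilon>) * u + 2 / \<epsilon> * X"
      unfolding distrib_right by linarith
    then show ?thesis using w by linarith
  qed
  then show ?thesis by (simp add: K_def u_def X_def)
qed

text \<open>Fixing the mass of \<open>h\<close> at \<open>Z\<close> fixes the constant of
  \<open>damped_power_bound\<close> and puts the contribution of the region h < 1, at most 2 Z, on
  the same footing as the other terms.\<close>

lemma entropy_bound:
  assumes \<beta>: "0 < \<beta>" "\<beta> * p \<le> p - 3" and wi: "integrable lborel wt"
  defines "Z \<equiv> \<integral>z. wt z \<partial>lborel"
  assumes Z: "Z > 0"
  obtains C where "C \<ge> 0"
    "\<And>h H. hdom k h H \<Longrightarrow> wintegrable h \<Longrightarrow> wintegrable H \<Longrightarrow>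
      (wint h) = Z \<Longrightarrow>
      (\<integral>\<^sup>+z. ennreal (h z * \<bar>ln (h z)\<bar> powr \<beta> * wt z) \<partial>lborel) \<le> ennreal (C * (Z + (wint H)))"
proof -
  define \<epsilon> where "\<epsilon> = 1 / (2 * real (CARD('n + 'n) + 2))"
  have \<epsilon>: "0 < \<epsilon>" "\<epsilon> \<le> 1" by (simp_all add: \<epsilon>_def field_simps)
  obtain C1 where C1: "C1 \<ge> 0" and b1: "\<And>h H. hdom k h H \<Longrightarrow> wintegrable h \<Longrightarrow> wintegrable H \<Longrightarrow>
      (\<integral>\<^sup>+z. ennreal (h z * Wt z * wt z) \<partial>lborel) \<le> ennreal (C1 * (wint h + wint H))"
    by (rule U_bound) (rule that)
  obtain C2 where C2: "C2 \<ge> 0" and b2: "\<And>h H. hdom k h H \<Longrightarrow> wintegrable h \<Longrightarrow> wintegrable H \<Longrightarrow>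
      (wint h) \<le> Z \<Longrightarrow>
      (\<integral>\<^sup>+z. ennreal (if h z * wt z * damp z \<ge> 2 then (h z * wt z * damp z) powr (1 + \<epsilon>) else 0) \<partial>lborel)
        \<le> ennreal (C2 * (wint h + wint H))"
    by (rule damped_power_bound[OF Z, folded \<epsilon>_def]) (rule that)
  define K where "K = 2 * (p / 4 * (1 + \<epsilon>) / \<epsilon> + \<alpha> * 2 powr (p / 2)) powr \<beta>"
  have K: "K \<ge> 0" by (simp add: K_def)
  show ?thesis
  proof (rule that[of "2 + K * C1 + (2 + 4 / \<epsilon>) + 2 / \<epsilon> * C2"])
    show "2 + K * C1 + (2 + 4 / \<epsilon>) + 2 / \<epsilon> * C2 \<ge> 0" using K C1 C2 \<epsilon> by simp
    fix h H
    assume h: "hdom k h H" and hi: "wintegrable h" and Hi: "wintegrable H"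
      and hZ: "(wint h) = Z"
    note [measurable] = hreg_borel[OF hdomD(1)[OF h]]
    have [measurable]: "Wt \<in> borel_measurable borel" unfolding Wt_def by (rule hreg_borel[OF hreg_P_powr])
    define J where "J = (wint H)"
    have J: "J \<ge> 0"
      unfolding J_def using hdomD(4)[OF h] by (auto intro!: integral_nonneg_AE AE_I2 mult_nonneg_nonneg less_imp_le[OF wt_pos])
    define X where "X z = (if h z * wt z * damp z \<ge> 2 then (h z * wt z * damp z) powr (1 + \<epsilon>) else 0)" for z
    have [measurable]: "X \<in> borel_measurable borel" unfolding X_def by measurable
    have nn: "0 \<le> wt z" "0 \<le> h z * Wt z * wt z" "0 \<le> h z * wt z" "0 \<le> X z" for z
      using hdomD(2)[OF h, of z] wt_pos[of z] Wt_pos[of z] by (simp_all add: X_def)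
    have "(\<integral>\<^sup>+z. ennreal (h z * \<bar>ln (h z)\<bar> powr \<beta> * wt z) \<partial>lborel)
      \<le> (\<integral>\<^sup>+z. ennreal 2 * ennreal (wt z) + ennreal K * ennreal (h z * Wt z * wt z) + ennreal (2 + 4 / \<epsilon>) * ennreal (h z * wt z) + ennreal (2 / \<epsilon>) * ennreal (X z) \<partial>lborel)"
    proof (rule nn_integral_mono)
      fix z
      have "ennreal (h z * \<bar>ln (h z)\<bar> powr \<beta> * wt z) \<le> ennreal (2 * wt z + K * (h z * Wt z * wt z) + (2 + 4 / \<epsilon>) * (h z * wt z) + 2 / \<epsilon> * X z)"
        using entropy_integrand_bound[OF hdomD(2)[OF h, of z] \<beta> \<epsilon>, of z] by (intro ennreal_leI) (simp add: K_def X_def)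
      also have "\<dots> = ennreal 2 * ennreal (wt z) + ennreal K * ennreal (h z * Wt z * wt z) + ennreal (2 + 4 / \<epsilon>) * ennreal (h z * wt z) + ennreal (2 / \<epsilon>) * ennreal (X z)"
        using nn[of z] K \<epsilon> by (simp only: ennreal_mult[symmetric] ennreal_plus[symmetric] mult_nonneg_nonneg add_nonneg_nonneg zero_le_numeral divide_nonneg_nonneg less_imp_le)
      finally show "ennreal (h z * \<bar>ln (h z)\<bar> powr \<beta> * wt z) \<le> \<dots>" .
    qed
    also have "\<dots> = ennreal 2 * (\<integral>\<^sup>+z. ennreal (wt z) \<partial>lborel) + ennreal K * (\<integral>\<^sup>+z. ennreal (h z * Wt z * wt z) \<partial>lborel)
        + ennreal (2 + 4 / \<epsilon>) * (\<integral>\<^sup>+z. ennreal (h z * wt z) \<partial>lborel) + ennreal (2 / \<epsilon>) * (\<integral>\<^sup>+z. ennreal (X z) \<partial>lborel)"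
      by (simp add: nn_integral_add nn_integral_cmult)
    also have "\<dots> \<le> ennreal 2 * ennreal (Z + J) + ennreal K * ennreal (C1 * (Z + J)) + ennreal (2 + 4 / \<epsilon>) * ennreal (Z + J) + ennreal (2 / \<epsilon>) * ennreal (C2 * (Z + J))"
    proof (intro add_mono mult_left_mono)
      have "(\<integral>\<^sup>+z. ennreal (wt z) \<partial>lborel) = ennreal Z" unfolding Z_def by (rule nn_integral_eq_integral[OF wi AE_I2[OF nn(1)]])
      then show "(\<integral>\<^sup>+z. ennreal (wt z) \<partial>lborel) \<le> ennreal (Z + J)" using J by (simp only:) (rule ennreal_leI, simp)
      have "(\<integral>\<^sup>+z. ennreal (h z * wt z) \<partial>lborel) = ennreal Z" unfolding hZ[symmetric] by (rule nn_integral_eq_integral[OF hi AE_I2[OF nn(3)]])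
      then show "(\<integral>\<^sup>+z. ennreal (h z * wt z) \<partial>lborel) \<le> ennreal (Z + J)" using J by (simp only:) (rule ennreal_leI, simp)
      show "(\<integral>\<^sup>+z. ennreal (h z * Wt z * wt z) \<partial>lborel) \<le> ennreal (C1 * (Z + J))"
        using b1[OF h hi Hi] by (simp only: hZ J_def)
      show "(\<integral>\<^sup>+z. ennreal (X z) \<partial>lborel) \<le> ennreal (C2 * (Z + J))"
        using b2[OF h hi Hi] unfolding X_def hZ J_def by simp
    qed auto
    also have "\<dots> = ennreal (2 * (Z + J) + K * (C1 * (Z + J)) + (2 + 4 / \<epsilon>) * (Z + J) + 2 / \<epsilon> * (C2 * (Z + J)))"
    proof -
      have "0 \<le> Z + J" using Z J by simp
      then show ?thesis using K C1 C2 \<epsilon>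
        by (simp only: ennreal_mult[symmetric] ennreal_plus[symmetric] mult_nonneg_nonneg add_nonneg_nonneg zero_le_numeral divide_nonneg_nonneg less_imp_le)
    qed
    also have "2 * (Z + J) + K * (C1 * (Z + J)) + (2 + 4 / \<epsilon>) * (Z + J) + 2 / \<epsilon> * (C2 * (Z + J))
        = (2 + K * C1 + (2 + 4 / \<epsilon>) + 2 / \<epsilon> * C2) * (Z + J)"
      by (simp only: distrib_right mult.assoc)
    finally show "(\<integral>\<^sup>+z. ennreal (h z * \<bar>ln (h z)\<bar> powr \<beta> * wt z) \<partial>lborel)
        \<le> ennreal ((2 + K * C1 + (2 + 4 / \<epsilon>) + 2 / \<epsilon> * C2) * (Z + (wint H)))"
      by (simp only: J_def)
  qed
qed

lemma heis_measure_eq: "heis_measure k \<alpha> p = density lborel (\<lambda>z. ennreal (wt z / heis_Z k \<alpha> p))"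
  by (simp add: heis_measure_def wt_def U_def)

lemma heis_Z_eq: "heis_Z k \<alpha> p = (\<integral>z. wt z \<partial>lborel)"
  by (simp add: heis_Z_def wt_def U_def)

end

text \<open>At the zeros of \<open>f\<close> the factor \<open>0 powr q\<close> is 0, so the
  integrand takes the value 0 there.\<close>

definition log_integrand :: "'a measure \<Rightarrow> real \<Rightarrow> real \<Rightarrow> ('a \<Rightarrow> real) \<Rightarrow> 'a \<Rightarrow> real" where
  "log_integrand \<mu> q \<beta> f z = \<bar>f z\<bar> powr q * \<bar>ln (\<bar>f z\<bar> powr q / (\<integral>w. \<bar>f w\<bar> powr q \<partial>\<mu>))\<bar> powr \<beta>"

context heis_potential
begin

text \<open>Both sides are homogeneous. Dividing |f|^q by its mean a gives \<open>h\<close> with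
  weighted mass \<open>Z\<close> and turns the logarithm into \<open>ln h\<close>; scaling back by a
  / Z yields the factor 1 + q^2, where q^2 comes from \<open>hdom_abs_powr\<close>.\<close>

theorem entropy_inequality:
  assumes \<beta>: "0 < \<beta>" "\<beta> * p \<le> p - 3" and q: "q \<ge> 2"
  defines "\<mu> \<equiv> heis_measure k \<alpha> p"
  obtains C where "C \<ge> 0"
    "\<And>f. locally_lipschitz f \<Longrightarrow> integrable \<mu> (\<lambda>z. \<bar>f z\<bar> powr q) \<Longrightarrow> integrable \<mu> (\<lambda>z. subgrad_norm k f z powr q) \<Longrightarrow>
      integrable \<mu> (log_integrand \<mu> q \<beta> f) \<and>
      (\<integral>z. log_integrand \<mu> q \<beta> f z \<partial>\<mu>) \<le> C * ((\<integral>z. \<bar>f z\<bar> powr q \<partial>\<mu>) + (\<integral>z. subgrad_norm k f z powr q \<partial>\<mu>))"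
proof -
  define Z where "Z = heis_Z k \<alpha> p"
  have Z0: "Z \<ge> 0"
    unfolding Z_def heis_Z_eq by (intro integral_nonneg_AE AE_I2 less_imp_le[OF wt_pos])
  have \<mu>: "\<mu> = density lborel (\<lambda>z. ennreal (wt z / Z))" by (simp add: \<mu>_def Z_def heis_measure_eq)
  have nn: "0 \<le> wt z / Z" for z using wt_pos[of z] Z0 by simp
  have int: "integrable \<mu> F \<longleftrightarrow> integrable lborel (\<lambda>z. wt z / Z * F z)"
    if "F \<in> borel_measurable borel" for F :: "'n heis \<Rightarrow> real"
    unfolding \<mu> using that nn by (subst integrable_density) auto
  have lint: "(\<integral>z. F z \<partial>\<mu>) = (\<integral>z. wt z / Z * F z \<partial>lborel)"
    if "F \<in> borel_measurable borel" for F :: "'n heis \<Rightarrow> real"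
    unfolding \<mu> using that nn by (subst integral_density) auto
  show ?thesis
  proof (cases "Z = 0")
    case True
    \<comment> \<open>This is the case of a non-integrable weight, in which \<open>\<mu>\<close> is the null measure because \<open>x / 0 = 0\<close>.\<close>
    show ?thesis
    proof (rule that[of 0])
      fix f :: "'n heis \<Rightarrow> real" assume f: "locally_lipschitz f"
      note [measurable] = borel_measurable_continuous_onI[OF locally_lipschitz_continuous[OF f]]
      have F: "log_integrand \<mu> q \<beta> f \<in> borel_measurable borel" unfolding log_integrand_def by measurable
      show "integrable \<mu> (log_integrand \<mu> q \<beta> f) \<and>
          (\<integral>z. log_integrand \<mu> q \<beta> f z \<partial>\<mu>) \<le> 0 * ((\<integral>z. \<bar>f z\<bar> powr q \<partial>\<mu>) + (\<integral>z. subgrad_norm k f z powr q \<partial>\<mu>))"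
        unfolding int[OF F] lint[OF F] True by simp
    qed simp
  next
    case False
    then have Z: "Z > 0" using Z0 by simp
    have Zeq: "Z = (\<integral>z. wt z \<partial>lborel)" by (simp add: Z_def heis_Z_eq)
    \<comment> \<open>A non-integrable function has Bochner integral 0, so a nonzero
      \<open>Z\<close> forces \<open>wt\<close> to be integrable.\<close>
    have wi: "integrable lborel wt" using False not_integrable_integral_eq unfolding Zeq by blast
    obtain C where C: "C \<ge> 0" and bd: "\<And>h H. hdom k h H \<Longrightarrow> wintegrable h \<Longrightarrow> wintegrable H \<Longrightarrow>
      (wint h) = Z \<Longrightarrow>
      (\<integral>\<^sup>+z. ennreal (h z * \<bar>ln (h z)\<bar> powr \<beta> * wt z) \<partial>lborel) \<le> ennreal (C * (Z + (wint H)))"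
      by (rule entropy_bound[OF \<beta> wi, folded Zeq, OF Z]) (rule that)
    show ?thesis
    proof (rule that[of "C * (1 + q\<^sup>2)"])
      show "C * (1 + q\<^sup>2) \<ge> 0" using C by simp
      fix f :: "'n heis \<Rightarrow> real"
      assume f: "locally_lipschitz f" and fi: "integrable \<mu> (\<lambda>z. \<bar>f z\<bar> powr q)"
        and gi: "integrable \<mu> (\<lambda>z. subgrad_norm k f z powr q)"
      have fc: "continuous_on UNIV f" by (rule locally_lipschitz_continuous[OF f])
      note [measurable] = borel_measurable_continuous_onI[OF fc] borel_measurable_hderiv[OF fc]
      define G where "G z = subgrad_norm k f z powr q" for z
      have G [measurable]: "G \<in> borel_measurable borel" unfolding G_def subgrad_norm_def by measurable
      define a where "a = (\<integral>z. \<bar>f z\<bar> powr q \<partial>\<mu>)"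
      define b where "b = (\<integral>z. G z \<partial>\<mu>)"
      have b: "b \<ge> 0" by (simp add: b_def G_def)
      have a0: "a \<ge> 0" by (simp add: a_def)
      define F where "F z = \<bar>f z\<bar> powr q * \<bar>ln (\<bar>f z\<bar> powr q / a)\<bar> powr \<beta>" for z
      have F [measurable]: "F \<in> borel_measurable borel" unfolding F_def by measurable
      have fm: "(\<lambda>z. \<bar>f z\<bar> powr q) \<in> borel_measurable borel" by measurable
      have fi': "integrable lborel (\<lambda>z. \<bar>f z\<bar> powr q * wt z)" and gi': "integrable lborel (\<lambda>z. G z * wt z)"
      proof -
        have "integrable lborel (\<lambda>z. Z * (wt z / Z * \<bar>f z\<bar> powr q))"
          using fi unfolding int[OF fm] by (rule integrable_mult_right)
        then show "integrable lborel (\<lambda>z. \<bar>f z\<bar> powr q * wt z)" using Z by (simp add: mult.commute)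
        have "integrable lborel (\<lambda>z. Z * (wt z / Z * G z))"
          using gi unfolding G_def[symmetric] int[OF G] by (rule integrable_mult_right)
        then show "integrable lborel (\<lambda>z. G z * wt z)" using Z by (simp add: mult.commute)
      qed
      have fa: "(\<integral>z. \<bar>f z\<bar> powr q * wt z \<partial>lborel) = Z * a" and gb: "(\<integral>z. G z * wt z \<partial>lborel) = Z * b"
        using Z unfolding a_def b_def lint[OF fm] lint[OF G] by (simp_all add: mult.commute)
      have "integrable \<mu> F \<and> (\<integral>z. F z \<partial>\<mu>) \<le> C * (1 + q\<^sup>2) * (a + b)"
      proof (cases "a = 0")
        case True
        \<comment> \<open>Division by 0 gives 0 and \<open>ln 0\<close> is 0, so the logarithmic
          factor vanishes everywhere.\<close>
        then have "F = (\<lambda>_. 0)" by (simp add: F_def fun_eq_iff)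
        then show ?thesis using True b C by simp
      next
        case False
        then have a: "a > 0" using a0 by simp
        define h where "h z = 1 / a * \<bar>f z\<bar> powr q" for z
        define H where "H z = 1 / a * q\<^sup>2 * (\<bar>f z\<bar> powr q + G z)" for z
        have hd: "hdom k h H" unfolding h_def H_def G_def using a by (intro hdom_abs_powr[OF f q]) simp
        have hi: "wintegrable h"
          using fi' unfolding h_def mult.assoc by (rule integrable_mult_right)
        have hZ: "(wint h) = Z"
          using a unfolding h_def mult.assoc by (simp add: fa)
        have Heq: "H z * wt z = 1 / a * q\<^sup>2 * (\<bar>f z\<bar> powr q * wt z + G z * wt z)" for z
          by (simp add: H_def distrib_right)
        have Hi: "wintegrable H"
          unfolding Heq by (intro integrable_mult_right Bochner_Integration.integrable_add fi' gi')
        have HI: "(wint H) = q\<^sup>2 * Z * (1 + b / a)"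
        proof -
          have "(wint H) = 1 / a * q\<^sup>2 * (Z * a + Z * b)"
            unfolding Heq integral_mult_right_zero Bochner_Integration.integral_add[OF fi' gi'] fa gb ..
          then show ?thesis using a by (simp add: field_simps)
        qed
        have Fh: "F z * wt z = a * (h z * \<bar>ln (h z)\<bar> powr \<beta> * wt z)" for z
          using a by (simp add: F_def h_def)
        have F0: "F z \<ge> 0" for z by (simp add: F_def)
        have "(\<integral>\<^sup>+z. ennreal (wt z / Z * F z) \<partial>lborel) = (\<integral>\<^sup>+z. ennreal (a / Z) * ennreal (h z * \<bar>ln (h z)\<bar> powr \<beta> * wt z) \<partial>lborel)"
        proof (rule nn_integral_cong)
          fix z
          have "wt z / Z * F z = a / Z * (h z * \<bar>ln (h z)\<bar> powr \<beta> * wt z)" using Fh[of z] by (simp add: mult.commute)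
          then show "ennreal (wt z / Z * F z) = ennreal (a / Z) * ennreal (h z * \<bar>ln (h z)\<bar> powr \<beta> * wt z)"
            using a Z by (simp only: ennreal_mult'[of "a / Z"] divide_nonneg_nonneg less_imp_le)
        qed
        also have "\<dots> = ennreal (a / Z) * (\<integral>\<^sup>+z. ennreal (h z * \<bar>ln (h z)\<bar> powr \<beta> * wt z) \<partial>lborel)"
          unfolding h_def by (rule nn_integral_cmult) measurable
        also have "\<dots> \<le> ennreal (a / Z) * ennreal (C * (Z + q\<^sup>2 * Z * (1 + b / a)))"
          using bd[OF hd hi Hi hZ] unfolding HI by (rule mult_left_mono) simp
        also have "\<dots> = ennreal (a / Z * (C * (Z + q\<^sup>2 * Z * (1 + b / a))))"
          using a Z by (intro ennreal_mult'[symmetric]) simp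
        also have "a / Z * (C * (Z + q\<^sup>2 * Z * (1 + b / a))) = C * (1 + q\<^sup>2) * a + C * q\<^sup>2 * b"
          using a Z by (simp add: field_simps)
        finally have le: "(\<integral>\<^sup>+z. ennreal (wt z / Z * F z) \<partial>lborel) \<le> ennreal (C * (1 + q\<^sup>2) * a + C * q\<^sup>2 * b)" .
        have nnF: "0 \<le> wt z / Z * F z" for z using nn[of z] F0[of z] by (rule mult_nonneg_nonneg)
        have I: "integrable lborel (\<lambda>z. wt z / Z * F z)"
        proof (rule integrableI_nonneg)
          show "(\<integral>\<^sup>+z. ennreal (wt z / Z * F z) \<partial>lborel) < \<infinity>"
            using le by (rule order_le_less_trans) simp
        qed (use nnF in auto)
        have "(\<integral>z. F z \<partial>\<mu>) \<le> C * (1 + q\<^sup>2) * a + C * q\<^sup>2 * b"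
        proof -
          have "ennreal (\<integral>z. wt z / Z * F z \<partial>lborel) \<le> ennreal (C * (1 + q\<^sup>2) * a + C * q\<^sup>2 * b)"
            using le nn_integral_eq_integral[OF I AE_I2[OF nnF]] by simp
          then show ?thesis unfolding lint[OF F] using a b C by (subst (asm) ennreal_le_iff) auto
        qed
        also have "\<dots> \<le> C * (1 + q\<^sup>2) * (a + b)" using C b by (simp add: algebra_simps)
        finally show ?thesis using I unfolding int[OF F] by blast
      qed
      then show "integrable \<mu> (log_integrand \<mu> q \<beta> f) \<and>
          (\<integral>z. log_integrand \<mu> q \<beta> f z \<partial>\<mu>) \<le> C * (1 + q\<^sup>2) * ((\<integral>z. \<bar>f z\<bar> powr q \<partial>\<mu>) + (\<integral>z. subgrad_norm k f z powr q \<partial>\<mu>))"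
        unfolding log_integrand_def F_def a_def b_def G_def .
    qed
  qed
qed

end

theorem corollary10:
  fixes k :: "'n::finite" and \<alpha> p \<beta> q :: real
  assumes "CARD('n) > 5" and "\<alpha> > 0" and "p \<ge> 4"
    and "0 < \<beta>" and "\<beta> \<le> (p - 3) / p" and "q \<ge> 2"
  shows "\<exists>C>0. \<exists>D>0. \<forall>f :: 'n heis \<Rightarrow> real.
           let \<mu> = heis_measure k \<alpha> p in
             locally_lipschitz f \<longrightarrow>
             integrable \<mu> (\<lambda>z. \<bar>f z\<bar> powr q) \<longrightarrow>
             integrable \<mu> (\<lambda>z. subgrad_norm k f z powr q) \<longrightarrow>
             integrable \<mu> (\<lambda>z. \<bar>f z\<bar> powr q *
               \<bar>ln (\<bar>f z\<bar> powr q / (\<integral>w. \<bar>f w\<bar> powr q \<partial>\<mu>))\<bar> powr \<beta>) \<and>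
             (\<integral>z. \<bar>f z\<bar> powr q *
               \<bar>ln (\<bar>f z\<bar> powr q / (\<integral>w. \<bar>f w\<bar> powr q \<partial>\<mu>))\<bar> powr \<beta> \<partial>\<mu>)
             \<le> C * (\<integral>z. \<bar>f z\<bar> powr q \<partial>\<mu>) + D * (\<integral>z. subgrad_norm k f z powr q \<partial>\<mu>)"
proof -
  interpret heis_potential k \<alpha> p by unfold_locales fact+
  have "\<beta> * p \<le> p - 3" using assms by (simp add: le_divide_eq)
  from entropy_inequality[OF assms(4) this assms(6)] obtain C where C: "C \<ge> 0" and
    le: "\<And>f :: 'n heis \<Rightarrow> real. let \<mu> = heis_measure k \<alpha> p in locally_lipschitz f \<longrightarrow> integrable \<mu> (\<lambda>z. \<bar>f z\<bar> powr q) \<longrightarrow>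
      integrable \<mu> (\<lambda>z. subgrad_norm k f z powr q) \<longrightarrow> integrable \<mu> (log_integrand \<mu> q \<beta> f) \<and>
      (\<integral>z. log_integrand \<mu> q \<beta> f z \<partial>\<mu>) \<le> C * ((\<integral>z. \<bar>f z\<bar> powr q \<partial>\<mu>) + (\<integral>z. subgrad_norm k f z powr q \<partial>\<mu>))"
    unfolding Let_def by blast
  show ?thesis
  \<comment> \<open>The constants have to be positive, while \<open>C\<close> is only
    nonnegative.\<close>
  proof (rule exI[of _ "C + 1"], intro conjI exI[of _ "C + 1"] allI)
    fix f :: "'n heis \<Rightarrow> real"
    define \<mu> where "\<mu> = heis_measure k \<alpha> p"
    show "let \<mu> = heis_measure k \<alpha> p in
             locally_lipschitz f \<longrightarrow>
             integrable \<mu> (\<lambda>z. \<bar>f z\<bar> powr q) \<longrightarrow>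
             integrable \<mu> (\<lambda>z. subgrad_norm k f z powr q) \<longrightarrow>
             integrable \<mu> (\<lambda>z. \<bar>f z\<bar> powr q *
               \<bar>ln (\<bar>f z\<bar> powr q / (\<integral>w. \<bar>f w\<bar> powr q \<partial>\<mu>))\<bar> powr \<beta>) \<and>
             (\<integral>z. \<bar>f z\<bar> powr q *
               \<bar>ln (\<bar>f z\<bar> powr q / (\<integral>w. \<bar>f w\<bar> powr q \<partial>\<mu>))\<bar> powr \<beta> \<partial>\<mu>)
             \<le> (C + 1) * (\<integral>z. \<bar>f z\<bar> powr q \<partial>\<mu>) + (C + 1) * (\<integral>z. subgrad_norm k f z powr q \<partial>\<mu>)"
      using le[of f] unfolding log_integrand_def Let_def \<mu>_def[symmetric] by (auto simp: algebra_simps intro!: add_increasing)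
  qed (use C in auto)
qed

end
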